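(* Assume: (i) (Lipschitz loss) for all $f_1,f_2\in F$, $x\in\mathcal X$, $y\in\mathbb R$: $|\ell(f_1(x),y)-\ell(f_2(x),y)|\le|f_1(x)-f_2(x)|$; (ii) (Bernstein condition) $\kappa\ge1$ and $A>0$ are such that $\|f-f^*\|_{L_2}^{2\kappa}\le A\,\mathcal E(f)$ for every $f\in F$; (iii) (boundedness) there is $b>0$ such that $\|f\|_{L_\infty}\le b$ for all $f\in F$. Let $C=1920/7$, define $r(\rho)=\left(\frac{C\,A\,\mathrm{Rad}(B)\,\rho}{\sqrt N}\right)^{1/(2\kappa)}$ for $\rho\ge0$, let $\rho^*>0$ satisfy the sparsity equation $\Delta(\rho^* )\ge\frac45\rho^*$ (with $\Delta$ defined from this $r$), and let $\lambda=\frac{720\,\mathrm{Rad}(B)}{7\sqrt N}$. Let $\hat f\in\operatorname*{argmin}_{f\in F}\{P_N\ell_f+\lambda\|f\|\}$. Then, with probability larger than $$1-C_1\exp\left(-C_2\,N^{1/(2\kappa)}\,(\rho^*\,\mathrm{Rad}(B))^{(2\kappa-1)/\kappa}\right),$$ one has $$\|\hat f-f^*\|\le\rho^*,\qquad \|\hat f-f^*\|_{L_2}\le r(2\rho^* )=\left[\frac{C\,A\,\mathrm{Rad}(B)\,2\rho^*}{\sqrt N}\right]^{1/(2\kappa)},\qquad \mathcal E(\hat f)\le\frac{r(2\rho^* )^{2\kappa}}{A}=\frac{C\,\mathrm{Rad}(B)\,2\rho^*}{\sqrt N},$$ where $C_1,C_2>0$ depend only on $A,b,\kappa$.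
   Context: Setting. $(X,Y),(X_1,Y_1),\dots,(X_N,Y_N)$ are i.i.d. with values in $\mathcal X\times\mathcal Y$, $\mathcal Y\subseteq\mathbb R$. $L_2$ is the space of real functions $f$ on $\mathcal X$ with $\|f\|_{L_2}=(\mathbb Ef(X)^2)^{1/2}<\infty$; $\|f\|_{L_\infty}=\mathrm{esssup}|f(X)|$. $E$ is a linear subspace of $L_2$, $\|\cdot\|$ is a norm on $E$, and $F\subseteq E$ is convex. $B=\{f\in E:\|f\|\le1\}$, $S=\{f\in E:\|f\|=1\}$, $B_{L_2}=\{f\in L_2:\|f\|_{L_2}\le1\}$; $\rho B,\rho S,rB_{L_2}$ are the dilates. The loss $\ell$ is nonnegative; $\ell_f(x,y)=\ell(f(x),y)$; $P\ell_f=\mathbb E\ell_f(X,Y)$; $P_N\ell_f=\frac1N\sum_{i=1}^N\ell_f(X_i,Y_i)$. The oracle $f^*$ is a minimizer of $P\ell_f$ over $f\in F$ (if these expectations are infinite, a minimizer over $F$ of $\mathbb E[\ell_f(X,Y)-\ell_{f_0}(X,Y)]$ for a fixed $f_0\in F$), assumed to exist, as is $\hat f$. $\mathcal L_f=\ell_f-\ell_{f^*}$ and $\mathcal E(f)=P\mathcal L_f$ (evaluated at the random function for $\hat f$). Rademacher complexity: for $H\subset L_2$, $\mathrm{Rad}(H)=\mathbb E\sup_{f\in H}\left|\frac1{\sqrt N}\sum_{i=1}^N\epsilon_if(X_i)\right|$, with $\epsilon_i$ i.i.d. uniform on $\{-1,1\}$, independent of the $X_i$'s. Sparsity parameter: the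 subdifferential is $\partial\|\cdot\|(f)=\{g:\|f+h\|-\|f\|\ge\langle g,h\rangle\ \forall h\in E\}$, where $g$ ranges over linear functionals on $E$ and $\langle g,h\rangle$ is the duality pairing; $\Gamma_{f^*}(\rho)=\bigcup_{f\in f^*+(\rho/20)B}\partial\|\cdot\|(f)$; and $\Delta(\rho)=\inf_{h\in\rho S\cap r(2\rho)B_{L_2}}\ \sup_{g\in\Gamma_{f^*}(\rho)}\langle h,g\rangle$.
   Formalization: Added: for each ρ>0, {f∈F: ‖f−f*‖≤ρ} is pointwise measurable (each member is a pointwise limit of a sequence from a fixed countable subclass); without such a convention Rad(B) and the probability can be undefined and the claim can fail. C_1, C_2 are uniform over all data on given carrier types. *)

theory Defs
  imports "HOL-Probability.Probability" "HOL-Library.Function_Algebras"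
begin

text \<open>Real functions form a real vector space under pointwise operations; this makes
  \<^const>\<open>subspace\<close>, \<^const>\<open>convex\<close> and the dilates \<open>(*\<^sub>R) \<rho> ` B\<close> available for classes of functions.\<close>

instantiation "fun" :: (type, real_vector) real_vector
begin

definition scaleR_fun :: "real \<Rightarrow> ('a \<Rightarrow> 'b) \<Rightarrow> 'a \<Rightarrow> 'b" where
  "scaleR_fun c f = (\<lambda>x. c *\<^sub>R f x)"

instance
  by standard (simp_all add: scaleR_fun_def fun_eq_iff algebra_simps)

end

lemma scaleR_fun_apply [simp]: "(c *\<^sub>R f) x = c *\<^sub>R f x"
  by (simp add: scaleR_fun_def)


section \<open>Function classes\<close>

text \<open>Throughout, \<open>\<mu>\<close> is the law of \<open>X\<close>.  Elements of \<open>L\<^sub>2\<close> are genuine functions, not classes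
  modulo \<open>\<mu>\<close>-null sets, so that the supremum of \<open>f(X\<^sub>i)\<close> over an uncountable class makes sense.\<close>

definition L2_space :: "'x measure \<Rightarrow> ('x \<Rightarrow> real) set" where
  "L2_space \<mu> = {f \<in> borel_measurable \<mu>. integrable \<mu> (\<lambda>x. (f x)\<^sup>2)}"

definition L2_norm :: "'x measure \<Rightarrow> ('x \<Rightarrow> real) \<Rightarrow> real" where
  "L2_norm \<mu> f = sqrt (\<integral>x. (f x)\<^sup>2 \<partial>\<mu>)"

definition Linf_norm :: "'x measure \<Rightarrow> ('x \<Rightarrow> real) \<Rightarrow> ereal" where
  "Linf_norm \<mu> f = esssup \<mu> (\<lambda>x. ereal \<bar>f x\<bar>)"

definition L2_ball :: "'x measure \<Rightarrow> ('x \<Rightarrow> real) set" where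
  "L2_ball \<mu> = {f \<in> L2_space \<mu>. L2_norm \<mu> f \<le> 1}"

definition unit_ball :: "('x \<Rightarrow> real) set \<Rightarrow> (('x \<Rightarrow> real) \<Rightarrow> real) \<Rightarrow> ('x \<Rightarrow> real) set" where
  "unit_ball E nrm = {f \<in> E. nrm f \<le> 1}"

definition unit_sphere :: "('x \<Rightarrow> real) set \<Rightarrow> (('x \<Rightarrow> real) \<Rightarrow> real) \<Rightarrow> ('x \<Rightarrow> real) set" where
  "unit_sphere E nrm = {f \<in> E. nrm f = 1}"

text \<open>The values of a function outside the carrier \<open>S\<close> are irrelevant, hence the form of
  definiteness.\<close>

definition is_norm_on ::
  "'x set \<Rightarrow> ('x \<Rightarrow> real) set \<Rightarrow> (('x \<Rightarrow> real) \<Rightarrow> real) \<Rightarrow> bool" where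
  "is_norm_on S E nrm \<longleftrightarrow>
     (\<forall>f\<in>E. 0 \<le> nrm f) \<and>
     (\<forall>f\<in>E. nrm f = 0 \<longleftrightarrow> (\<forall>x\<in>S. f x = 0)) \<and>
     (\<forall>f\<in>E. \<forall>c. nrm (c *\<^sub>R f) = \<bar>c\<bar> * nrm f) \<and>
     (\<forall>f\<in>E. \<forall>g\<in>E. nrm (f + g) \<le> nrm f + nrm g)"

text \<open>The usual notion of a pointwise measurable class of functions in empirical process theory:
  suprema over such a class reduce to suprema over a countable subclass.\<close>

definition pointwise_measurable :: "'x set \<Rightarrow> ('x \<Rightarrow> real) set \<Rightarrow> bool" where
  "pointwise_measurable S H \<longleftrightarrow>
     (\<exists>D\<subseteq>H. countable D \<and>
        (\<forall>f\<in>H. \<exists>s. (\<forall>n::nat. s n \<in> D) \<and> (\<forall>x\<in>S. (\<lambda>n. s n x) \<longlonglongrightarrow> f x)))"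


section \<open>Complexity and sparsity parameters\<close>

text \<open>The expectation is taken under the product law of \<open>(X\<^sub>1,\<dots>,X\<^sub>N)\<close> and
  \<open>(\<epsilon>\<^sub>1,\<dots>,\<epsilon>\<^sub>N)\<close>.  If the supremum is not measurable, the integral below is a lower integral.\<close>

definition Rademacher_complexity :: "'x measure \<Rightarrow> nat \<Rightarrow> ('x \<Rightarrow> real) set \<Rightarrow> ennreal" where
  "Rademacher_complexity \<mu> N H =
     (\<integral>\<^sup>+ (x, \<epsilon>). (SUP f\<in>H. ennreal \<bar>1 / sqrt (real N) * (\<Sum>i=1..N. \<epsilon> i * f (x i))\<bar>)
        \<partial>((\<Pi>\<^sub>M i\<in>{1..N}. \<mu>) \<Otimes>\<^sub>M (\<Pi>\<^sub>M i\<in>{1..N}. measure_pmf (pmf_of_set {-1, 1 :: real}))))"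

text \<open>\<^const>\<open>linear\<close> only speaks about functionals on a whole type, not on a subspace.\<close>

definition linear_functional_on :: "('x \<Rightarrow> real) set \<Rightarrow> (('x \<Rightarrow> real) \<Rightarrow> real) \<Rightarrow> bool" where
  "linear_functional_on E g \<longleftrightarrow>
     (\<forall>f\<in>E. \<forall>h\<in>E. g (f + h) = g f + g h) \<and> (\<forall>f\<in>E. \<forall>c. g (c *\<^sub>R f) = c * g f)"

definition subdifferential ::
  "('x \<Rightarrow> real) set \<Rightarrow> (('x \<Rightarrow> real) \<Rightarrow> real) \<Rightarrow> ('x \<Rightarrow> real) \<Rightarrow> (('x \<Rightarrow> real) \<Rightarrow> real) set" where
  "subdifferential E nrm f =
     {g. linear_functional_on E g \<and> (\<forall>h\<in>E. nrm (f + h) - nrm f \<ge> g h)}"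

definition Gamma_set ::
  "('x \<Rightarrow> real) set \<Rightarrow> (('x \<Rightarrow> real) \<Rightarrow> real) \<Rightarrow> ('x \<Rightarrow> real) \<Rightarrow> real \<Rightarrow> (('x \<Rightarrow> real) \<Rightarrow> real) set" where
  "Gamma_set E nrm fstar \<rho> =
     (\<Union>f \<in> (\<lambda>h. fstar + (\<rho> / 20) *\<^sub>R h) ` unit_ball E nrm. subdifferential E nrm f)"

text \<open>Extended real valued: the infimum of the empty set is \<open>\<infinity>\<close>.\<close>

definition sparsity_parameter ::
  "'x measure \<Rightarrow> ('x \<Rightarrow> real) set \<Rightarrow> (('x \<Rightarrow> real) \<Rightarrow> real) \<Rightarrow> ('x \<Rightarrow> real) \<Rightarrow>
     (real \<Rightarrow> real) \<Rightarrow> real \<Rightarrow> ereal" where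
  "sparsity_parameter \<mu> E nrm fstar r \<rho> =
     (INF h \<in> (*\<^sub>R) \<rho> ` unit_sphere E nrm \<inter> (*\<^sub>R) (r (2 * \<rho>)) ` L2_ball \<mu>.
        SUP g \<in> Gamma_set E nrm fstar \<rho>. ereal (g h))"


section \<open>Risks\<close>

definition loss_of :: "(real \<Rightarrow> real \<Rightarrow> real) \<Rightarrow> ('x \<Rightarrow> real) \<Rightarrow> 'x \<times> real \<Rightarrow> real" where
  "loss_of loss f = (\<lambda>(x, y). loss (f x) y)"

definition empirical_risk ::
  "nat \<Rightarrow> (nat \<Rightarrow> 'x \<times> real) \<Rightarrow> (real \<Rightarrow> real \<Rightarrow> real) \<Rightarrow> ('x \<Rightarrow> real) \<Rightarrow> real" where
  "empirical_risk N z loss f = 1 / real N * (\<Sum>i=1..N. loss_of loss f (z i))"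

text \<open>If the risks are infinite, the oracle minimizes the risk relative to a reference function.\<close>

definition is_oracle ::
  "('x \<times> real) measure \<Rightarrow> (real \<Rightarrow> real \<Rightarrow> real) \<Rightarrow> ('x \<Rightarrow> real) set \<Rightarrow> ('x \<Rightarrow> real) \<Rightarrow> bool" where
  "is_oracle P loss F fstar \<longleftrightarrow>
     (if \<forall>f\<in>F. integrable P (loss_of loss f)
      then is_arg_min (\<lambda>f. \<integral>z. loss_of loss f z \<partial>P) (\<lambda>f. f \<in> F) fstar
      else \<exists>f0\<in>F. is_arg_min (\<lambda>f. \<integral>z. loss_of loss f z - loss_of loss f0 z \<partial>P) (\<lambda>f. f \<in> F) fstar)"

definition excess_risk ::
  "('x \<times> real) measure \<Rightarrow> (real \<Rightarrow> real \<Rightarrow> real) \<Rightarrow> ('x \<Rightarrow> real) \<Rightarrow> ('x \<Rightarrow> real) \<Rightarrow> real" where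
  "excess_risk P loss fstar f = (\<integral>z. loss_of loss f z - loss_of loss fstar z \<partial>P)"


section \<open>Standing assumptions\<close>

text \<open>\<open>P\<close> is the common law of the data; the generic pair \<open>(X, Y)\<close> enters only through it.
  Assumption \<open>F_pointwise_measurable\<close> makes explicit the customary measurability
  convention for suprema of the empirical process.\<close>

locale regularized_erm = prob_space M
  for M :: "'w measure" +
  fixes MX :: "'x measure"
    and P :: "('x \<times> real) measure"
    and N :: nat
    and XY :: "nat \<Rightarrow> 'w \<Rightarrow> 'x \<times> real"
    and E :: "('x \<Rightarrow> real) set"
    and nrm :: "('x \<Rightarrow> real) \<Rightarrow> real"
    and F :: "('x \<Rightarrow> real) set"
    and loss :: "real \<Rightarrow> real \<Rightarrow> real"
    and fstar :: "'x \<Rightarrow> real"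
  assumes N_pos: "1 \<le> N"
    and indep: "indep_vars (\<lambda>_. MX \<Otimes>\<^sub>M borel) XY {1..N}"
    and ident_distr: "\<And>i. i \<in> {1..N} \<Longrightarrow> distr M (MX \<Otimes>\<^sub>M borel) (XY i) = P"
    and E_subspace: "subspace E"
    and E_L2: "E \<subseteq> L2_space (distr P MX fst)"
    and norm_E: "is_norm_on (space MX) E nrm"
    and F_subset: "F \<subseteq> E"
    and F_convex: "convex F"
    and loss_nonneg: "\<And>u y. 0 \<le> loss u y"
    and loss_measurable: "\<And>f. f \<in> F \<Longrightarrow> loss_of loss f \<in> borel_measurable (MX \<Otimes>\<^sub>M borel)"
    and fstar_oracle: "is_oracle P loss F fstar"
    and F_pointwise_measurable:
      "\<And>\<rho>. 0 < \<rho> \<Longrightarrow> pointwise_measurable (space MX) {f \<in> F. nrm (f - fstar) \<le> \<rho>}"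

end

theory Submission
  imports Defs
begin

text \<open>On the event that the deviation \<open>\<bar>(P - P\<^sub>N) L\<^sub>f\<bar>\<close> is at most \<open>72 Rad(B) u / \<surd>N\<close> for all \<open>f \<in> F\<close>, with
  \<open>u\<close> the larger of \<open>\<parallel>f - f\<^sup>*\<parallel>\<close>, \<open>\<rho>\<^sup>*\<close> and the radius at which \<open>r(2u) = \<parallel>f - f\<^sup>*\<parallel>\<^sub>2\<close>, the three bounds
  are deterministic: a large \<open>L\<^sub>2\<close> norm contradicts the Bernstein condition, a large regularization norm
  contradicts sparsity.

  The deviation bound comes from peeling in \<open>u\<close> and from a Talagrand-type inequality for finite classes,
  which suffice by pointwise measurability.  The constants leave room for a fixed factor in front of
  the expected supremum, so no sharp form of Talagrand's inequality is needed.  It is derived by the entropy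
  method: entropy tensorizes, which bounds the moment generating function of the self-bounding variable
  \<open>V = sup \<Sum>\<^sub>i f(X\<^sub>i)\<^sup>2\<close>; the Gibbs variational principle then decouples \<open>V\<close> from the exponential of the
  supremum of the empirical process.  Instead of Herbst's differential inequality, the logarithmic
  moment generating functions at \<open>s\<close> and \<open>s/2\<close> are compared.  Symmetrization and contraction, done one
  coordinate at a time, relate both expectations to \<open>Rad(B)\<close>.\<close>

section \<open>Bounded measurable functions\<close>

text \<open>The constants are tied by a cancellation. With \<open>unit_rate\<close> = Rad(B) / sqrt
  N, \<lambda> equals (10/7) * 72 * \<open>unit_rate\<close>, and sparsity makes the norm grow by
  more than 7/10 of its distance to the oracle; so outside the ball of radius
  \<open>\<rho>star\<close> the penalty outweighs the deviation 72 * \<open>unit_rate\<close> * u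
  with no slack except strictness. The slack lies elsewhere: 72 = 2 * 36, where the 2 pays for
  dyadic peeling, and 36 = 32 * 9/8, where 32 is eight times the factor 4 that symmetrization and
  contraction of an absolute supremum cost. The mean thus takes only a ninth of the level. The
  obstacle to a C2 free of N, \<open>\<rho>star\<close> and Rad(B) is the linear term of a
  Bernstein-type exponent, which carries b and a different power of the radius than the variance
  term. Deviations are almost surely at most 4 b, so large radii cost nothing, and for the remaining
  radii the linear term is dominated by the power that the variance contributes.\<close>

definition bdd_meas :: "'a measure \<Rightarrow> ('a \<Rightarrow> real) \<Rightarrow> bool" where
  "bdd_meas M f \<longleftrightarrow> f \<in> borel_measurable M \<and> (\<exists>B. \<forall>x\<in>space M. \<bar>f x\<bar> \<le> B)"

named_theorems bm_intros

lemma bdd_measD: "bdd_meas M f \<Longrightarrow> f \<in> borel_measurable M"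
  by (simp add: bdd_meas_def)

lemma bdd_measI: "f \<in> borel_measurable M \<Longrightarrow> (\<And>x. x \<in> space M \<Longrightarrow> \<bar>f x\<bar> \<le> B) \<Longrightarrow> bdd_meas M f"
  by (auto simp: bdd_meas_def)

lemma bdd_measE:
  assumes "bdd_meas M f"
  obtains B where "0 \<le> B" "\<And>x. x \<in> space M \<Longrightarrow> \<bar>f x\<bar> \<le> B"
proof -
  from assms obtain B where "\<forall>x\<in>space M. \<bar>f x\<bar> \<le> B"
    by (auto simp: bdd_meas_def)
  then show thesis
    by (intro that[of "max 0 B"]) (auto simp: le_max_iff_disj)
qed

lemma bdd_meas_const [bm_intros]: "bdd_meas M (\<lambda>x. c)"
  by (rule bdd_measI[where B = "\<bar>c\<bar>"]) auto

lemma bdd_meas_add [bm_intros]: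
  assumes "bdd_meas M f" "bdd_meas M g" shows "bdd_meas M (\<lambda>x. f x + g x)"
proof -
  obtain B C where "\<And>x. x \<in> space M \<Longrightarrow> \<bar>f x\<bar> \<le> B" "\<And>x. x \<in> space M \<Longrightarrow> \<bar>g x\<bar> \<le> C"
    using assms by (metis bdd_measE)
  then show ?thesis
    using assms[THEN bdd_measD] by (intro bdd_measI[where B = "B + C"]) (auto intro!: abs_triangle_ineq[THEN order_trans] add_mono)
qed

lemma bdd_meas_uminus [bm_intros]: "bdd_meas M f \<Longrightarrow> bdd_meas M (\<lambda>x. - f x)"
  by (auto simp: bdd_meas_def)

lemma bdd_meas_diff [bm_intros]: "bdd_meas M f \<Longrightarrow> bdd_meas M g \<Longrightarrow> bdd_meas M (\<lambda>x. f x - g x)"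
  using bdd_meas_add[OF _ bdd_meas_uminus, of M f g] by simp

lemma bdd_meas_mult [bm_intros]:
  assumes "bdd_meas M f" "bdd_meas M g" shows "bdd_meas M (\<lambda>x. f x * g x)"
proof -
  obtain B C where "\<And>x. x \<in> space M \<Longrightarrow> \<bar>f x\<bar> \<le> B" "\<And>x. x \<in> space M \<Longrightarrow> \<bar>g x\<bar> \<le> C" "0 \<le> B"
    using assms by (metis bdd_measE)
  then show ?thesis
    using assms[THEN bdd_measD] by (intro bdd_measI[where B = "B * C"]) (auto simp: abs_mult intro!: mult_mono)
qed

lemma bdd_meas_divide [bm_intros]: "bdd_meas M f \<Longrightarrow> bdd_meas M (\<lambda>x. f x / c)"
  using bdd_meas_mult[OF _ bdd_meas_const, of M f "1 / c"] by simp

lemma bdd_meas_power [bm_intros]: "bdd_meas M f \<Longrightarrow> bdd_meas M (\<lambda>x. f x ^ n)"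
  by (induction n) (auto intro: bm_intros)

lemma bdd_meas_abs [bm_intros]: "bdd_meas M f \<Longrightarrow> bdd_meas M (\<lambda>x. \<bar>f x\<bar>)"
  by (auto simp: bdd_meas_def)

lemma bdd_meas_max [bm_intros]:
  assumes "bdd_meas M f" "bdd_meas M g" shows "bdd_meas M (\<lambda>x. max (f x) (g x))"
proof -
  have *: "max a b = (a + b + \<bar>a - b\<bar>) / 2" for a b :: real by auto
  show ?thesis unfolding * by (intro bm_intros assms)
qed

lemma bdd_meas_sum [bm_intros]:
  "(\<And>i. i \<in> I \<Longrightarrow> bdd_meas M (f i)) \<Longrightarrow> bdd_meas M (\<lambda>x. \<Sum>i\<in>I. f i x)"
  by (induction I rule: infinite_finite_induct) (auto intro: bm_intros)

lemma bdd_meas_Max [bm_intros]: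
  assumes "finite T" "T \<noteq> {}" "\<And>t. t \<in> T \<Longrightarrow> bdd_meas M (f t)"
  shows "bdd_meas M (\<lambda>x. Max ((\<lambda>t. f t x) ` T))"
  using assms by (induction T rule: finite_ne_induct) (auto intro: bm_intros)

lemma bdd_meas_exp [bm_intros]:
  assumes "bdd_meas M f" shows "bdd_meas M (\<lambda>x. exp (f x))"
proof -
  obtain B where "\<And>x. x \<in> space M \<Longrightarrow> \<bar>f x\<bar> \<le> B" using assms by (metis bdd_measE)
  then show ?thesis using bdd_measD[OF assms]
    by (intro bdd_measI[where B = "exp B"]) (auto simp: abs_le_iff)
qed

lemma bdd_meas_ln:
  assumes "bdd_meas M f" "0 < c" "\<And>x. x \<in> space M \<Longrightarrow> c \<le> f x"
  shows "bdd_meas M (\<lambda>x. ln (f x))"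
proof -
  obtain B where B: "\<And>x. x \<in> space M \<Longrightarrow> \<bar>f x\<bar> \<le> B" using assms by (metis bdd_measE)
  have "\<bar>ln (f x)\<bar> \<le> max \<bar>ln c\<bar> \<bar>ln B\<bar>" if "x \<in> space M" for x
  proof -
    have "ln c \<le> ln (f x)" "ln (f x) \<le> ln B"
      using assms(2,3) B that by (smt (verit) ln_le_cancel_iff)+
    then show ?thesis by linarith
  qed
  then show ?thesis using bdd_measD[OF assms(1)]
    by (intro bdd_measI) auto
qed

lemma bdd_meas_compose:
  assumes "bdd_meas M f" "h \<in> measurable N M" shows "bdd_meas N (\<lambda>x. f (h x))"
  using assms measurable_compose[OF assms(2), of f borel] measurable_space[OF assms(2)]
  unfolding bdd_meas_def by blast

lemma (in prob_space) bdd_meas_integrable: "bdd_meas M f \<Longrightarrow> integrable M f"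
  by (auto simp: bdd_meas_def intro!: integrable_const_bound AE_I2)

lemma (in prob_space) bdd_meas_integral:
  assumes "bdd_meas (N \<Otimes>\<^sub>M M) f"
  shows "bdd_meas N (\<lambda>x. \<integral>y. f (x, y) \<partial>M)"
proof -
  obtain B where B: "\<And>x. x \<in> space (N \<Otimes>\<^sub>M M) \<Longrightarrow> \<bar>f x\<bar> \<le> B" "0 \<le> B"
    using assms by (metis bdd_measE)
  have [measurable]: "f \<in> borel_measurable (N \<Otimes>\<^sub>M M)" by (rule bdd_measD[OF assms])
  have "\<bar>\<integral>y. f (x, y) \<partial>M\<bar> \<le> B" if "x \<in> space N" for x
  proof -
    have "\<bar>\<integral>y. f (x, y) \<partial>M\<bar> \<le> (\<integral>y. B \<partial>M)"
      using that B by (intro integral_abs_bound[THEN order_trans] integral_mono_AE' integrable_const AE_I2)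
        (auto simp: space_pair_measure)
    then show ?thesis by (simp add: prob_space)
  qed
  then show ?thesis by (intro bdd_measI) auto
qed

lemma (in prob_space) expectation_ge_const:
  "integrable M f \<Longrightarrow> (\<And>x. x \<in> space M \<Longrightarrow> (c::real) \<le> f x) \<Longrightarrow> c \<le> expectation f"
  using integral_mono_AE[of M "\<lambda>_. c" f] by (simp add: prob_space)

text \<open>The bound depends on g only through B, so all partial integrals of
  \<open>exp (g (x, y))\<close> stay above one positive constant; this keeps their logarithms in the
  class \<open>bdd_meas\<close>.\<close>

lemma (in prob_space) expectation_exp_ge:
  assumes "bdd_meas M g" "\<And>x. x \<in> space M \<Longrightarrow> \<bar>g x\<bar> \<le> B"
  shows "exp (-B) \<le> expectation (\<lambda>x. exp (g x))"
  by (rule expectation_ge_const) (use assms in \<open>auto intro!: bdd_meas_integrable bm_intros dest!: assms(2) simp: abs_le_iff\<close>)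

lemma (in prob_space) expectation_exp_pos:
  assumes "bdd_meas M g" shows "0 < expectation (\<lambda>x. exp (g x))"
  using bdd_measE[OF assms] expectation_exp_ge[OF assms] by (metis exp_gt_zero less_le_trans)


section \<open>Entropy\<close>

text \<open>The entropy E[F ln F] - E[F] ln E[F] of F = exp g. Parametrizing by the exponent turns
  ln F into g and builds in positivity.\<close>

definition exp_entropy :: "'a measure \<Rightarrow> ('a \<Rightarrow> real) \<Rightarrow> real" where
  "exp_entropy M g = (\<integral>x. g x * exp (g x) \<partial>M) - (\<integral>x. exp (g x) \<partial>M) * ln (\<integral>x. exp (g x) \<partial>M)"

text \<open>Convexity: the tangent of exp at g lies below the graph. The Gibbs principle and the
  subadditivity of entropy are this inequality integrated, with q normalized so that the right-hand
  side has integral zero.\<close>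

lemma exp_mult_diff_le: "exp g * (q - g) \<le> exp q - exp (g :: real)"
proof -
  have "exp g * (1 + (q - g)) \<le> exp g * exp (q - g)"
    by (intro mult_left_mono exp_ge_add_one_self) auto
  then show ?thesis by (simp add: exp_diff algebra_simps)
qed

text \<open>The tangent inequality is used at q = h + ln m - ln k. The shift gives exp q the same
  integral m as exp g, so the error term integrates to zero. The mean of h under the law tilted by
  exp g is thereby paid for with the entropy of g and the moment generating function of h
  alone.\<close>

lemma (in prob_space) gibbs_variational:
  assumes g: "bdd_meas M g" and h: "bdd_meas M h"
  shows "(\<integral>x. h x * exp (g x) \<partial>M) \<le>
    exp_entropy M g + (\<integral>x. exp (g x) \<partial>M) * ln (\<integral>x. exp (h x) \<partial>M)"
proof -
  define m where "m = (\<integral>x. exp (g x) \<partial>M)"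
  define k where "k = (\<integral>x. exp (h x) \<partial>M)"
  have pos: "m > 0" "k > 0"
    unfolding m_def k_def by (intro expectation_exp_pos g h)+
  have "(\<integral>x. h x * exp (g x) + (ln m - ln k) * exp (g x) - g x * exp (g x) \<partial>M)
      \<le> (\<integral>x. exp (h x) * (m / k) - exp (g x) \<partial>M)"
  proof (rule integral_mono)
    fix x
    have "exp (h x + (ln m - ln k)) = exp (h x) * (m / k)"
      using pos by (simp add: exp_add exp_diff)
    then show "h x * exp (g x) + (ln m - ln k) * exp (g x) - g x * exp (g x)
        \<le> exp (h x) * (m / k) - exp (g x)"
      using exp_mult_diff_le[of "g x" "h x + (ln m - ln k)"] by (simp add: algebra_simps)
  qed (intro bdd_meas_integrable bm_intros g h)+
  also have "\<dots> = 0"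
  proof -
    have i: "integrable M (\<lambda>x. exp (h x))" "integrable M (\<lambda>x. exp (g x))"
      by (intro bdd_meas_integrable bm_intros g h)+
    show ?thesis using pos i by (simp add: m_def[symmetric] k_def[symmetric])
  qed
  also have "(\<integral>x. h x * exp (g x) + (ln m - ln k) * exp (g x) - g x * exp (g x) \<partial>M)
     = (\<integral>x. h x * exp (g x) \<partial>M) + (ln m - ln k) * m - (\<integral>x. g x * exp (g x) \<partial>M)"
  proof -
    have i: "integrable M (\<lambda>x. exp (g x))" "integrable M (\<lambda>x. h x * exp (g x))"
        "integrable M (\<lambda>x. g x * exp (g x))"
      by (intro bdd_meas_integrable bm_intros g h)+
    show ?thesis using i by (simp add: m_def[symmetric])
  qed
  finally show ?thesis
    by (simp add: exp_entropy_def m_def[symmetric] k_def[symmetric] algebra_simps)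
qed

text \<open>This is \<open>gibbs_variational\<close> for \<open>h = g/2\<close>.\<close>

lemma (in prob_space) log_mgf_halving:
  assumes g: "bdd_meas M g"
  shows "ln (\<integral>x. exp (g x) \<partial>M) \<le> 2 * ln (\<integral>x. exp (g x / 2) \<partial>M)
     + exp_entropy M g / (\<integral>x. exp (g x) \<partial>M)"
proof -
  define m where "m = (\<integral>x. exp (g x) \<partial>M)"
  have pos: "m > 0"
    unfolding m_def by (intro expectation_exp_pos g)
  have "(\<integral>x. g x / 2 * exp (g x) \<partial>M) = (exp_entropy M g + m * ln m) / 2"
    by (simp add: exp_entropy_def m_def)
  with gibbs_variational[OF g bdd_meas_divide[OF g, of 2]]
  have "m * ln m \<le> m * (2 * ln (\<integral>x. exp (g x / 2) \<partial>M)) + exp_entropy M g"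
    by (simp add: m_def[symmetric])
  with pos show ?thesis
    by (simp add: m_def[symmetric] field_simps)
qed

section \<open>Fubini and sections for bounded functions on pairs\<close>

lemma (in pair_prob_space) bdd_meas_swap:
  assumes "bdd_meas (M1 \<Otimes>\<^sub>M M2) f" shows "bdd_meas (M2 \<Otimes>\<^sub>M M1) (\<lambda>(x, y). f (y, x))"
  using bdd_meas_compose[OF assms measurable_pair_swap'] by (simp add: case_prod_beta')

lemma (in pair_prob_space) bdd_meas_integral1:
  assumes "bdd_meas (M1 \<Otimes>\<^sub>M M2) f" shows "bdd_meas M2 (\<lambda>y. \<integral>x. f (x, y) \<partial>M1)"
  using M1.bdd_meas_integral[OF bdd_meas_swap[OF assms]] by simp

lemma (in pair_prob_space) bdd_meas_iterated:
  assumes "bdd_meas (M1 \<Otimes>\<^sub>M M2) f"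
  shows "(\<integral>x. \<integral>y. f (x, y) \<partial>M2 \<partial>M1) = integral\<^sup>L (M1 \<Otimes>\<^sub>M M2) f"
    and "(\<integral>y. \<integral>x. f (x, y) \<partial>M1 \<partial>M2) = integral\<^sup>L (M1 \<Otimes>\<^sub>M M2) f"
  using integral_fst'[of f] integral_snd[of "\<lambda>x y. f (x, y)"] bdd_meas_integrable[OF assms]
  by (auto simp: case_prod_unfold)

text \<open>Sections are bounded at every point, not merely at almost every one, because
  \<open>bdd_meas\<close> asks for a bound on the whole space. This spares exceptional null sets in
  the iterated integrals.\<close>

lemma bdd_meas_Pair1: "bdd_meas (M1 \<Otimes>\<^sub>M M2) f \<Longrightarrow> x \<in> space M1 \<Longrightarrow> bdd_meas M2 (\<lambda>y. f (x, y))"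
  by (erule bdd_meas_compose) measurable

lemma bdd_meas_Pair2: "bdd_meas (M1 \<Otimes>\<^sub>M M2) f \<Longrightarrow> y \<in> space M2 \<Longrightarrow> bdd_meas M1 (\<lambda>x. f (x, y))"
  by (erule bdd_meas_compose) measurable

lemma bdd_meas_fst: "bdd_meas M1 f \<Longrightarrow> bdd_meas (M1 \<Otimes>\<^sub>M M2) (\<lambda>z. f (fst z))"
  by (erule bdd_meas_compose) measurable

lemma bdd_meas_snd: "bdd_meas M2 f \<Longrightarrow> bdd_meas (M1 \<Otimes>\<^sub>M M2) (\<lambda>z. f (snd z))"
  by (erule bdd_meas_compose) measurable

text \<open>The tangent inequality at q = ln u(x) + ln w(y) - ln m, where u and w are the marginals
  of exp g: exp q is the product of the marginals divided by m, and by Fubini it has integral m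
  again. What remains is E[u ln u] + E[w ln w] \<le> m ln m + E[g exp g], a rearrangement of the
  claim.\<close>

lemma (in pair_prob_space) exp_entropy_pair:
  assumes g: "bdd_meas (M1 \<Otimes>\<^sub>M M2) g"
  shows "exp_entropy (M1 \<Otimes>\<^sub>M M2) g \<le>
    (\<integral>y. exp_entropy M1 (\<lambda>x. g (x, y)) \<partial>M2) + (\<integral>x. exp_entropy M2 (\<lambda>y. g (x, y)) \<partial>M1)"
proof -
  let ?P = "M1 \<Otimes>\<^sub>M M2"
  obtain B where B: "\<And>z. z \<in> space ?P \<Longrightarrow> \<bar>g z\<bar> \<le> B" "0 \<le> B"
    using g by (metis bdd_measE)
  define m where "m = (\<integral>z. exp (g z) \<partial>?P)"
  define u where "u x = (\<integral>y. exp (g (x, y)) \<partial>M2)" for x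
  define w where "w y = (\<integral>x. exp (g (x, y)) \<partial>M1)" for y
  have eg: "bdd_meas ?P (\<lambda>z. exp (g z))" "bdd_meas ?P (\<lambda>z. g z * exp (g z))"
    by (intro bm_intros g)+
  have u: "bdd_meas M1 u" and w: "bdd_meas M2 w"
    using M2.bdd_meas_integral[OF eg(1)] bdd_meas_integral1[OF eg(1)] by (simp_all add: u_def[abs_def] w_def[abs_def])
  have ub: "exp (- B) \<le> u x" if "x \<in> space M1" for x
    unfolding u_def using that B
    by (intro M2.expectation_exp_ge bdd_meas_Pair1[OF g]) (auto simp: space_pair_measure)
  have wb: "exp (- B) \<le> w y" if "y \<in> space M2" for y
    unfolding w_def using that B
    by (intro M1.expectation_exp_ge bdd_meas_Pair2[OF g]) (auto simp: space_pair_measure)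
  have m: "0 < m" unfolding m_def by (intro expectation_exp_pos g)
  have lu: "bdd_meas M1 (\<lambda>x. ln (u x))" and lw: "bdd_meas M2 (\<lambda>y. ln (w y))"
    by (rule bdd_meas_ln[OF u _ ub] bdd_meas_ln[OF w _ wb]; simp)+
  have lu': "bdd_meas ?P (\<lambda>z. ln (u (fst z)))" and lw': "bdd_meas ?P (\<lambda>z. ln (w (snd z)))"
    by (intro bdd_meas_fst bdd_meas_snd lu lw)+
  have u': "bdd_meas ?P (\<lambda>z. u (fst z))" and w': "bdd_meas ?P (\<lambda>z. w (snd z))"
    by (intro bdd_meas_fst bdd_meas_snd u w)+
  have int_u: "(\<integral>x. u x \<partial>M1) = m" and int_w: "(\<integral>y. w y \<partial>M2) = m"
    unfolding u_def w_def m_def using bdd_meas_iterated[OF eg(1)] by auto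
  have a: "(\<integral>z. exp (g z) * ln (u (fst z)) \<partial>?P) = (\<integral>x. u x * ln (u x) \<partial>M1)"
    by (subst bdd_meas_iterated(1)[symmetric]) (auto simp: u_def intro!: bm_intros g lu'[unfolded u_def])
  have b: "(\<integral>z. exp (g z) * ln (w (snd z)) \<partial>?P) = (\<integral>x. w x * ln (w x) \<partial>M2)"
    by (subst bdd_meas_iterated(2)[symmetric]) (auto simp: w_def intro!: bm_intros g lw'[unfolded w_def])
  have c: "(\<integral>z. u (fst z) * w (snd z) \<partial>?P) = m * m"
    by (subst bdd_meas_iterated(1)[symmetric]) (simp_all add: bm_intros u' w' int_u int_w)
  have "(\<integral>z. exp (g z) * ln (u (fst z)) + exp (g z) * ln (w (snd z)) - exp (g z) * ln m - g z * exp (g z) \<partial>?P)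
      \<le> (\<integral>z. (u (fst z) * w (snd z)) / m - exp (g z) \<partial>?P)"
  proof (rule integral_mono)
    fix z assume "z \<in> space ?P"
    then have "0 < u (fst z)" "0 < w (snd z)"
      using ub[of "fst z"] wb[of "snd z"] by (auto simp: space_pair_measure intro: less_le_trans[OF exp_gt_zero])
    then have "exp (ln (u (fst z)) + ln (w (snd z)) - ln m) = (u (fst z) * w (snd z)) / m"
      using m by (simp add: exp_add exp_diff)
    then show "exp (g z) * ln (u (fst z)) + exp (g z) * ln (w (snd z)) - exp (g z) * ln m - g z * exp (g z)
        \<le> (u (fst z) * w (snd z)) / m - exp (g z)"
      using exp_mult_diff_le[of "g z" "ln (u (fst z)) + ln (w (snd z)) - ln m"] by (simp add: algebra_simps)
  qed (intro bdd_meas_integrable bm_intros g u' w' lu' lw')+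
  also have "\<dots> = 0"
    using m c bdd_meas_integrable[OF eg(1)] bdd_meas_integrable[OF bdd_meas_mult[OF u' w']]
    by (simp add: m_def[symmetric])
  also have "(\<integral>z. exp (g z) * ln (u (fst z)) + exp (g z) * ln (w (snd z)) - exp (g z) * ln m - g z * exp (g z) \<partial>?P)
      = (\<integral>x. u x * ln (u x) \<partial>M1) + (\<integral>x. w x * ln (w x) \<partial>M2) - m * ln m - (\<integral>z. g z * exp (g z) \<partial>?P)"
    using bdd_meas_integrable[OF eg(1)] bdd_meas_integrable[OF eg(2)]
      bdd_meas_integrable[OF bdd_meas_mult[OF eg(1) lu']] bdd_meas_integrable[OF bdd_meas_mult[OF eg(1) lw']]
    by (simp add: a b m_def[symmetric])
  finally have key: "(\<integral>x. u x * ln (u x) \<partial>M1) + (\<integral>x. w x * ln (w x) \<partial>M2) \<le> m * ln m + (\<integral>z. g z * exp (g z) \<partial>?P)"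
    by simp
  have "(\<integral>y. exp_entropy M1 (\<lambda>x. g (x, y)) \<partial>M2) = (\<integral>z. g z * exp (g z) \<partial>?P) - (\<integral>x. w x * ln (w x) \<partial>M2)"
    unfolding exp_entropy_def w_def[symmetric]
    by (subst Bochner_Integration.integral_diff)
       (auto simp: bdd_meas_iterated(2)[OF eg(2)] intro!: M2.bdd_meas_integrable bdd_meas_integral1[OF eg(2), simplified] bdd_meas_mult w lw)
  moreover have "(\<integral>x. exp_entropy M2 (\<lambda>y. g (x, y)) \<partial>M1) = (\<integral>z. g z * exp (g z) \<partial>?P) - (\<integral>x. u x * ln (u x) \<partial>M1)"
    unfolding exp_entropy_def u_def[symmetric]
    by (subst Bochner_Integration.integral_diff)
       (auto simp: bdd_meas_iterated(1)[OF eg(2)] intro!: M1.bdd_meas_integrable M2.bdd_meas_integral[OF eg(2), simplified] bdd_meas_mult u lu)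
  ultimately show ?thesis
    using key unfolding exp_entropy_def m_def by simp
qed

text \<open>Jensen replaces the logarithm of the mean by the mean of g, leaving the covariance of g
  and exp g. Written with an independent copy, it is half the mean of (a - b)(exp a - exp b), which
  is at most exp of the larger value times (a - b)^2. Exchanging the copies puts all the weight on
  pairs with g x > g y, hence the positive part.\<close>

lemma (in prob_space) exp_entropy_le_sq:
  assumes g: "bdd_meas M g"
  shows "exp_entropy M g \<le> (\<integral>x. \<integral>y. exp (g x) * (max 0 (g x - g y))\<^sup>2 \<partial>M \<partial>M)"
proof -
  interpret Q: pair_prob_space M M ..
  let ?P = "M \<Otimes>\<^sub>M M"
  define h where "h z = exp (g (fst z)) * (max 0 (g (fst z) - g (snd z)))\<^sup>2" for z
  note g1 = bdd_meas_fst[OF g, of M] and g2 = bdd_meas_snd[OF g, of M]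
  have h: "bdd_meas ?P h" unfolding h_def by (intro bm_intros g1 g2)
  have h': "bdd_meas ?P (\<lambda>(x, y). h (y, x))" by (rule Q.bdd_meas_swap[OF h])
  let ?eg = "\<integral>x. exp (g x) \<partial>M" and ?g = "\<integral>x. g x \<partial>M"
  have "exp ?g \<le> ?eg"
    by (rule jensens_inequality[where I = UNIV and q = exp])
       (auto intro!: bdd_meas_integrable bm_intros g exp_convex)
  then have "?g \<le> ln ?eg" using expectation_exp_pos[OF g] by (simp add: ln_ge_iff)
  then have "exp_entropy M g \<le> (\<integral>x. g x * exp (g x) \<partial>M) - ?eg * ?g"
    using expectation_exp_pos[OF g] by (simp add: exp_entropy_def)
  also have "\<dots> = (\<integral>z. (g (fst z) - g (snd z)) * (exp (g (fst z)) - exp (g (snd z))) / 2 \<partial>?P)"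
  proof -
    have "(\<integral>z. (g (fst z) - g (snd z)) * (exp (g (fst z)) - exp (g (snd z))) / 2 \<partial>?P)
       = (\<integral>z. (g (fst z) * exp (g (fst z)) + g (snd z) * exp (g (snd z))
            - exp (g (fst z)) * g (snd z) - exp (g (snd z)) * g (fst z)) / 2 \<partial>?P)"
      by (simp add: algebra_simps)
    also have "\<dots> = ((\<integral>z. g (fst z) * exp (g (fst z)) \<partial>?P) + (\<integral>z. g (snd z) * exp (g (snd z)) \<partial>?P)
        - (\<integral>z. exp (g (fst z)) * g (snd z) \<partial>?P) - (\<integral>z. exp (g (snd z)) * g (fst z) \<partial>?P)) / 2"
    proof -
      have "integrable ?P (\<lambda>z. g (fst z) * exp (g (fst z)))" "integrable ?P (\<lambda>z. g (snd z) * exp (g (snd z)))"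
         "integrable ?P (\<lambda>z. exp (g (fst z)) * g (snd z))" "integrable ?P (\<lambda>z. exp (g (snd z)) * g (fst z))"
        by (intro Q.bdd_meas_integrable bm_intros g1 g2)+
      then show ?thesis by simp
    qed
    also have "(\<integral>z. g (fst z) * exp (g (fst z)) \<partial>?P) = (\<integral>x. g x * exp (g x) \<partial>M)"
      by (subst Q.bdd_meas_iterated(1)[symmetric]) (auto intro!: bm_intros g1 g2 simp: prob_space)
    also have "(\<integral>z. g (snd z) * exp (g (snd z)) \<partial>?P) = (\<integral>x. g x * exp (g x) \<partial>M)"
      by (subst Q.bdd_meas_iterated(1)[symmetric]) (auto intro!: bm_intros g1 g2 simp: prob_space)
    also have "(\<integral>z. exp (g (fst z)) * g (snd z) \<partial>?P) = ?eg * ?g"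
      by (subst Q.bdd_meas_iterated(1)[symmetric]) (auto intro!: bm_intros g1 g2 simp: prob_space)
    also have "(\<integral>z. exp (g (snd z)) * g (fst z) \<partial>?P) = ?eg * ?g"
      by (subst Q.bdd_meas_iterated(1)[symmetric]) (auto intro!: bm_intros g1 g2 simp: prob_space)
    finally show ?thesis by simp
  qed
  also have "\<dots> \<le> (\<integral>z. (h z + h (snd z, fst z)) / 2 \<partial>?P)"
  proof (rule integral_mono)
    fix z
    have *: "(a - b) * (exp a - exp b) \<le> exp a * (max 0 (a - b))\<^sup>2 + exp b * (max 0 (b - a))\<^sup>2" for a b :: real
    proof -
      have *: "(a - b) * (exp a - exp b) \<le> exp a * (a - b)\<^sup>2" if "b \<le> a" for a b :: real
      proof -
        have "exp a * (b - a) \<le> exp b - exp a" by (rule exp_mult_diff_le)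
        then have "(a - b) * (exp a - exp b) \<le> (a - b) * (exp a * (a - b))"
          using that by (intro mult_left_mono) (auto simp: algebra_simps)
        then show ?thesis by (simp add: power2_eq_square algebra_simps)
      qed
      show ?thesis using *[of a b] *[of b a] by (cases "a \<le> b") (auto simp: max_def algebra_simps)
    qed
    show "(g (fst z) - g (snd z)) * (exp (g (fst z)) - exp (g (snd z))) / 2 \<le> (h z + h (snd z, fst z)) / 2"
      using *[of "g (fst z)" "g (snd z)"] by (simp add: h_def)
  qed (use h' in \<open>auto intro!: Q.bdd_meas_integrable bm_intros g1 g2 h simp: case_prod_unfold\<close>)
  also have "\<dots> = (integral\<^sup>L ?P h + (\<integral>z. h (snd z, fst z) \<partial>?P)) / 2"
    using Q.bdd_meas_integrable[OF h] Q.bdd_meas_integrable[OF h'] by (simp add: case_prod_unfold)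
  also have "(\<integral>z. h (snd z, fst z) \<partial>?P) = integral\<^sup>L ?P h"
    using Q.bdd_meas_iterated[OF h] Q.bdd_meas_iterated[OF h'] by (simp add: case_prod_unfold)
  finally show ?thesis
    using Q.bdd_meas_iterated(1)[OF h] by (simp add: h_def[abs_def])
qed

lemma (in pair_prob_space) bdd_meas_exp_entropy:
  assumes g: "bdd_meas (M1 \<Otimes>\<^sub>M M2) g"
  shows "bdd_meas M1 (\<lambda>x. exp_entropy M2 (\<lambda>y. g (x, y)))"
proof -
  obtain B where B: "\<And>z. z \<in> space (M1 \<Otimes>\<^sub>M M2) \<Longrightarrow> \<bar>g z\<bar> \<le> B"
    using g by (metis bdd_measE)
  have 1: "bdd_meas M1 (\<lambda>x. \<integral>y. exp (g (x, y)) \<partial>M2)"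
    by (rule M2.bdd_meas_integral) (intro bm_intros g)
  have "exp (- B) \<le> (\<integral>y. exp (g (x, y)) \<partial>M2)" if "x \<in> space M1" for x
    using that B by (intro M2.expectation_exp_ge bdd_meas_Pair1[OF g]) (auto simp: space_pair_measure)
  from bdd_meas_ln[OF 1 _ this] have 2: "bdd_meas M1 (\<lambda>x. ln (\<integral>y. exp (g (x, y)) \<partial>M2))"
    by simp
  have 3: "bdd_meas M1 (\<lambda>x. \<integral>y. g (x, y) * exp (g (x, y)) \<partial>M2)"
    by (rule M2.bdd_meas_integral) (intro bm_intros g)
  show ?thesis unfolding exp_entropy_def by (intro bm_intros 1 2 3)
qed

section \<open>Splitting one coordinate off a finite power\<close>

lemma (in prob_space) prob_space_PiM_const: "prob_space (\<Pi>\<^sub>M i\<in>I. M)"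
  by (rule prob_space_PiM) unfold_locales

text \<open>For i already in I the set \<open>insert i I\<close> is I and the map resamples one
  coordinate; both readings occur below.\<close>

lemma measurable_update_insert:
  "(\<lambda>z. (fst z)(i := snd z)) \<in> (\<Pi>\<^sub>M i\<in>I. M) \<Otimes>\<^sub>M M \<rightarrow>\<^sub>M (\<Pi>\<^sub>M i\<in>insert i I. M)"
  using measurable_add_dim[of i I "\<lambda>_. M"] by (simp add: case_prod_beta')

lemma (in prob_space) PiM_insert_integral:
  assumes f: "bdd_meas (\<Pi>\<^sub>M i\<in>insert i I. M) f" and I: "finite I" "i \<notin> I"
  shows "integral\<^sup>L (\<Pi>\<^sub>M i\<in>insert i I. M) f =
    (\<integral>z. f ((fst z)(i := snd z)) \<partial>((\<Pi>\<^sub>M i\<in>I. M) \<Otimes>\<^sub>M M))"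
proof -
  interpret J: prob_space "\<Pi>\<^sub>M i\<in>I. M" by (rule prob_space_PiM_const)
  interpret Q: pair_prob_space "\<Pi>\<^sub>M i\<in>I. M" M ..
  interpret pp: product_sigma_finite "\<lambda>_. M" by standard
  interpret K: prob_space "\<Pi>\<^sub>M i\<in>insert i I. M" by (rule prob_space_PiM_const)
  have f': "bdd_meas ((\<Pi>\<^sub>M i\<in>I. M) \<Otimes>\<^sub>M M) (\<lambda>z. f ((fst z)(i := snd z)))"
    by (rule bdd_meas_compose[OF f measurable_update_insert])
  show ?thesis
    using pp.product_integral_insert[OF I K.bdd_meas_integrable[OF f]] Q.bdd_meas_iterated(1)[OF f']
    by simp
qed

text \<open>Induction on I. \<open>exp_entropy_pair\<close> separates the new coordinate k: the
  entropy in the old coordinates, at a frozen value of k, falls under the induction hypothesis, and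
  the entropy in k alone under \<open>exp_entropy_le_sq\<close>. Updates at distinct coordinates
  commute, so both kinds of terms are again resampling integrals over the enlarged product.\<close>

lemma (in prob_space) exp_entropy_tensorization:
  assumes "finite I" "bdd_meas (\<Pi>\<^sub>M i\<in>I. M) g"
  shows "exp_entropy (\<Pi>\<^sub>M i\<in>I. M) g \<le>
    (\<Sum>i\<in>I. \<integral>x. \<integral>y. exp (g x) * (max 0 (g x - g (x(i := y))))\<^sup>2 \<partial>M \<partial>(\<Pi>\<^sub>M i\<in>I. M))"
  using assms
proof (induction I arbitrary: g rule: finite_induct)
  case empty
  have int: "integral\<^sup>L (\<Pi>\<^sub>M i\<in>{}. M) f = f (\<lambda>_. undefined)" for f :: "('b \<Rightarrow> 'a) \<Rightarrow> real"
    by (simp add: PiM_empty lebesgue_integral_count_space_finite)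
  have "exp_entropy (\<Pi>\<^sub>M i\<in>{}. M) g = 0"
    unfolding exp_entropy_def int by simp
  then show ?case by simp
next
  case (insert k I g)
  let ?J = "\<Pi>\<^sub>M i\<in>I. M" and ?K = "\<Pi>\<^sub>M i\<in>insert k I. M"
  interpret J: prob_space ?J by (rule prob_space_PiM_const)
  interpret K: prob_space ?K by (rule prob_space_PiM_const)
  interpret Q: pair_prob_space ?J M ..
  interpret R: pair_prob_space M ?J ..
  note g = insert.prems
  define h where "h i x = (\<integral>y. exp (g x) * (max 0 (g x - g (x(i := y))))\<^sup>2 \<partial>M)" for i x
  have h: "bdd_meas ?K (h i)" if "i \<in> insert k I" for i
  proof -
    have 1: "bdd_meas (?K \<Otimes>\<^sub>M M) (\<lambda>z. g (fst z))" by (rule bdd_meas_fst[OF g])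
    have "insert i (insert k I) = insert k I" using that by auto
    then have 2: "bdd_meas (?K \<Otimes>\<^sub>M M) (\<lambda>z. g ((fst z)(i := snd z)))"
      using bdd_meas_compose[OF g, of _ "?K \<Otimes>\<^sub>M M"] measurable_update_insert[of i "insert k I" M] by simp
    have "bdd_meas (?K \<Otimes>\<^sub>M M) (\<lambda>z. exp (g (fst z)) * (max 0 (g (fst z) - g ((fst z)(i := snd z))))\<^sup>2)"
      by (intro bm_intros 1 2)
    from bdd_meas_integral[OF this] show ?thesis by (simp add: h_def[abs_def])
  qed
  note ins = PiM_insert_integral[OF _ insert.hyps]
  note comp = bdd_meas_compose[OF _ measurable_update_insert]
  define g' where "g' z = g ((fst z)(k := snd z))" for z
  have g': "bdd_meas (?J \<Otimes>\<^sub>M M) g'" unfolding g'_def by (rule comp[OF g])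
  have h': "bdd_meas (?J \<Otimes>\<^sub>M M) (\<lambda>z. h i ((fst z)(k := snd z)))" if "i \<in> insert k I" for i
    by (rule comp[OF h[OF that]])
  have "exp_entropy ?K g = exp_entropy (?J \<Otimes>\<^sub>M M) g'"
    unfolding exp_entropy_def g'_def by (subst (1 2 3) ins) (intro bm_intros g refl)+
  also have "\<dots> \<le> (\<integral>y. exp_entropy ?J (\<lambda>x. g' (x, y)) \<partial>M) + (\<integral>x. exp_entropy M (\<lambda>y. g' (x, y)) \<partial>?J)"
    by (rule Q.exp_entropy_pair[OF g'])
  also have "(\<integral>y. exp_entropy ?J (\<lambda>x. g' (x, y)) \<partial>M)
      \<le> (\<integral>y. (\<Sum>i\<in>I. \<integral>x. h i (x(k := y)) \<partial>?J) \<partial>M)"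
  proof (rule integral_mono)
    show "integrable M (\<lambda>y. exp_entropy ?J (\<lambda>x. g' (x, y)))"
      using R.bdd_meas_exp_entropy[OF Q.bdd_meas_swap[OF g']]
      by (intro bdd_meas_integrable) simp
    show "integrable M (\<lambda>y. \<Sum>i\<in>I. \<integral>x. h i (x(k := y)) \<partial>?J)"
      using Q.bdd_meas_integral1[OF h'] by (intro bdd_meas_integrable bm_intros) simp
    fix y assume "y \<in> space M"
    then have "exp_entropy ?J (\<lambda>x. g' (x, y)) \<le> (\<Sum>i\<in>I. \<integral>x. \<integral>y'. exp (g' (x, y)) *
        (max 0 (g' (x, y) - g' (x(i := y'), y)))\<^sup>2 \<partial>M \<partial>?J)"
      by (intro insert.IH bdd_meas_Pair2[OF g'])
    also have "\<dots> = (\<Sum>i\<in>I. \<integral>x. h i (x(k := y)) \<partial>?J)"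
    proof (rule sum.cong[OF refl])
      fix i assume "i \<in> I"
      then have "i \<noteq> k" using insert.hyps by auto
      then show "(\<integral>x. \<integral>y'. exp (g' (x, y)) * (max 0 (g' (x, y) - g' (x(i := y'), y)))\<^sup>2 \<partial>M \<partial>?J)
          = (\<integral>x. h i (x(k := y)) \<partial>?J)"
        by (simp add: g'_def h_def fun_upd_twist)
    qed
    finally show "exp_entropy ?J (\<lambda>x. g' (x, y)) \<le> (\<Sum>i\<in>I. \<integral>x. h i (x(k := y)) \<partial>?J)" .
  qed
  also have "(\<integral>y. (\<Sum>i\<in>I. \<integral>x. h i (x(k := y)) \<partial>?J) \<partial>M) = (\<Sum>i\<in>I. \<integral>y. \<integral>x. h i (x(k := y)) \<partial>?J \<partial>M)"
    using Q.bdd_meas_integral1[OF h'] by (intro Bochner_Integration.integral_sum bdd_meas_integrable) simp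
  also have "\<dots> = (\<Sum>i\<in>I. integral\<^sup>L ?K (h i))"
  proof (rule sum.cong[OF refl])
    fix i assume i: "i \<in> I"
    show "(\<integral>y. \<integral>x. h i (x(k := y)) \<partial>?J \<partial>M) = integral\<^sup>L ?K (h i)"
      using Q.bdd_meas_iterated(2)[OF h'[of i]] ins[OF h[of i]] i by simp
  qed
  also have "(\<integral>x. exp_entropy M (\<lambda>y. g' (x, y)) \<partial>?J) \<le> (\<integral>x. \<integral>y. h k (x(k := y)) \<partial>M \<partial>?J)"
  proof (rule integral_mono)
    show "integrable ?J (\<lambda>x. exp_entropy M (\<lambda>y. g' (x, y)))"
      by (intro J.bdd_meas_integrable Q.bdd_meas_exp_entropy[OF g'])
    show "integrable ?J (\<lambda>x. \<integral>y. h k (x(k := y)) \<partial>M)"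
      using bdd_meas_integral[OF h'[of k]] by (intro J.bdd_meas_integrable) simp
    fix x assume "x \<in> space ?J"
    from exp_entropy_le_sq[OF bdd_meas_Pair1[OF g' this]]
    show "exp_entropy M (\<lambda>y. g' (x, y)) \<le> (\<integral>y. h k (x(k := y)) \<partial>M)"
      by (simp add: h_def g'_def)
  qed
  also have "\<dots> = integral\<^sup>L ?K (h k)"
    using Q.bdd_meas_iterated(1)[OF h'[of k]] ins[OF h[of k]] by simp
  finally have "exp_entropy ?K g \<le> (\<Sum>i\<in>insert k I. integral\<^sup>L ?K (h i))"
    using insert.hyps by simp
  then show ?case unfolding h_def .
qed

section \<open>Moment generating functions\<close>

lemma exp_le_quadratic:
  fixes x :: real assumes "\<bar>x\<bar> \<le> 1" shows "exp x \<le> 1 + x + x\<^sup>2"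
proof (cases "0 \<le> x")
  case True
  then show ?thesis using assms exp_bound[of x] by simp
next
  case False
  have p: "0 < 1 + x + x\<^sup>2" using assms False by (auto intro: add_nonneg_pos)
  have "1 \<le> (1 + x + x\<^sup>2) * (1 - x)"
  proof -
    have "(1 + x + x\<^sup>2) * (1 - x) = 1 - x * x\<^sup>2" by (simp add: algebra_simps power2_eq_square)
    moreover have "x * x\<^sup>2 \<le> 0" using False by (intro mult_nonpos_nonneg) auto
    ultimately show ?thesis by linarith
  qed
  also have "\<dots> \<le> (1 + x + x\<^sup>2) * exp (- x)"
    using p exp_ge_add_one_self[of "-x"] by (intro mult_left_mono) auto
  finally show ?thesis by (simp add: exp_minus field_simps)
qed

text \<open>Iterating \<open>\<phi> s \<le> \<phi> (s / 2)\<close> works because \<open>ln E exp(s f) / s\<close> tends to \<open>E f\<close> as \<open>s\<close> tends to 0.\<close>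

lemma (in prob_space) log_mgf_le_of_halving:
  assumes f: "bdd_meas M f" and s0: "0 < s0"
    and half: "\<And>s. 0 < s \<Longrightarrow> s \<le> s0 \<Longrightarrow> \<phi> s \<le> \<phi> (s / 2)"
    and le: "\<And>s. 0 < s \<Longrightarrow> s \<le> s0 \<Longrightarrow> s * \<phi> s \<le> ln (\<integral>x. exp (s * f x) \<partial>M)"
  shows "\<phi> s0 \<le> (\<integral>x. f x \<partial>M)"
proof -
  obtain B where B: "0 \<le> B" "\<And>x. x \<in> space M \<Longrightarrow> \<bar>f x\<bar> \<le> B" using f by (metis bdd_measE)
  have it: "\<phi> s0 \<le> \<phi> (s0 / 2 ^ k)" for k
  proof (induction k)
    case (Suc k)
    have "s0 / 2 ^ k \<le> s0" using s0 by (simp add: field_simps)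
    from half[OF _ this] s0 Suc show ?case by (simp add: field_simps)
  qed simp
  \<comment> \<open>Second-order expansion of exp: for small s, \<phi> s exceeds the mean by at most
    s B^2, which vanishes along \<open>s0 / 2 ^ k\<close>.\<close>
  have bound: "\<phi> s \<le> (\<integral>x. f x \<partial>M) + s * B\<^sup>2" if s: "0 < s" "s \<le> s0" "s * B \<le> 1" for s
  proof -
    have "(\<integral>x. exp (s * f x) \<partial>M) \<le> (\<integral>x. 1 + s * f x + s\<^sup>2 * B\<^sup>2 \<partial>M)"
    proof (rule integral_mono)
      fix x assume x: "x \<in> space M"
      have "\<bar>s * f x\<bar> \<le> s * B" using B(2)[OF x] s by (simp add: abs_mult)
      then have "\<bar>s * f x\<bar> \<le> 1" "(s * f x)\<^sup>2 \<le> (s * B)\<^sup>2"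
        using s(3) by (auto simp: abs_le_square_iff[symmetric])
      then show "exp (s * f x) \<le> 1 + s * f x + s\<^sup>2 * B\<^sup>2"
        using exp_le_quadratic[of "s * f x"] by (simp add: power_mult_distrib)
    qed (intro bdd_meas_integrable bm_intros f)+
    also have "\<dots> = 1 + (s * (\<integral>x. f x \<partial>M) + s\<^sup>2 * B\<^sup>2)"
      using bdd_meas_integrable[OF f] by (simp add: prob_space)
    finally have "ln (\<integral>x. exp (s * f x) \<partial>M) \<le> s * (\<integral>x. f x \<partial>M) + s\<^sup>2 * B\<^sup>2"
      using expectation_exp_pos[OF bdd_meas_mult[OF bdd_meas_const[of M s] f]]
        ln_le_minus_one[of "\<integral>x. exp (s * f x) \<partial>M"] by linarith
    with le[OF s(1,2)] have "s * \<phi> s \<le> s * ((\<integral>x. f x \<partial>M) + s * B\<^sup>2)"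
      by (simp add: power2_eq_square algebra_simps)
    then show ?thesis using s by simp
  qed
  have lim: "(\<lambda>k. s0 / 2 ^ k) \<longlonglongrightarrow> 0"
    using tendsto_mult[OF tendsto_const[of s0] LIMSEQ_power_zero[of "1/2 :: real"]]
    by (simp add: power_one_over field_simps)
  have "\<forall>\<^sub>F k in sequentially. s0 / 2 ^ k * B < 1"
    using order_tendstoD(2)[OF tendsto_mult_left[OF lim, of B], of 1] by (simp add: mult.commute)
  then have ev: "\<forall>\<^sub>F k in sequentially. \<phi> s0 \<le> (\<integral>x. f x \<partial>M) + s0 / 2 ^ k * B\<^sup>2"
  proof eventually_elim
    case (elim k)
    have "s0 / 2 ^ k \<le> s0" using s0 by (simp add: field_simps)
    with bound[of "s0 / 2 ^ k"] it[of k] s0 elim show ?case by (simp add: less_imp_le)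
  qed
  have "(\<lambda>k. (\<integral>x. f x \<partial>M) + s0 / 2 ^ k * B\<^sup>2) \<longlonglongrightarrow> (\<integral>x. f x \<partial>M) + 0 * B\<^sup>2"
    by (intro tendsto_intros lim)
  from tendsto_le[OF _ this tendsto_const ev] show ?thesis by simp
qed

section \<open>Entropy bounds through the jump variance\<close>

lemma bdd_meas_PiM_update:
  assumes g: "bdd_meas (\<Pi>\<^sub>M i\<in>I. M) g" and i: "i \<in> I" and x: "x \<in> space (\<Pi>\<^sub>M i\<in>I. M)"
  shows "bdd_meas M (\<lambda>y. g (x(i := y)))"
proof -
  have I: "insert i I = I" using i by auto
  have "bdd_meas ((\<Pi>\<^sub>M i\<in>I. M) \<Otimes>\<^sub>M M) (\<lambda>z. g ((fst z)(i := snd z)))"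
    using bdd_meas_compose[OF g, of "\<lambda>z. (fst z)(i := snd z)" "(\<Pi>\<^sub>M i\<in>I. M) \<Otimes>\<^sub>M M"]
      measurable_update_insert[of i I M] unfolding I .
  from bdd_meas_Pair1[OF this x] show ?thesis by simp
qed

text \<open>The quadratic variation \<open>\<Sum>\<^sub>i E'(g - g\<^sub>i')\<^sub>+\<^sup>2\<close> of Efron and Stein, where \<open>g\<^sub>i'\<close> resamples coordinate \<open>i\<close>.\<close>

definition jump_variance :: "'a measure \<Rightarrow> 'i set \<Rightarrow> (('i \<Rightarrow> 'a) \<Rightarrow> real) \<Rightarrow> ('i \<Rightarrow> 'a) \<Rightarrow> real" where
  "jump_variance M I g x = (\<Sum>i\<in>I. \<integral>y. (max 0 (g x - g (x(i := y))))\<^sup>2 \<partial>M)"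

lemma jump_variance_cmult:
  assumes "0 \<le> s" shows "jump_variance M I (\<lambda>x. s * g x) x = s\<^sup>2 * jump_variance M I g x"
proof -
  have "max 0 (s * a - s * b) = s * max 0 (a - b)" for a b
    using assms by (auto simp: max_def right_diff_distrib[symmetric] mult_le_0_iff zero_le_mult_iff)
  then show ?thesis
    by (simp add: jump_variance_def power_mult_distrib sum_distrib_left)
qed

text \<open>In the tensorized bound the factor exp (g x) does not involve the resampled value and
  leaves the inner integral. The majorant Q is where the structure of the variable enters: up to the
  factor s^2 it is c V for a self-bounding V, and 2 V + 2 w for the supremum.\<close>

lemma (in prob_space) exp_entropy_le_jump_variance:
  assumes I: "finite I" and g: "bdd_meas (\<Pi>\<^sub>M i\<in>I. M) g" and Q: "bdd_meas (\<Pi>\<^sub>M i\<in>I. M) Q"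
    and le: "\<And>x. x \<in> space (\<Pi>\<^sub>M i\<in>I. M) \<Longrightarrow> jump_variance M I g x \<le> Q x"
  shows "exp_entropy (\<Pi>\<^sub>M i\<in>I. M) g \<le> (\<integral>x. Q x * exp (g x) \<partial>(\<Pi>\<^sub>M i\<in>I. M))"
proof -
  let ?K = "\<Pi>\<^sub>M i\<in>I. M"
  interpret K: prob_space ?K by (rule prob_space_PiM_const)
  have h: "bdd_meas ?K (\<lambda>x. \<integral>y. exp (g x) * (max 0 (g x - g (x(i := y))))\<^sup>2 \<partial>M)" if "i \<in> I" for i
  proof -
    have 1: "bdd_meas (?K \<Otimes>\<^sub>M M) (\<lambda>z. g (fst z))" by (rule bdd_meas_fst[OF g])
    have "insert i I = I" using that by auto
    then have 2: "bdd_meas (?K \<Otimes>\<^sub>M M) (\<lambda>z. g ((fst z)(i := snd z)))"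
      using bdd_meas_compose[OF g, of _ "?K \<Otimes>\<^sub>M M"] measurable_update_insert[of i I M] by simp
    have "bdd_meas (?K \<Otimes>\<^sub>M M) (\<lambda>z. exp (g (fst z)) * (max 0 (g (fst z) - g ((fst z)(i := snd z))))\<^sup>2)"
      by (intro bm_intros 1 2)
    from bdd_meas_integral[OF this] show ?thesis by simp
  qed
  have "exp_entropy ?K g \<le>
    (\<Sum>i\<in>I. \<integral>x. \<integral>y. exp (g x) * (max 0 (g x - g (x(i := y))))\<^sup>2 \<partial>M \<partial>?K)"
    by (rule exp_entropy_tensorization[OF I g])
  also have "\<dots> = (\<integral>x. (\<Sum>i\<in>I. \<integral>y. exp (g x) * (max 0 (g x - g (x(i := y))))\<^sup>2 \<partial>M) \<partial>?K)"
    by (intro Bochner_Integration.integral_sum[symmetric] K.bdd_meas_integrable h)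
  also have "\<dots> \<le> (\<integral>x. Q x * exp (g x) \<partial>?K)"
  proof (rule integral_mono)
    fix x assume x: "x \<in> space ?K"
    have "(\<Sum>i\<in>I. \<integral>y. exp (g x) * (max 0 (g x - g (x(i := y))))\<^sup>2 \<partial>M) = exp (g x) * jump_variance M I g x"
      by (simp add: jump_variance_def sum_distrib_left)
    then show "(\<Sum>i\<in>I. \<integral>y. exp (g x) * (max 0 (g x - g (x(i := y))))\<^sup>2 \<partial>M) \<le> Q x * exp (g x)"
      using le[OF x] by (simp add: mult.commute)
  qed (intro K.bdd_meas_integrable bm_intros h g Q; assumption)+
  finally show ?thesis .
qed

text \<open>For g = s V the majorant s^2 c V is a multiple of g itself, so its integral against exp
  g is s c (e + m H(s)): the entropy e appears on both sides and can be solved for when q = s c is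
  small. Halving then yields (1 - 2 q) H(s) \<le> (1 - q) 2 H(s / 2).\<close>

lemma (in prob_space) log_mgf_self_bounding:
  assumes I: "finite I" and V: "bdd_meas (\<Pi>\<^sub>M i\<in>I. M) V"
    and V0: "\<And>x. x \<in> space (\<Pi>\<^sub>M i\<in>I. M) \<Longrightarrow> 0 \<le> V x"
    and le: "\<And>x. x \<in> space (\<Pi>\<^sub>M i\<in>I. M) \<Longrightarrow> jump_variance M I V x \<le> c * V x"
    and c: "0 < c" and s0: "0 < s0" "8 * s0 * c \<le> 1"
  shows "ln (\<integral>x. exp (s0 * V x) \<partial>(\<Pi>\<^sub>M i\<in>I. M)) \<le> 2 * s0 * (\<integral>x. V x \<partial>(\<Pi>\<^sub>M i\<in>I. M))"
proof -
  let ?K = "\<Pi>\<^sub>M i\<in>I. M"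
  interpret K: prob_space ?K by (rule prob_space_PiM_const)
  define H where "H s = ln (\<integral>x. exp (s * V x) \<partial>?K)" for s
  have sV: "bdd_meas ?K (\<lambda>x. s * V x)" for s by (intro bm_intros V)
  have H0: "0 \<le> H s" if "0 < s" for s
  proof -
    have "1 \<le> (\<integral>x. exp (s * V x) \<partial>?K)"
      using that V0 by (intro K.expectation_ge_const K.bdd_meas_integrable bm_intros V) simp
    then show ?thesis by (simp add: H_def)
  qed
  \<comment> \<open>The factor 1 - 4 q, with q = s c, becomes 1 - 2 q at s / 2; monotonicity under
    halving reduces to (1 - q)(1 - 4 q) \<le> (1 - 2 q)^2.\<close>
  define \<phi> where "\<phi> s = (1 - 4 * s * c) * H s / s" for s
  have q: "0 < s * c \<and> s * c \<le> 1 / 8" if "0 < s" "s \<le> s0" for s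
  proof -
    have "s * c \<le> s0 * c" using that c by simp
    moreover have "0 < s * c" using that c by simp
    ultimately show ?thesis using s0 by linarith
  qed
  have "\<phi> s0 \<le> (\<integral>x. V x \<partial>?K)"
  proof (rule K.log_mgf_le_of_halving[OF V s0(1)])
    fix s assume s: "0 < s" "s \<le> s0"
    show "s * \<phi> s \<le> ln (\<integral>x. exp (s * V x) \<partial>?K)"
      using q[OF s] H0[OF s(1)] s mult_right_mono[of "1 - 4 * (s * c)" 1 "H s"] by (simp add: \<phi>_def H_def[symmetric] mult.assoc)
    let ?q = "s * c"
    define m where "m = (\<integral>x. exp (s * V x) \<partial>?K)"
    define e where "e = exp_entropy ?K (\<lambda>x. s * V x)"
    have m: "0 < m" unfolding m_def by (rule K.expectation_exp_pos[OF sV])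
    have "e \<le> (\<integral>x. (s\<^sup>2 * (c * V x)) * exp (s * V x) \<partial>?K)"
      unfolding e_def
      by (rule exp_entropy_le_jump_variance[OF I sV]) (auto intro!: bm_intros V mult_left_mono le simp: jump_variance_cmult s(1)[THEN less_imp_le])
    also have "\<dots> = (\<integral>x. ?q * ((s * V x) * exp (s * V x)) \<partial>?K)"
      by (intro Bochner_Integration.integral_cong refl) (simp add: power2_eq_square)
    also have "\<dots> = ?q * (e + m * H s)"
      by (simp add: e_def m_def H_def exp_entropy_def)
    finally have "(1 - ?q) * (e / m) \<le> ?q * H s"
      using m by (simp add: field_simps)
    moreover have "H s \<le> 2 * H (s / 2) + e / m"
      using K.log_mgf_halving[OF sV[of s]] by (simp add: H_def e_def m_def)
    ultimately have *: "(1 - 2 * ?q) * H s \<le> (1 - ?q) * (2 * H (s / 2))"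
      using q[OF s] mult_left_mono[of "H s" "2 * H (s / 2) + e / m" "1 - ?q"] by (simp add: algebra_simps)
    have "(1 - ?q) * ((1 - 4 * ?q) * H s) \<le> (1 - 2 * ?q) * ((1 - 2 * ?q) * H s)"
    proof -
      have "(1 - ?q) * (1 - 4 * ?q) \<le> (1 - 2 * ?q) * (1 - 2 * ?q)"
        using q[OF s] by (simp add: algebra_simps)
      from mult_right_mono[OF this H0[OF s(1)]] show ?thesis by (simp add: mult.assoc)
    qed
    also have "\<dots> \<le> (1 - 2 * ?q) * ((1 - ?q) * (2 * H (s / 2)))"
      using q[OF s] by (intro mult_left_mono *) auto
    finally have "(1 - ?q) * ((1 - 4 * ?q) * H s) \<le> (1 - ?q) * ((1 - 2 * ?q) * (2 * H (s / 2)))"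
      by (simp add: algebra_simps)
    then have "(1 - 4 * ?q) * H s \<le> (1 - 2 * ?q) * (2 * H (s / 2))"
      using q[OF s] by simp
    then have "(1 - 4 * ?q) * H s / s \<le> (1 - 2 * ?q) * (2 * H (s / 2)) / s"
      using s by (intro divide_right_mono) auto
    then show "\<phi> s \<le> \<phi> (s / 2)"
      by (simp add: \<phi>_def mult.assoc mult.commute[of _ 2])
  qed
  then have "(1 - 4 * (s0 * c)) * H s0 \<le> s0 * (\<integral>x. V x \<partial>?K)"
    using s0 by (simp add: \<phi>_def field_simps)
  \<comment> \<open>The condition \<open>8 * s0 * c \<le> 1\<close> leaves a factor of at least 1/2,
    whence the 2 in the claim.\<close>
  moreover have "1 / 2 * H s0 \<le> (1 - 4 * (s0 * c)) * H s0"
    using s0 H0[OF s0(1)] by (intro mult_right_mono) auto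
  ultimately show ?thesis by (simp add: H_def)
qed

text \<open>The bound on the jump variance of Z is random through V, so the entropy bound contains
  the mean of V exp (s Z). The Gibbs principle separates the two factors at the price of 8 c times
  the entropy of s Z, which the left-hand side absorbs for small s.\<close>

lemma (in prob_space) log_mgf_weak_variance:
  assumes I: "finite I" and V: "bdd_meas (\<Pi>\<^sub>M i\<in>I. M) V" and Z: "bdd_meas (\<Pi>\<^sub>M i\<in>I. M) Z"
    and V0: "\<And>x. x \<in> space (\<Pi>\<^sub>M i\<in>I. M) \<Longrightarrow> 0 \<le> V x"
    and leV: "\<And>x. x \<in> space (\<Pi>\<^sub>M i\<in>I. M) \<Longrightarrow> jump_variance M I V x \<le> c * V x"
    and leZ: "\<And>x. x \<in> space (\<Pi>\<^sub>M i\<in>I. M) \<Longrightarrow> jump_variance M I Z x \<le> 2 * V x + 2 * w"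
    and c: "0 < c" and w: "0 \<le> w" and s0: "0 < s0" "36 * s0\<^sup>2 * c \<le> 1"
  shows "ln (\<integral>x. exp (s0 * Z x) \<partial>(\<Pi>\<^sub>M i\<in>I. M)) \<le> s0 * (\<integral>x. Z x \<partial>(\<Pi>\<^sub>M i\<in>I. M)) +
    2 * s0\<^sup>2 * (8 * (\<integral>x. V x \<partial>(\<Pi>\<^sub>M i\<in>I. M)) + 4 * w)"
proof -
  let ?K = "\<Pi>\<^sub>M i\<in>I. M"
  interpret K: prob_space ?K by (rule prob_space_PiM_const)
  define H where "H s = ln (\<integral>x. exp (s * Z x) \<partial>?K)" for s
  define EV where "EV = (\<integral>x. V x \<partial>?K)"
  have EV0: "0 \<le> EV" unfolding EV_def using V0 by (intro K.expectation_ge_const K.bdd_meas_integrable V)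
  define v where "v = 8 * EV + 4 * w"
  have v0: "0 \<le> v" using EV0 w by (simp add: v_def)
  have sZ: "bdd_meas ?K (\<lambda>x. s * Z x)" for s by (intro bm_intros Z)
  \<comment> \<open>The largest exponent that \<open>log_mgf_self_bounding\<close> admits for
    V.\<close>
  define \<theta> where "\<theta> = 1 / (8 * c)"
  have \<theta>: "0 < \<theta>" "8 * \<theta> * c \<le> 1" using c by (auto simp: \<theta>_def)
  \<comment> \<open>Each halving costs s v in H(s) / s; the series s v + s v / 2 + ... adds up to
    the correction 2 s v.\<close>
  define \<phi> where "\<phi> s = H s / s - 2 * s * v" for s
  have "\<phi> s0 \<le> (\<integral>x. Z x \<partial>?K)"
  proof (rule K.log_mgf_le_of_halving[OF Z s0(1)])
    fix s assume s: "0 < s" "s \<le> s0"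
    show "s * \<phi> s \<le> ln (\<integral>x. exp (s * Z x) \<partial>?K)"
      using s v0 by (simp add: \<phi>_def H_def[symmetric] algebra_simps)
    define m where "m = (\<integral>x. exp (s * Z x) \<partial>?K)"
    define e where "e = exp_entropy ?K (\<lambda>x. s * Z x)"
    have m: "0 < m" unfolding m_def by (rule K.expectation_exp_pos[OF sZ])
    have sc: "36 * (s\<^sup>2 * c) \<le> 1"
    proof -
      have "s\<^sup>2 * c \<le> s0\<^sup>2 * c" using s c by (intro mult_right_mono power_mono) auto
      then show ?thesis using s0 by simp
    qed
    have i: "integrable ?K (\<lambda>x. V x * exp (s * Z x))" "integrable ?K (\<lambda>x. exp (s * Z x))"
      by (intro K.bdd_meas_integrable bm_intros V Z)+
    have "\<theta> * (\<integral>x. V x * exp (s * Z x) \<partial>?K) \<le> e + m * (2 * \<theta> * EV)"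
    proof -
      have "(\<integral>x. (\<theta> * V x) * exp (s * Z x) \<partial>?K) \<le> e + m * ln (\<integral>x. exp (\<theta> * V x) \<partial>?K)"
        unfolding e_def m_def by (rule K.gibbs_variational[OF sZ]) (intro bm_intros V)
      also have "\<dots> \<le> e + m * (2 * \<theta> * EV)"
        using m log_mgf_self_bounding[OF I V V0 leV c \<theta>] by (simp add: EV_def)
      finally show ?thesis by (simp add: mult.assoc)
    qed
    then have gib: "(\<integral>x. V x * exp (s * Z x) \<partial>?K) \<le> 8 * c * e + m * (2 * EV)"
      using c by (simp add: \<theta>_def field_simps)
    have "e \<le> (\<integral>x. (s\<^sup>2 * (2 * V x + 2 * w)) * exp (s * Z x) \<partial>?K)"
      unfolding e_def
      by (rule exp_entropy_le_jump_variance[OF I sZ]) (auto intro!: bm_intros V mult_left_mono leZ simp: jump_variance_cmult s(1)[THEN less_imp_le])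
    also have "\<dots> = (\<integral>x. 2 * s\<^sup>2 * (V x * exp (s * Z x)) + 2 * s\<^sup>2 * w * exp (s * Z x) \<partial>?K)"
      by (intro Bochner_Integration.integral_cong refl) (simp add: algebra_simps)
    also have "\<dots> = 2 * s\<^sup>2 * (\<integral>x. V x * exp (s * Z x) \<partial>?K) + 2 * s\<^sup>2 * w * m"
      using i by (simp add: m_def)
    also have "\<dots> \<le> 2 * s\<^sup>2 * (8 * c * e + m * (2 * EV)) + 2 * s\<^sup>2 * w * m"
      by (intro add_right_mono mult_left_mono gib) auto
    finally have *: "e \<le> 16 * (s\<^sup>2 * c) * e + s\<^sup>2 * m * v / 2"
      by (simp add: v_def field_simps)
    \<comment> \<open>The coefficient 16 s^2 c is at most 16/36 < 1/2, so the left-hand side absorbs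
      the term in e; a negative e satisfies the bound at once.\<close>
    have "e \<le> s\<^sup>2 * m * v"
    proof (cases "0 \<le> e")
      case True
      have "16 * (s\<^sup>2 * c) * e \<le> 1 / 2 * e" using True sc by (intro mult_right_mono) auto
      with * show ?thesis by simp
    next
      case False
      moreover have "0 \<le> s\<^sup>2 * m * v" using m v0 by simp
      ultimately show ?thesis by linarith
    qed
    then have "e / m \<le> s\<^sup>2 * v" using m by (simp add: field_simps)
    moreover have "H s \<le> 2 * H (s / 2) + e / m"
      using K.log_mgf_halving[OF sZ[of s]] by (simp add: H_def e_def m_def)
    ultimately have "H s \<le> 2 * H (s / 2) + s\<^sup>2 * v" by simp
    then have "H s / s \<le> (2 * H (s / 2) + s\<^sup>2 * v) / s"
      using s by (intro divide_right_mono) auto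
    also have "\<dots> = H (s / 2) / (s / 2) + s * v"
      using s by (simp add: add_divide_distrib power2_eq_square)
    finally show "\<phi> s \<le> \<phi> (s / 2)"
      by (simp add: \<phi>_def)
  qed
  then have "H s0 \<le> s0 * (\<integral>x. Z x \<partial>?K) + 2 * s0\<^sup>2 * v"
    using s0 by (simp add: \<phi>_def field_simps power2_eq_square)
  then show ?thesis by (simp add: H_def v_def EV_def)
qed

section \<open>Empirical processes over finite classes\<close>

text \<open>The abstract index set lets one class a carry three choices of l: loss differences,
  their negatives, and the squares \<open>a\<^sup>2 / (2 m)\<close>. The element t0, where a and l
  vanish, gives |l| \<le> |a| and makes one-sided suprema nonnegative.\<close>

locale finite_class = prob_space M for M :: "'a measure" +
  fixes I :: "'i set" and T :: "'t set" and a l :: "'t \<Rightarrow> 'a \<Rightarrow> real" and m :: real and t0 :: 't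
  assumes fin_I: "finite I" and fin_T: "finite T" and t0: "t0 \<in> T"
    and a_meas: "\<And>t. t \<in> T \<Longrightarrow> a t \<in> borel_measurable M"
    and l_meas: "\<And>t. t \<in> T \<Longrightarrow> l t \<in> borel_measurable M"
    and a_bound: "\<And>t z. t \<in> T \<Longrightarrow> z \<in> space M \<Longrightarrow> \<bar>a t z\<bar> \<le> m"
    and a_t0: "\<And>z. z \<in> space M \<Longrightarrow> a t0 z = 0" and l_t0: "\<And>z. z \<in> space M \<Longrightarrow> l t0 z = 0"
    and contraction: "\<And>t s z. t \<in> T \<Longrightarrow> s \<in> T \<Longrightarrow> z \<in> space M \<Longrightarrow> \<bar>l t z - l s z\<bar> \<le> \<bar>a t z - a s z\<bar>"
    and m_pos: "0 < m"
begin

lemma T_ne: "T \<noteq> {}" using t0 by auto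

lemma l_le_a: "t \<in> T \<Longrightarrow> z \<in> space M \<Longrightarrow> \<bar>l t z\<bar> \<le> \<bar>a t z\<bar>"
  using contraction[of t t0 z] t0 a_t0 l_t0 by simp

lemma a_bdd: "t \<in> T \<Longrightarrow> bdd_meas M (a t)"
  by (rule bdd_measI[OF a_meas a_bound])

lemma l_bdd: "t \<in> T \<Longrightarrow> bdd_meas M (l t)"
  by (rule bdd_measI[OF l_meas, of _ m]) (auto intro: order_trans[OF l_le_a a_bound])

lemma ge_Max: "t \<in> T \<Longrightarrow> f t \<le> Max (f ` T)" for f :: "'t \<Rightarrow> real"
  using fin_T by simp

lemma Max_attained: "\<exists>t\<in>T. Max (f ` T) = f t" for f :: "'t \<Rightarrow> real"
proof -
  have "Max (f ` T) \<in> f ` T" using fin_T T_ne by simp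
  then show ?thesis by auto
qed

text \<open>One coordinate is symmetrized with a ghost copy and contracted at the same time.\<close>

lemma symmetrize_coordinate:
  "(\<integral>z. Max ((\<lambda>t. c t + (l t z - expectation (l t))) ` T) \<partial>M) \<le>
   (\<integral>z. (Max ((\<lambda>t. c t + 2 * a t z) ` T) + Max ((\<lambda>t. c t - 2 * a t z) ` T)) / 2 \<partial>M)"
proof -
  interpret Q: pair_prob_space M M ..
  define \<phi> where "\<phi> z = (Max ((\<lambda>t. c t + 2 * a t z) ` T) + Max ((\<lambda>t. c t - 2 * a t z) ` T)) / 2" for z
  define G where "G w = Max ((\<lambda>t. c t + (l t (fst w) - l t (snd w))) ` T)" for w
  have \<phi>: "bdd_meas M \<phi>" unfolding \<phi>_def by (intro bm_intros a_bdd fin_T T_ne)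
  have G: "bdd_meas (M \<Otimes>\<^sub>M M) G" unfolding G_def
    by (intro bm_intros fin_T T_ne bdd_meas_fst bdd_meas_snd l_bdd)
  have G': "bdd_meas (M \<Otimes>\<^sub>M M) (\<lambda>w. G (snd w, fst w))"
    using Q.bdd_meas_swap[OF G] by (simp add: case_prod_unfold)
  have "(\<integral>z. Max ((\<lambda>t. c t + (l t z - expectation (l t))) ` T) \<partial>M) \<le> (\<integral>z. \<integral>z'. G (z, z') \<partial>M \<partial>M)"
  proof (rule integral_mono)
    fix z assume z: "z \<in> space M"
    \<comment> \<open>The mean of l t is an average over the ghost copy z', and a maximum of
      averages is at most the average of the maxima.\<close>
    have "c t + (l t z - expectation (l t)) \<le> (\<integral>z'. G (z, z') \<partial>M)" if t: "t \<in> T" for t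
    proof -
      have "c t + (l t z - expectation (l t)) = (\<integral>z'. c t + (l t z - l t z') \<partial>M)"
        using bdd_meas_integrable[OF l_bdd[OF t]] by (simp add: prob_space)
      also have "\<dots> \<le> (\<integral>z'. G (z, z') \<partial>M)"
        using t fin_T by (intro integral_mono bdd_meas_integrable bm_intros l_bdd bdd_meas_Pair1[OF G] z)
          (auto simp: G_def intro!: Max_ge)
      finally show ?thesis .
    qed
    then show "Max ((\<lambda>t. c t + (l t z - expectation (l t))) ` T) \<le> (\<integral>z'. G (z, z') \<partial>M)"
      using fin_T T_ne by simp
  qed (intro bdd_meas_integrable bm_intros l_bdd fin_T T_ne bdd_meas_integral G; assumption)+
  also have "\<dots> = (integral\<^sup>L (M \<Otimes>\<^sub>M M) G + (\<integral>w. G (snd w, fst w) \<partial>(M \<Otimes>\<^sub>M M))) / 2"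
    using Q.bdd_meas_iterated[OF G] Q.bdd_meas_iterated[OF G'] by simp
  also have "\<dots> = (\<integral>w. (G w + G (snd w, fst w)) / 2 \<partial>(M \<Otimes>\<^sub>M M))"
    using Q.bdd_meas_integrable[OF G] Q.bdd_meas_integrable[OF G'] by simp
  also have "\<dots> \<le> (\<integral>w. (\<phi> (fst w) + \<phi> (snd w)) / 2 \<partial>(M \<Otimes>\<^sub>M M))"
  proof (rule integral_mono)
    fix w assume "w \<in> space (M \<Otimes>\<^sub>M M)"
    then obtain z z' where w: "w = (z, z')" and z: "z \<in> space M" "z' \<in> space M"
      by (auto simp: space_pair_measure)
    \<comment> \<open>With t optimal for (z, z') and s for (z', z), the sum of the two values groups
      into c t + c s, plus l t - l s at z, minus l t - l s at z'. Contraction turns these into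
      differences of a; using t in one maximum of \<phi> and s in the other recovers the term |a t -
      a s|.\<close>
    obtain t where t: "t \<in> T" "G (z, z') = c t + (l t z - l t z')"
      using Max_attained[of "\<lambda>t. c t + (l t z - l t z')"] by (auto simp: G_def)
    obtain s where s: "s \<in> T" "G (z', z) = c s + (l s z' - l s z)"
      using Max_attained[of "\<lambda>t. c t + (l t z' - l t z)"] by (auto simp: G_def)
    have \<phi>_ge: "(c t + c s) / 2 + \<bar>a t x - a s x\<bar> \<le> \<phi> x" for x
      using ge_Max[OF t(1), of "\<lambda>t. c t + 2 * a t x"] ge_Max[OF t(1), of "\<lambda>t. c t - 2 * a t x"]
        ge_Max[OF s(1), of "\<lambda>t. c t + 2 * a t x"] ge_Max[OF s(1), of "\<lambda>t. c t - 2 * a t x"]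
      unfolding \<phi>_def by argo
    have "G (z, z') + G (z', z) \<le> \<phi> z + \<phi> z'"
      using contraction[OF t(1) s(1) z(1)] contraction[OF t(1) s(1) z(2)] \<phi>_ge[of z] \<phi>_ge[of z']
      unfolding t(2) s(2) by argo
    then show "(G w + G (snd w, fst w)) / 2 \<le> (\<phi> (fst w) + \<phi> (snd w)) / 2" by (simp add: w)
  qed (intro Q.bdd_meas_integrable bm_intros G G' bdd_meas_fst bdd_meas_snd \<phi>)+
  also have "\<dots> = (\<integral>z. \<phi> z \<partial>M)"
  proof -
    have 1: "(\<integral>w. \<phi> (fst w) \<partial>(M \<Otimes>\<^sub>M M)) = (\<integral>z. \<phi> z \<partial>M)"
      by (subst Q.bdd_meas_iterated(1)[symmetric]) (auto intro!: bdd_meas_fst \<phi> simp: prob_space)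
    have 2: "(\<integral>w. \<phi> (snd w) \<partial>(M \<Otimes>\<^sub>M M)) = (\<integral>z. \<phi> z \<partial>M)"
      by (subst Q.bdd_meas_iterated(1)[symmetric]) (auto intro!: bdd_meas_snd \<phi> simp: prob_space)
    show ?thesis
      using Q.bdd_meas_integrable[OF bdd_meas_fst[OF \<phi>, of M]] Q.bdd_meas_integrable[OF bdd_meas_snd[OF \<phi>, of M]]
      by (simp add: 1 2)
  qed
  finally show ?thesis by (simp add: \<phi>_def)
qed

end

section \<open>Averages over sign vectors\<close>

definition sign_vectors :: "'i set \<Rightarrow> ('i \<Rightarrow> real) set" where
  "sign_vectors I = (\<Pi>\<^sub>E i\<in>I. {-1, 1})"

text \<open>A finite sum instead of an integral: signs are added one coordinate at a time through
  \<open>sign_average_insert\<close>, and the link to the product law of the signs is made once, in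
  \<open>sign_average_le_nn_integral\<close>.\<close>

definition sign_average :: "'i set \<Rightarrow> (('i \<Rightarrow> real) \<Rightarrow> real) \<Rightarrow> real" where
  "sign_average I f = (\<Sum>\<epsilon>\<in>sign_vectors I. f \<epsilon>) / 2 ^ card I"

lemma finite_sign_vectors: "finite I \<Longrightarrow> finite (sign_vectors I)"
  by (simp add: sign_vectors_def finite_PiE)

lemma sign_average_empty: "sign_average {} f = f (\<lambda>_. undefined)"
  by (simp add: sign_average_def sign_vectors_def)

lemma sign_average_insert:
  assumes "finite I" "k \<notin> I"
  shows "sign_average (insert k I) f = sign_average I (\<lambda>\<epsilon>. (f (\<epsilon>(k := 1)) + f (\<epsilon>(k := -1))) / 2)"
proof -
  have inj: "inj_on (\<lambda>(y, g). g(k := y)) ({-1, 1} \<times> sign_vectors I)"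
    unfolding sign_vectors_def by (rule inj_combinator) fact
  have "(\<Sum>\<epsilon>\<in>sign_vectors (insert k I). f \<epsilon>) = (\<Sum>(e, \<epsilon>)\<in>{-1, 1} \<times> sign_vectors I. f (\<epsilon>(k := e)))"
    unfolding sign_vectors_def PiE_insert_eq
    by (subst sum.reindex[OF inj[unfolded sign_vectors_def]]) (simp add: case_prod_unfold)
  also have "\<dots> = (\<Sum>\<epsilon>\<in>sign_vectors I. f (\<epsilon>(k := 1)) + f (\<epsilon>(k := -1)))"
    by (subst sum.cartesian_product[symmetric]) (simp add: sum.distrib)
  finally show ?thesis
    using assms by (simp add: sign_average_def sum_divide_distrib[symmetric])
qed

lemma sign_average_mono:
  "(\<And>\<epsilon>. \<epsilon> \<in> sign_vectors I \<Longrightarrow> f \<epsilon> \<le> g \<epsilon>) \<Longrightarrow> sign_average I f \<le> sign_average I g"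
  by (auto simp: sign_average_def intro!: divide_right_mono sum_mono)

lemma sign_average_cmult: "sign_average I (\<lambda>\<epsilon>. c * f \<epsilon>) = c * sign_average I f"
  by (simp add: sign_average_def sum_distrib_left[symmetric])

context finite_class
begin

lemma component_bdd: "bdd_meas M f \<Longrightarrow> i \<in> J \<Longrightarrow> bdd_meas (\<Pi>\<^sub>M i\<in>J. M) (\<lambda>x. f (x i))"
  by (erule bdd_meas_compose) (rule measurable_component_singleton)

text \<open>The free offset c carries the induction: it stores what is frozen while other
  coordinates are treated. For the new coordinate this includes the sum over J, for the induction
  hypothesis the term e * a t y with e = 2 or e = -2. Fubini exchanges the two roles in
  between.\<close>

lemma symmetrization_contraction_aux:
  assumes "finite J"
  shows "(\<integral>x. Max ((\<lambda>t. c t + (\<Sum>i\<in>J. l t (x i) - expectation (l t))) ` T) \<partial>(\<Pi>\<^sub>M i\<in>J. M)) \<le>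
    sign_average J (\<lambda>\<epsilon>. \<integral>x. Max ((\<lambda>t. c t + 2 * (\<Sum>i\<in>J. \<epsilon> i * a t (x i))) ` T) \<partial>(\<Pi>\<^sub>M i\<in>J. M))"
  using assms
proof (induction J arbitrary: c rule: finite_induct)
  case empty
  show ?case by (simp add: sign_average_empty PiM_empty lebesgue_integral_count_space_finite)
next
  case (insert k J c)
  let ?J = "\<Pi>\<^sub>M i\<in>J. M" and ?K = "\<Pi>\<^sub>M i\<in>insert k J. M"
  interpret J: prob_space ?J by (rule prob_space_PiM_const)
  interpret K: prob_space ?K by (rule prob_space_PiM_const)
  interpret Q: pair_prob_space ?J M ..
  note ins = PiM_insert_integral[OF _ insert.hyps]
  have sum_ins: "(\<Sum>i\<in>insert k J. f i ((x(k := y)) i)) = f k y + (\<Sum>i\<in>J. f i (x i))" for f :: "_ \<Rightarrow> 'a \<Rightarrow> real" and x y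
  proof -
    have "(\<Sum>i\<in>J. f i ((x(k := y)) i)) = (\<Sum>i\<in>J. f i (x i))"
      using insert.hyps by (intro sum.cong refl) auto
    then show ?thesis using insert.hyps by simp
  qed
  have fstJ: "bdd_meas (?J \<Otimes>\<^sub>M M) (\<lambda>z. f (fst z i))" if "bdd_meas M f" "i \<in> J" for f i
    using bdd_meas_fst[OF component_bdd[OF that], of M] .
  \<comment> \<open>L is the original supremum, A has coordinate k symmetrized with coefficient e,
    and S has all coordinates symmetrized.\<close>
  define L where "L z = Max ((\<lambda>t. (c t + (l t (snd z) - expectation (l t))) + (\<Sum>i\<in>J. l t (fst z i) - expectation (l t))) ` T)" for z
  define A where "A e z = Max ((\<lambda>t. (c t + e * a t (snd z)) + (\<Sum>i\<in>J. l t (fst z i) - expectation (l t))) ` T)" for e z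
  define S where "S \<epsilon> e z = Max ((\<lambda>t. (c t + e * a t (snd z)) + 2 * (\<Sum>i\<in>J. \<epsilon> i * a t (fst z i))) ` T)" for \<epsilon> e z
  have L: "bdd_meas (?J \<Otimes>\<^sub>M M) L"
    unfolding L_def by (intro bm_intros fin_T T_ne bdd_meas_snd l_bdd fstJ; assumption)
  have A: "bdd_meas (?J \<Otimes>\<^sub>M M) (A e)" for e
    unfolding A_def by (intro bm_intros fin_T T_ne bdd_meas_snd l_bdd a_bdd fstJ; assumption)
  have S: "bdd_meas (?J \<Otimes>\<^sub>M M) (S \<epsilon> e)" for \<epsilon> e
    unfolding S_def by (intro bm_intros fin_T T_ne bdd_meas_snd a_bdd fstJ; assumption)
  have "(\<integral>x. Max ((\<lambda>t. c t + (\<Sum>i\<in>insert k J. l t (x i) - expectation (l t))) ` T) \<partial>?K) = integral\<^sup>L (?J \<Otimes>\<^sub>M M) L"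
    by (subst ins)
       (auto simp: L_def[abs_def] sum_ins[of "\<lambda>i z. l _ z - expectation (l _)", simplified] add.assoc
         intro!: bm_intros fin_T T_ne l_bdd component_bdd)
  also have "\<dots> = (\<integral>x. \<integral>y. L (x, y) \<partial>M \<partial>?J)"
    by (rule Q.bdd_meas_iterated(1)[OF L, symmetric])
  also have "\<dots> \<le> (\<integral>x. \<integral>y. (A 2 (x, y) + A (-2) (x, y)) / 2 \<partial>M \<partial>?J)"
  proof (rule integral_mono)
    fix x
    show "(\<integral>y. L (x, y) \<partial>M) \<le> (\<integral>y. (A 2 (x, y) + A (-2) (x, y)) / 2 \<partial>M)"
      using symmetrize_coordinate[of "\<lambda>t. c t + (\<Sum>i\<in>J. l t (x i) - expectation (l t))"]
      by (simp add: L_def A_def algebra_simps)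
  qed (intro J.bdd_meas_integrable bdd_meas_integral bm_intros L A)+
  also have "\<dots> = (\<integral>y. \<integral>x. (A 2 (x, y) + A (-2) (x, y)) / 2 \<partial>?J \<partial>M)"
    using Q.bdd_meas_iterated[of "\<lambda>z. (A 2 z + A (-2) z) / 2"] by (simp add: bm_intros A)
  also have "\<dots> \<le> (\<integral>y. sign_average J (\<lambda>\<epsilon>. \<integral>x. (S \<epsilon> 2 (x, y) + S \<epsilon> (-2) (x, y)) / 2 \<partial>?J) \<partial>M)"
  proof (rule integral_mono)
    show "integrable M (\<lambda>y. \<integral>x. (A 2 (x, y) + A (-2) (x, y)) / 2 \<partial>?J)"
      by (intro bdd_meas_integrable Q.bdd_meas_integral1 bm_intros A)
    show "integrable M (\<lambda>y. sign_average J (\<lambda>\<epsilon>. \<integral>x. (S \<epsilon> 2 (x, y) + S \<epsilon> (-2) (x, y)) / 2 \<partial>?J))"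
      unfolding sign_average_def by (intro bdd_meas_integrable bm_intros Q.bdd_meas_integral1 S)
    fix y assume y: "y \<in> space M"
    have Ai: "integrable ?J (\<lambda>x. A e (x, y))" and Si: "integrable ?J (\<lambda>x. S \<epsilon> e (x, y))" for e \<epsilon>
      by (intro J.bdd_meas_integrable bdd_meas_Pair2[OF A] bdd_meas_Pair2[OF S] y)+
    have "(\<integral>x. A e (x, y) \<partial>?J) \<le> sign_average J (\<lambda>\<epsilon>. \<integral>x. S \<epsilon> e (x, y) \<partial>?J)" for e
      using insert.IH[of "\<lambda>t. c t + e * a t y"] by (simp add: A_def S_def)
    from this[of 2] this[of "-2"]
    show "(\<integral>x. (A 2 (x, y) + A (-2) (x, y)) / 2 \<partial>?J) \<le> sign_average J (\<lambda>\<epsilon>. \<integral>x. (S \<epsilon> 2 (x, y) + S \<epsilon> (-2) (x, y)) / 2 \<partial>?J)"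
      using Ai Si by (simp add: sign_average_def sum.distrib sum_divide_distrib[symmetric] add_divide_distrib)
  qed
  also have "\<dots> = sign_average J (\<lambda>\<epsilon>. \<integral>y. \<integral>x. (S \<epsilon> 2 (x, y) + S \<epsilon> (-2) (x, y)) / 2 \<partial>?J \<partial>M)"
  proof -
    have "integrable M (\<lambda>y. \<integral>x. (S \<epsilon> 2 (x, y) + S \<epsilon> (-2) (x, y)) / 2 \<partial>?J)" for \<epsilon>
      by (intro bdd_meas_integrable Q.bdd_meas_integral1 bm_intros S)
    then show ?thesis
      unfolding sign_average_def by (simp only: Bochner_Integration.integral_divide_zero Bochner_Integration.integral_sum)
  qed
  also have "\<dots> = sign_average J (\<lambda>\<epsilon>. (integral\<^sup>L (?J \<Otimes>\<^sub>M M) (S \<epsilon> 2) + integral\<^sup>L (?J \<Otimes>\<^sub>M M) (S \<epsilon> (-2))) / 2)"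
  proof -
    have "(\<integral>y. \<integral>x. (S \<epsilon> 2 (x, y) + S \<epsilon> (-2) (x, y)) / 2 \<partial>?J \<partial>M) = (integral\<^sup>L (?J \<Otimes>\<^sub>M M) (S \<epsilon> 2) + integral\<^sup>L (?J \<Otimes>\<^sub>M M) (S \<epsilon> (-2))) / 2" for \<epsilon>
      using Q.bdd_meas_iterated(2)[of "\<lambda>z. (S \<epsilon> 2 z + S \<epsilon> (-2) z) / 2"] Q.bdd_meas_integrable[OF S] by (simp add: bm_intros S)
    then show ?thesis by simp
  qed
  also have "\<dots> = sign_average J (\<lambda>\<epsilon>. ((\<integral>x. Max ((\<lambda>t. c t + 2 * (\<Sum>i\<in>insert k J. (\<epsilon>(k := 1)) i * a t (x i))) ` T) \<partial>?K) +
       (\<integral>x. Max ((\<lambda>t. c t + 2 * (\<Sum>i\<in>insert k J. (\<epsilon>(k := -1)) i * a t (x i))) ` T) \<partial>?K)) / 2)"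
  proof -
    have "(\<integral>x. Max ((\<lambda>t. c t + 2 * (\<Sum>i\<in>insert k J. (\<epsilon>(k := e)) i * a t (x i))) ` T) \<partial>?K)
        = integral\<^sup>L (?J \<Otimes>\<^sub>M M) (S \<epsilon> (2 * e))" for \<epsilon> e
    proof -
      have 1: "(\<Sum>i\<in>insert k J. (\<epsilon>(k := e)) i * a t ((x(k := y)) i)) = e * a t y + (\<Sum>i\<in>J. \<epsilon> i * a t (x i))" for t x y
        using sum_ins[of "\<lambda>i z. (\<epsilon>(k := e)) i * a t z" x y] insert.hyps
        by (simp cong: sum.cong_simp add: if_distrib) (intro sum.cong; auto)
      show ?thesis
      proof (subst ins)
        show "bdd_meas ?K (\<lambda>x. Max ((\<lambda>t. c t + 2 * (\<Sum>i\<in>insert k J. (\<epsilon>(k := e)) i * a t (x i))) ` T))"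
          by (intro bm_intros fin_T T_ne a_bdd component_bdd; assumption)
        show "(\<integral>z. Max ((\<lambda>t. c t + 2 * (\<Sum>i\<in>insert k J. (\<epsilon>(k := e)) i * a t (((fst z)(k := snd z)) i))) ` T) \<partial>(?J \<Otimes>\<^sub>M M))
            = integral\<^sup>L (?J \<Otimes>\<^sub>M M) (S \<epsilon> (2 * e))"
          unfolding 1 by (simp only: S_def[abs_def] distrib_left mult.assoc add.assoc)
      qed
    qed
    from this[of _ 1] this[of _ "-1"] show ?thesis by simp
  qed
  also have "\<dots> = sign_average (insert k J) (\<lambda>\<epsilon>. \<integral>x. Max ((\<lambda>t. c t + 2 * (\<Sum>i\<in>insert k J. \<epsilon> i * a t (x i))) ` T) \<partial>?K)"
    by (rule sign_average_insert[OF insert.hyps, symmetric])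
  finally show ?case .
qed


section \<open>Expected suprema, jump variances and the tail bound\<close>

definition emp_process :: "'t \<Rightarrow> ('i \<Rightarrow> 'a) \<Rightarrow> real" where
  "emp_process t x = (\<Sum>i\<in>I. l t (x i) - expectation (l t))"

definition sup_process :: "('i \<Rightarrow> 'a) \<Rightarrow> real" where
  "sup_process x = Max ((\<lambda>t. \<bar>emp_process t x\<bar>) ` T)"

definition sup_squares :: "('i \<Rightarrow> 'a) \<Rightarrow> real" where
  "sup_squares x = Max ((\<lambda>t. \<Sum>i\<in>I. (a t (x i))\<^sup>2) ` T)"

definition rademacher :: real where
  "rademacher = sign_average I (\<lambda>\<epsilon>. \<integral>x. Max ((\<lambda>t. \<bar>\<Sum>i\<in>I. \<epsilon> i * a t (x i)\<bar>) ` T) \<partial>(\<Pi>\<^sub>M i\<in>I. M))"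

lemma emp_process_bdd: "t \<in> T \<Longrightarrow> bdd_meas (\<Pi>\<^sub>M i\<in>I. M) (emp_process t)"
  unfolding emp_process_def[abs_def] by (intro bm_intros component_bdd l_bdd)

lemma sup_process_bdd: "bdd_meas (\<Pi>\<^sub>M i\<in>I. M) sup_process"
  unfolding sup_process_def[abs_def] by (intro bm_intros fin_T T_ne emp_process_bdd)

lemma sup_squares_bdd: "bdd_meas (\<Pi>\<^sub>M i\<in>I. M) sup_squares"
  unfolding sup_squares_def[abs_def] by (intro bm_intros fin_T T_ne component_bdd a_bdd)

lemma sup_squares_nonneg: "0 \<le> sup_squares x"
  using ge_Max[OF t0, of "\<lambda>t. \<Sum>i\<in>I. (a t (x i))\<^sup>2"] sum_nonneg[of I "\<lambda>i. (a t0 (x i))\<^sup>2"]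
  by (simp add: sup_squares_def)

lemma symmetrization_contraction:
  "(\<integral>x. Max ((\<lambda>t. emp_process t x) ` T) \<partial>(\<Pi>\<^sub>M i\<in>I. M)) \<le> 2 * rademacher"
proof -
  let ?K = "\<Pi>\<^sub>M i\<in>I. M"
  interpret K: prob_space ?K by (rule prob_space_PiM_const)
  have "(\<integral>x. Max ((\<lambda>t. emp_process t x) ` T) \<partial>?K) \<le>
      sign_average I (\<lambda>\<epsilon>. \<integral>x. Max ((\<lambda>t. 2 * (\<Sum>i\<in>I. \<epsilon> i * a t (x i))) ` T) \<partial>?K)"
    using symmetrization_contraction_aux[OF fin_I, of "\<lambda>_. 0"] by (simp add: emp_process_def)
  also have "\<dots> \<le> sign_average I (\<lambda>\<epsilon>. \<integral>x. 2 * Max ((\<lambda>t. \<bar>\<Sum>i\<in>I. \<epsilon> i * a t (x i)\<bar>) ` T) \<partial>?K)"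
  proof (intro sign_average_mono integral_mono)
    fix \<epsilon> :: "'i \<Rightarrow> real" and x
    show "Max ((\<lambda>t. 2 * (\<Sum>i\<in>I. \<epsilon> i * a t (x i))) ` T) \<le> 2 * Max ((\<lambda>t. \<bar>\<Sum>i\<in>I. \<epsilon> i * a t (x i)\<bar>) ` T)"
    proof -
      obtain t where t: "t \<in> T" "Max ((\<lambda>t. 2 * (\<Sum>i\<in>I. \<epsilon> i * a t (x i))) ` T) = 2 * (\<Sum>i\<in>I. \<epsilon> i * a t (x i))"
        using Max_attained[of "\<lambda>t. 2 * (\<Sum>i\<in>I. \<epsilon> i * a t (x i))"] by auto
      show ?thesis
        using ge_Max[OF t(1), of "\<lambda>t. \<bar>\<Sum>i\<in>I. \<epsilon> i * a t (x i)\<bar>"] unfolding t(2) by linarith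
    qed
  qed (intro K.bdd_meas_integrable bm_intros fin_T T_ne component_bdd a_bdd; assumption)+
  finally show ?thesis
    by (simp add: rademacher_def sign_average_cmult)
qed

text \<open>The one-sided suprema of the process and of its negative are both nonnegative, because
  the process vanishes at t0; hence their sum dominates the absolute supremum. Each of them costs 2
  * \<open>rademacher\<close>.\<close>

lemma expectation_sup_process: "(\<integral>x. sup_process x \<partial>(\<Pi>\<^sub>M i\<in>I. M)) \<le> 4 * rademacher"
proof -
  let ?K = "\<Pi>\<^sub>M i\<in>I. M"
  interpret K: prob_space ?K by (rule prob_space_PiM_const)
  interpret neg: finite_class M I T a "\<lambda>t z. - l t z" m t0
    using fin_I fin_T t0 a_meas l_meas a_bound a_t0 l_t0 contraction m_pos
    by unfold_locales (auto simp: abs_minus_commute)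
  have neg: "neg.emp_process t x = - emp_process t x" for t x
    by (simp add: emp_process_def neg.emp_process_def sum_negf[symmetric] del: sum_negf)
  have "(\<integral>x. sup_process x \<partial>?K) \<le> (\<integral>x. Max ((\<lambda>t. emp_process t x) ` T) + Max ((\<lambda>t. neg.emp_process t x) ` T) \<partial>?K)"
  proof (rule integral_mono)
    fix x assume x: "x \<in> space ?K"
    have "emp_process t0 x = 0"
    proof -
      have "x i \<in> space M" if "i \<in> I" for i using x that by (auto simp: space_PiM)
      moreover have "expectation (l t0) = 0"
        using Bochner_Integration.integral_cong[OF refl l_t0, of M] by simp
      ultimately show ?thesis by (simp add: emp_process_def l_t0)
    qed
    then have 0: "0 \<le> Max ((\<lambda>t. emp_process t x) ` T)" "0 \<le> Max ((\<lambda>t. neg.emp_process t x) ` T)"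
      using ge_Max[OF t0, of "\<lambda>t. emp_process t x"] ge_Max[OF t0, of "\<lambda>t. neg.emp_process t x"] by (auto simp: neg)
    obtain t where t: "t \<in> T" "sup_process x = \<bar>emp_process t x\<bar>"
      using Max_attained[of "\<lambda>t. \<bar>emp_process t x\<bar>"] by (auto simp: sup_process_def)
    show "sup_process x \<le> Max ((\<lambda>t. emp_process t x) ` T) + Max ((\<lambda>t. neg.emp_process t x) ` T)"
      using 0 ge_Max[OF t(1), of "\<lambda>t. emp_process t x"] ge_Max[OF t(1), of "\<lambda>t. neg.emp_process t x"]
      unfolding t(2) neg by linarith
  qed (intro K.bdd_meas_integrable bm_intros fin_T T_ne emp_process_bdd neg.emp_process_bdd sup_process_bdd; assumption)+
  also have "\<dots> = (\<integral>x. Max ((\<lambda>t. emp_process t x) ` T) \<partial>?K) + (\<integral>x. Max ((\<lambda>t. neg.emp_process t x) ` T) \<partial>?K)"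
    by (intro Bochner_Integration.integral_add K.bdd_meas_integrable bm_intros fin_T T_ne emp_process_bdd neg.emp_process_bdd; assumption)
  also have "\<dots> \<le> 2 * rademacher + 2 * rademacher"
    using symmetrization_contraction neg.symmetrization_contraction
    by (intro add_mono) (auto simp: rademacher_def neg.rademacher_def)
  finally show ?thesis by simp
qed

text \<open>On [-m, m] the map u \<mapsto> u^2 / (2 m) is a contraction, so the one-sided
  symmetrization bound applies to the centred squares; the centring itself accounts for the term
  with w.\<close>

lemma expectation_sup_squares:
  assumes w: "\<And>t. t \<in> T \<Longrightarrow> (\<integral>z. (a t z)\<^sup>2 \<partial>M) \<le> w"
  shows "(\<integral>x. sup_squares x \<partial>(\<Pi>\<^sub>M i\<in>I. M)) \<le> real (card I) * w + 4 * m * rademacher"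
proof -
  let ?K = "\<Pi>\<^sub>M i\<in>I. M"
  interpret K: prob_space ?K by (rule prob_space_PiM_const)
  interpret sq: finite_class M I T a "\<lambda>t z. (a t z)\<^sup>2 / (2 * m)" m t0
  proof unfold_locales
    fix t s z assume ts: "t \<in> T" "s \<in> T" and z: "z \<in> space M"
    have "\<bar>(a t z)\<^sup>2 / (2 * m) - (a s z)\<^sup>2 / (2 * m)\<bar> = \<bar>a t z - a s z\<bar> * \<bar>a t z + a s z\<bar> / (2 * m)"
      using m_pos by (simp add: diff_divide_distrib[symmetric] abs_mult[symmetric] abs_divide power2_eq_square algebra_simps)
    also have "\<dots> \<le> \<bar>a t z - a s z\<bar> * (2 * m) / (2 * m)"
      using m_pos a_bound[OF ts(1) z] a_bound[OF ts(2) z]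
      by (intro divide_right_mono mult_left_mono) auto
    finally show "\<bar>(a t z)\<^sup>2 / (2 * m) - (a s z)\<^sup>2 / (2 * m)\<bar> \<le> \<bar>a t z - a s z\<bar>" using m_pos by simp
  qed (use fin_I fin_T t0 a_meas a_bound a_t0 m_pos in auto)
  have "(\<integral>x. sup_squares x \<partial>?K) \<le> (\<integral>x. real (card I) * w + 2 * m * Max ((\<lambda>t. sq.emp_process t x) ` T) \<partial>?K)"
  proof (rule integral_mono)
    fix x
    obtain t where t: "t \<in> T" "sup_squares x = (\<Sum>i\<in>I. (a t (x i))\<^sup>2)"
      using Max_attained[of "\<lambda>t. \<Sum>i\<in>I. (a t (x i))\<^sup>2"] by (auto simp: sup_squares_def)
    have "sup_squares x = card I * (\<integral>z. (a t z)\<^sup>2 \<partial>M) + 2 * m * sq.emp_process t x"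
    proof -
      have "sq.emp_process t x = (\<Sum>i\<in>I. (a t (x i))\<^sup>2) / (2 * m) - card I * (\<integral>z. (a t z)\<^sup>2 \<partial>M) / (2 * m)"
        unfolding sq.emp_process_def by (simp add: sum_subtractf sum_divide_distrib)
      then show ?thesis using m_pos by (simp add: t(2) field_simps)
    qed
    also have "\<dots> \<le> real (card I) * w + 2 * m * Max ((\<lambda>t. sq.emp_process t x) ` T)"
      using m_pos by (intro add_mono mult_left_mono w t(1) ge_Max[OF t(1)]) auto
    finally show "sup_squares x \<le> real (card I) * w + 2 * m * Max ((\<lambda>t. sq.emp_process t x) ` T)" .
  qed (intro K.bdd_meas_integrable bm_intros fin_T T_ne sq.emp_process_bdd sup_squares_bdd; assumption)+
  also have "\<dots> = real (card I) * w + 2 * m * (\<integral>x. Max ((\<lambda>t. sq.emp_process t x) ` T) \<partial>?K)"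
  proof -
    have "integrable ?K (\<lambda>x. Max ((\<lambda>t. sq.emp_process t x) ` T))"
      by (intro K.bdd_meas_integrable bm_intros fin_T T_ne sq.emp_process_bdd)
    then show ?thesis by (simp add: K.prob_space)
  qed
  also have "\<dots> \<le> real (card I) * w + 2 * m * (2 * rademacher)"
    using m_pos sq.symmetrization_contraction
    by (intro add_left_mono mult_left_mono) (auto simp: rademacher_def sq.rademacher_def)
  finally show ?thesis by simp
qed

lemma sum_update:
  assumes "i \<in> I" shows "(\<Sum>j\<in>I. f ((x(i := y)) j)) = (\<Sum>j\<in>I. f (x j)) - f (x i) + (f y :: real)"
proof -
  have "(\<Sum>j\<in>I - {i}. f ((x(i := y)) j)) = (\<Sum>j\<in>I - {i}. f (x j))"
    by (intro sum.cong) auto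
  then show ?thesis
    using sum.remove[OF fin_I assms, of "\<lambda>j. f ((x(i := y)) j)"] sum.remove[OF fin_I assms, of "\<lambda>j. f (x j)"] by simp
qed

text \<open>If t is optimal at x, resampling coordinate i lowers the supremum by at most (a t (x
  i))^2, because the same t still competes afterwards. The square of this drop is at most m^2 (a t
  (x i))^2, and summing over i restores the supremum itself.\<close>

lemma jump_variance_sup_squares:
  assumes x: "x \<in> space (\<Pi>\<^sub>M i\<in>I. M)"
  shows "jump_variance M I sup_squares x \<le> m\<^sup>2 * sup_squares x"
proof -
  obtain t where t: "t \<in> T" "sup_squares x = (\<Sum>i\<in>I. (a t (x i))\<^sup>2)"
    using Max_attained[of "\<lambda>t. \<Sum>i\<in>I. (a t (x i))\<^sup>2"] by (auto simp: sup_squares_def)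
  have "jump_variance M I sup_squares x \<le> (\<Sum>i\<in>I. m\<^sup>2 * (a t (x i))\<^sup>2)"
    unfolding jump_variance_def
  proof (rule sum_mono)
    fix i assume i: "i \<in> I"
    then have xi: "x i \<in> space M" using x by (auto simp: space_PiM)
    have "(\<integral>y. (max 0 (sup_squares x - sup_squares (x(i := y))))\<^sup>2 \<partial>M) \<le> (\<integral>y. m\<^sup>2 * (a t (x i))\<^sup>2 \<partial>M)"
    proof (rule integral_mono)
      show "integrable M (\<lambda>y. (max 0 (sup_squares x - sup_squares (x(i := y))))\<^sup>2)"
        by (intro bdd_meas_integrable bm_intros bdd_meas_PiM_update[OF sup_squares_bdd i x])
      fix y
      have "sup_squares x - sup_squares (x(i := y)) \<le> (a t (x i))\<^sup>2"
        using ge_Max[OF t(1), of "\<lambda>t. \<Sum>j\<in>I. (a t ((x(i := y)) j))\<^sup>2"] sum_update[OF i, of "\<lambda>z. (a t z)\<^sup>2" x y]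
          zero_le_power2[of "a t y"]
        unfolding t(2) unfolding sup_squares_def by linarith
      then have "(max 0 (sup_squares x - sup_squares (x(i := y))))\<^sup>2 \<le> ((a t (x i))\<^sup>2)\<^sup>2"
        by (intro power_mono) auto
      also have "\<dots> \<le> m\<^sup>2 * (a t (x i))\<^sup>2"
        unfolding power2_eq_square[of "(a t (x i))\<^sup>2"]
        using power_mono[OF a_bound[OF t(1) xi], of 2] by (intro mult_right_mono) auto
      finally show "(max 0 (sup_squares x - sup_squares (x(i := y))))\<^sup>2 \<le> m\<^sup>2 * (a t (x i))\<^sup>2" .
    qed simp
    then show "(\<integral>y. (max 0 (sup_squares x - sup_squares (x(i := y))))\<^sup>2 \<partial>M) \<le> m\<^sup>2 * (a t (x i))\<^sup>2"
      by (simp add: prob_space)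
  qed
  then show ?thesis by (simp add: t(2) sum_distrib_left)
qed

text \<open>Again the index t optimal at x is kept. The drop is at most |a t (x i)| + |a t y|; after
  squaring, the first part sums to at most \<open>sup_squares\<close>, while the average over y of
  the second is controlled by w.\<close>

lemma jump_variance_sup_process:
  assumes x: "x \<in> space (\<Pi>\<^sub>M i\<in>I. M)"
    and w: "\<And>t. t \<in> T \<Longrightarrow> (\<integral>z. (a t z)\<^sup>2 \<partial>M) \<le> w"
  shows "jump_variance M I sup_process x \<le> 2 * sup_squares x + 2 * (real (card I) * w)"
proof -
  obtain t where t: "t \<in> T" "sup_process x = \<bar>emp_process t x\<bar>"
    using Max_attained[of "\<lambda>t. \<bar>emp_process t x\<bar>"] by (auto simp: sup_process_def)
  have "jump_variance M I sup_process x \<le> (\<Sum>i\<in>I. 2 * (a t (x i))\<^sup>2 + 2 * w)"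
    unfolding jump_variance_def
  proof (rule sum_mono)
    fix i assume i: "i \<in> I"
    then have xi: "x i \<in> space M" using x by (auto simp: space_PiM)
    have int: "integrable M (\<lambda>y. (a t y)\<^sup>2)" by (intro bdd_meas_integrable bm_intros a_bdd t(1))
    have "(\<integral>y. (max 0 (sup_process x - sup_process (x(i := y))))\<^sup>2 \<partial>M) \<le> (\<integral>y. 2 * (a t (x i))\<^sup>2 + 2 * (a t y)\<^sup>2 \<partial>M)"
    proof (rule integral_mono)
      show "integrable M (\<lambda>y. (max 0 (sup_process x - sup_process (x(i := y))))\<^sup>2)"
        by (intro bdd_meas_integrable bm_intros bdd_meas_PiM_update[OF sup_process_bdd i x])
      show "integrable M (\<lambda>y. 2 * (a t (x i))\<^sup>2 + 2 * (a t y)\<^sup>2)"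
        by (intro bdd_meas_integrable bm_intros a_bdd t(1))
      fix y assume y: "y \<in> space M"
      have "emp_process t (x(i := y)) = emp_process t x - l t (x i) + l t y"
        using sum_update[OF i, of "\<lambda>z. l t z - expectation (l t)" x y] by (simp add: emp_process_def)
      then have "sup_process x - sup_process (x(i := y)) \<le> \<bar>a t (x i)\<bar> + \<bar>a t y\<bar>"
        using ge_Max[OF t(1), of "\<lambda>t. \<bar>emp_process t (x(i := y))\<bar>"] l_le_a[OF t(1) xi] l_le_a[OF t(1) y]
        unfolding t(2) by (simp add: sup_process_def)
      then have "(max 0 (sup_process x - sup_process (x(i := y))))\<^sup>2 \<le> (\<bar>a t (x i)\<bar> + \<bar>a t y\<bar>)\<^sup>2"
        by (intro power_mono) auto
      also have "\<dots> \<le> 2 * (a t (x i))\<^sup>2 + 2 * (a t y)\<^sup>2"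
        using sum_squares_bound[of "\<bar>a t (x i)\<bar>" "\<bar>a t y\<bar>"] by (simp add: power2_sum)
      finally show "(max 0 (sup_process x - sup_process (x(i := y))))\<^sup>2 \<le> 2 * (a t (x i))\<^sup>2 + 2 * (a t y)\<^sup>2" .
    qed
    also have "\<dots> \<le> 2 * (a t (x i))\<^sup>2 + 2 * w"
      using int w[OF t(1)] by (simp add: prob_space)
    finally show "(\<integral>y. (max 0 (sup_process x - sup_process (x(i := y))))\<^sup>2 \<partial>M) \<le> 2 * (a t (x i))\<^sup>2 + 2 * w" .
  qed
  also have "\<dots> = 2 * (\<Sum>i\<in>I. (a t (x i))\<^sup>2) + 2 * (real (card I) * w)"
    by (simp add: sum.distrib sum_distrib_left)
  also have "\<dots> \<le> 2 * sup_squares x + 2 * (real (card I) * w)"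
    using ge_Max[OF t(1), of "\<lambda>t. \<Sum>i\<in>I. (a t (x i))\<^sup>2"] by (simp add: sup_squares_def)
  finally show ?thesis .
qed

lemma sup_process_tail:
  assumes w: "\<And>t. t \<in> T \<Longrightarrow> (\<integral>z. (a t z)\<^sup>2 \<partial>M) \<le> w"
    and \<tau>: "0 < \<tau>" and rad: "32 * rademacher \<le> \<tau>"
  shows "measure (\<Pi>\<^sub>M i\<in>I. M) {x \<in> space (\<Pi>\<^sub>M i\<in>I. M). 9 / 8 * \<tau> \<le> sup_process x}
    \<le> exp (- \<tau>\<^sup>2 / (96 * (real (card I) * w) + 16 * m * \<tau>))"
proof -
  let ?K = "\<Pi>\<^sub>M i\<in>I. M"
  interpret K: prob_space ?K by (rule prob_space_PiM_const)
  define W where "W = real (card I) * w"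
  have w0: "0 \<le> w"
    using w[OF t0] Bochner_Integration.integral_nonneg[of M "\<lambda>z. (a t0 z)\<^sup>2"]
    by (metis order_trans zero_le_power2)
  then have W0: "0 \<le> W" by (simp add: W_def)
  \<comment> \<open>The variance proxy 8 E[V] + 4 W is at most 12 W + m \<tau> once 32 *
    \<open>rademacher\<close> \<le> \<tau>. The second m \<tau> secures s m \<le> 1/8, inside the
    range 36 (s m)^2 \<le> 1 of the moment bound.\<close>
  define v where "v = 12 * W + 2 * m * \<tau>"
  have v: "0 < v" using W0 m_pos \<tau> by (auto simp: v_def intro!: add_nonneg_pos)
  \<comment> \<open>The minimizer of - s \<tau> + 2 s^2 v; the remaining \<tau> / 8 of the level
    compensates the mean.\<close>
  define s where "s = \<tau> / (4 * v)"
  have s: "0 < s" using v \<tau> by (simp add: s_def)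
  have "s * m \<le> 1 / 8"
    using v W0 \<tau> by (simp add: s_def field_simps) (simp add: v_def)
  then have "(s * m)\<^sup>2 \<le> (1 / 8)\<^sup>2" using s m_pos by (intro power_mono) auto
  moreover have "36 * s\<^sup>2 * m\<^sup>2 = 36 * (s * m)\<^sup>2" by (simp add: power_mult_distrib)
  ultimately have sm: "36 * s\<^sup>2 * m\<^sup>2 \<le> 1" by (simp add: power_divide)
  have "ln (\<integral>x. exp (s * sup_process x) \<partial>?K) \<le> s * (\<integral>x. sup_process x \<partial>?K) +
      2 * s\<^sup>2 * (8 * (\<integral>x. sup_squares x \<partial>?K) + 4 * W)"
    unfolding W_def using m_pos w0 s sm w
    by (intro log_mgf_weak_variance[OF fin_I sup_squares_bdd sup_process_bdd, where c = "m\<^sup>2"])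
       (auto intro: sup_squares_nonneg jump_variance_sup_squares jump_variance_sup_process)
  also have "\<dots> \<le> s * (\<tau> / 8) + 2 * s\<^sup>2 * v"
  proof (intro add_mono mult_left_mono)
    show "(\<integral>x. sup_process x \<partial>?K) \<le> \<tau> / 8"
      using expectation_sup_process rad by simp
    have "m * rademacher \<le> m * (\<tau> / 32)" using m_pos rad by (intro mult_left_mono) auto
    then show "8 * (\<integral>x. sup_squares x \<partial>?K) + 4 * W \<le> v"
      using expectation_sup_squares[OF w, folded W_def] mult_pos_pos[OF m_pos \<tau>]
      unfolding v_def times_divide_eq_right mult.assoc by linarith
  qed (use s in auto)
  finally have ln: "ln (\<integral>x. exp (s * sup_process x) \<partial>?K) \<le> s * (\<tau> / 8) + 2 * s\<^sup>2 * v" .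
  have int: "integrable ?K (\<lambda>x. exp (s * sup_process x))"
    by (intro K.bdd_meas_integrable bm_intros sup_process_bdd)
  have pos: "0 < (\<integral>x. exp (s * sup_process x) \<partial>?K)"
    by (intro K.expectation_exp_pos bm_intros sup_process_bdd)
  have "measure ?K {x \<in> space ?K. 9 / 8 * \<tau> \<le> sup_process x}
      \<le> exp (- s * (9 / 8 * \<tau>)) * (\<integral>x\<in>space ?K. exp (s * sup_process x) \<partial>?K)"
    using integrable_mult_indicator[OF sets.top int] by (intro K.Chernoff_ineq_ge s) (auto simp: set_integrable_def)
  also have "(\<integral>x\<in>space ?K. exp (s * sup_process x) \<partial>?K) = (\<integral>x. exp (s * sup_process x) \<partial>?K)"
    unfolding set_lebesgue_integral_def by (intro Bochner_Integration.integral_cong) auto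
  also have "\<dots> = exp (ln (\<integral>x. exp (s * sup_process x) \<partial>?K))" using pos by simp
  also have "exp (- s * (9 / 8 * \<tau>)) * \<dots> \<le> exp (- s * (9 / 8 * \<tau>)) * exp (s * (\<tau> / 8) + 2 * s\<^sup>2 * v)"
    using ln by (intro mult_left_mono) auto
  also have "\<dots> = exp (- \<tau>\<^sup>2 / (8 * v))"
  proof -
    have "- s * (9 / 8 * \<tau>) + (s * (\<tau> / 8) + 2 * s\<^sup>2 * v) = - \<tau>\<^sup>2 / (8 * v)"
      using v by (simp add: s_def field_simps power2_eq_square)
    then show ?thesis by (simp add: exp_add[symmetric])
  qed
  finally show ?thesis by (simp add: v_def W_def mult.assoc)
qed

end

text \<open>Under the product law each sign vector is an atom of mass 2^-card I. The integral over
  the signs is therefore at least the sum over these atoms, which is the average. The complexity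
  serves as an upper bound, so this is the direction required.\<close>

lemma sign_average_le_nn_integral:
  fixes \<mu> :: "'a measure" and I :: "'i set" and G :: "('i \<Rightarrow> 'a) \<Rightarrow> ('i \<Rightarrow> real) \<Rightarrow> real"
  defines "\<nu> \<equiv> \<Pi>\<^sub>M i\<in>I. measure_pmf (pmf_of_set {-1, 1 :: real})"
  assumes "prob_space \<mu>" and I: "finite I"
    and meas: "(\<lambda>(x, \<epsilon>). G x \<epsilon>) \<in> borel_measurable ((\<Pi>\<^sub>M i\<in>I. \<mu>) \<Otimes>\<^sub>M \<nu>)"
    and int: "\<And>\<epsilon>. \<epsilon> \<in> sign_vectors I \<Longrightarrow> integrable (\<Pi>\<^sub>M i\<in>I. \<mu>) (\<lambda>x. G x \<epsilon>)"
    and nonneg: "\<And>x \<epsilon>. 0 \<le> G x \<epsilon>"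
  shows "ennreal (sign_average I (\<lambda>\<epsilon>. \<integral>x. G x \<epsilon> \<partial>(\<Pi>\<^sub>M i\<in>I. \<mu>)))
    \<le> (\<integral>\<^sup>+ (x, \<epsilon>). ennreal (G x \<epsilon>) \<partial>((\<Pi>\<^sub>M i\<in>I. \<mu>) \<Otimes>\<^sub>M \<nu>))"
proof -
  interpret mu: prob_space \<mu> by fact
  let ?K = "\<Pi>\<^sub>M i\<in>I. \<mu>"
  let ?rade = "measure_pmf (pmf_of_set {-1, 1 :: real})"
  interpret K: prob_space ?K by (rule mu.prob_space_PiM_const)
  interpret N: prob_space \<nu> unfolding \<nu>_def by (rule prob_space.prob_space_PiM_const[OF prob_space_measure_pmf])
  interpret Q: pair_prob_space ?K \<nu> ..
  interpret pp: product_sigma_finite "\<lambda>_. ?rade" by standard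
  have single: "{\<epsilon>} \<in> sets \<nu>" "emeasure \<nu> {\<epsilon>} = ennreal ((1 / 2) ^ card I)" if "\<epsilon> \<in> sign_vectors I" for \<epsilon>
  proof -
    have eq: "{\<epsilon>} = Pi\<^sub>E I (\<lambda>i. {\<epsilon> i})"
      using that by (intro PiE_singleton[symmetric]) (auto simp: sign_vectors_def PiE_def)
    show "{\<epsilon>} \<in> sets \<nu>" unfolding eq \<nu>_def using I by (intro sets_PiM_I_finite) auto
    have e: "emeasure ?rade {\<epsilon> i} = ennreal (1 / 2)" if "i \<in> I" for i
      using that \<open>\<epsilon> \<in> sign_vectors I\<close> by (auto simp: sign_vectors_def PiE_def Pi_def emeasure_pmf_single)
    have "emeasure \<nu> {\<epsilon>} = (\<Prod>i\<in>I. emeasure ?rade {\<epsilon> i})"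
      unfolding eq \<nu>_def by (rule pp.emeasure_PiM[OF I]) simp
    also have "\<dots> = (\<Prod>i\<in>I. ennreal (1 / 2))" by (rule prod.cong[OF refl e])
    also have "\<dots> = ennreal (\<Prod>i\<in>I. 1 / 2)" by (rule prod_ennreal) simp
    finally show "emeasure \<nu> {\<epsilon>} = ennreal ((1 / 2) ^ card I)" by simp
  qed
  have "ennreal (sign_average I (\<lambda>\<epsilon>. \<integral>x. G x \<epsilon> \<partial>?K))
      = ennreal (\<Sum>\<epsilon>\<in>sign_vectors I. (\<integral>x. G x \<epsilon> \<partial>?K) * (1 / 2) ^ card I)"
    by (simp add: sign_average_def sum_divide_distrib power_one_over)
  also have "\<dots> = (\<Sum>\<epsilon>\<in>sign_vectors I. ennreal ((\<integral>x. G x \<epsilon> \<partial>?K) * (1 / 2) ^ card I))"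
    by (rule sum_ennreal[symmetric]) (auto intro!: mult_nonneg_nonneg Bochner_Integration.integral_nonneg nonneg)
  also have "\<dots> = (\<Sum>\<epsilon>\<in>sign_vectors I. (\<integral>\<^sup>+ x. ennreal (G x \<epsilon>) \<partial>?K) * emeasure \<nu> {\<epsilon>})"
    by (intro sum.cong refl)
       (simp add: single(2) nn_integral_eq_integral int nonneg ennreal_mult Bochner_Integration.integral_nonneg)
  also have "\<dots> = (\<integral>\<^sup>+ \<epsilon>. (\<Sum>\<epsilon>'\<in>sign_vectors I. (\<integral>\<^sup>+ x. ennreal (G x \<epsilon>') \<partial>?K) * indicator {\<epsilon>'} \<epsilon>) \<partial>\<nu>)"
  proof (subst nn_integral_sum)
    fix \<epsilon> assume "\<epsilon> \<in> sign_vectors I"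
    from single(1)[OF this]
    show "(\<lambda>\<epsilon>'. (\<integral>\<^sup>+ x. ennreal (G x \<epsilon>) \<partial>?K) * indicator {\<epsilon>} \<epsilon>') \<in> borel_measurable \<nu>"
      by measurable
  qed (simp add: nn_integral_cmult_indicator single(1))
  also have "\<dots> \<le> (\<integral>\<^sup>+ \<epsilon>. (\<integral>\<^sup>+ x. ennreal (G x \<epsilon>) \<partial>?K) \<partial>\<nu>)"
  proof (rule nn_integral_mono)
    fix \<epsilon>
    have "(\<Sum>\<epsilon>'\<in>sign_vectors I. (\<integral>\<^sup>+ x. ennreal (G x \<epsilon>') \<partial>?K) * indicator {\<epsilon>'} \<epsilon>)
        = (\<Sum>\<epsilon>'\<in>sign_vectors I. if \<epsilon>' = \<epsilon> then (\<integral>\<^sup>+ x. ennreal (G x \<epsilon>) \<partial>?K) else 0)"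
      by (intro sum.cong) (auto simp: indicator_def)
    also have "\<dots> \<le> (\<integral>\<^sup>+ x. ennreal (G x \<epsilon>) \<partial>?K)"
      by (simp add: finite_sign_vectors[OF I])
    finally show "(\<Sum>\<epsilon>'\<in>sign_vectors I. (\<integral>\<^sup>+ x. ennreal (G x \<epsilon>') \<partial>?K) * indicator {\<epsilon>'} \<epsilon>) \<le> (\<integral>\<^sup>+ x. ennreal (G x \<epsilon>) \<partial>?K)" .
  qed
  also have "\<dots> = (\<integral>\<^sup>+ (x, \<epsilon>). ennreal (G x \<epsilon>) \<partial>(?K \<Otimes>\<^sub>M \<nu>))"
    using meas by (subst Q.nn_integral_snd[symmetric]) (auto simp: case_prod_unfold)
  finally show ?thesis .
qed

section \<open>Localized deviations\<close>

locale bounded_lipschitz_erm = regularized_erm M MX P N XY E nrm F loss fstar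
  for M :: "'w measure" and MX :: "'x measure" and P N XY E nrm F loss fstar +
  fixes b Rad :: real
  assumes b_pos: "0 < b"
    and lipschitz: "\<And>f g x y. f \<in> F \<Longrightarrow> g \<in> F \<Longrightarrow> x \<in> space MX \<Longrightarrow> \<bar>loss (f x) y - loss (g x) y\<bar> \<le> \<bar>f x - g x\<bar>"
    and bounded: "\<And>f. f \<in> F \<Longrightarrow> Linf_norm (distr P MX fst) f \<le> ereal b"
    and Rad_nonneg: "0 \<le> Rad"
    and Rad_eq: "Rademacher_complexity (distr P MX fst) N (unit_ball E nrm) = ennreal Rad"
begin

abbreviation \<mu> :: "'x measure" where "\<mu> \<equiv> distr P MX fst"

definition deviation :: "('x \<Rightarrow> real) \<Rightarrow> 'w \<Rightarrow> real" where
  "deviation f \<omega> = excess_risk P loss fstar f -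
     (empirical_risk N (\<lambda>i. XY i \<omega>) loss f - empirical_risk N (\<lambda>i. XY i \<omega>) loss fstar)"

section \<open>The law of the data and almost sure bounds\<close>

lemma XY_measurable: "i \<in> {1..N} \<Longrightarrow> XY i \<in> M \<rightarrow>\<^sub>M MX \<Otimes>\<^sub>M borel"
  using indep by (auto simp: indep_vars_def)

lemma sets_P: "sets P = sets (MX \<Otimes>\<^sub>M borel)" and prob_space_P: "prob_space P"
proof -
  have 1: "1 \<in> {1..N}" using N_pos by simp
  show "sets P = sets (MX \<Otimes>\<^sub>M borel)" using ident_distr[OF 1] by (metis sets_distr)
  show "prob_space P" using prob_space_distr[OF XY_measurable[OF 1]] ident_distr[OF 1] by simp
qed

sublocale P: prob_space P by (rule prob_space_P)

lemma measurable_P: "measurable P = measurable (MX \<Otimes>\<^sub>M borel)"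
  by (intro ext measurable_cong_sets sets_P refl)

lemma space_P: "space P = space MX \<times> UNIV"
  using sets_eq_imp_space_eq[OF sets_P] by (simp add: space_pair_measure)

lemma fst_measurable: "fst \<in> P \<rightarrow>\<^sub>M MX"
  unfolding measurable_P by measurable

sublocale mu: prob_space \<mu> by (rule P.prob_space_distr[OF fst_measurable])

lemma fstar_F: "fstar \<in> F"
  using fstar_oracle by (auto simp: is_oracle_def is_arg_min_def split: if_splits)

lemma E_measurable: "f \<in> E \<Longrightarrow> f \<in> borel_measurable MX"
  using E_L2 by (auto simp: L2_space_def)

lemma F_measurable: "f \<in> F \<Longrightarrow> f \<in> borel_measurable MX"
  using F_subset E_measurable by auto

lemma diff_E: "f \<in> F \<Longrightarrow> f - fstar \<in> E"
  using F_subset fstar_F E_subspace by (auto intro: subspace_diff)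

lemma F_bounded: assumes "f \<in> F" shows "AE x in \<mu>. \<bar>f x\<bar> \<le> b"
  using esssup_AE[of "\<lambda>x. ereal \<bar>f x\<bar>" \<mu>]
proof eventually_elim
  case (elim x)
  have "ereal \<bar>f x\<bar> \<le> ereal b" using order_trans[OF elim bounded[OF assms, unfolded Linf_norm_def]] .
  then show ?case by simp
qed

lemma diff_bounded: assumes "f \<in> F" "g \<in> F" shows "AE x in \<mu>. \<bar>f x - g x\<bar> \<le> 2 * b"
  using F_bounded[OF assms(1)] F_bounded[OF assms(2)] by eventually_elim auto

lemma diff_bounded_P: assumes "f \<in> F" "g \<in> F" shows "AE z in P. \<bar>f (fst z) - g (fst z)\<bar> \<le> 2 * b"
  by (rule AE_distrD[OF fst_measurable diff_bounded[OF assms]])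

lemma loss_measurable_P: "f \<in> F \<Longrightarrow> loss_of loss f \<in> borel_measurable P"
  using loss_measurable by (simp add: measurable_P)

lemma loss_diff_le:
  "f \<in> F \<Longrightarrow> g \<in> F \<Longrightarrow> z \<in> space P \<Longrightarrow> \<bar>loss_of loss f z - loss_of loss g z\<bar> \<le> \<bar>f (fst z) - g (fst z)\<bar>"
  using lipschitz[of f g "fst z" "snd z"] by (auto simp: loss_of_def space_P case_prod_unfold)

lemma loss_diff_bounded:
  assumes "f \<in> F" "g \<in> F" shows "AE z in P. \<bar>loss_of loss f z - loss_of loss g z\<bar> \<le> 2 * b"
  using diff_bounded_P[OF assms] AE_space by eventually_elim (use loss_diff_le[OF assms] in \<open>auto intro: order_trans\<close>)

text \<open>The separate risks may be infinite; in general only differences of losses are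
  integrable, which is why \<open>deviation\<close> is built from them.\<close>

lemma loss_diff_integrable: 
  assumes "f \<in> F" "g \<in> F" shows "integrable P (\<lambda>z. loss_of loss f z - loss_of loss g z)"
  using loss_diff_bounded[OF assms] loss_measurable_P assms
  by (intro P.integrable_const_bound[where B = "2 * b"]) auto

lemma excess_risk_bound: assumes "f \<in> F" shows "\<bar>excess_risk P loss fstar f\<bar> \<le> 2 * b"
proof -
  have "\<bar>excess_risk P loss fstar f\<bar> \<le> (\<integral>z. \<bar>loss_of loss f z - loss_of loss fstar z\<bar> \<partial>P)"
    unfolding excess_risk_def by (rule integral_abs_bound)
  also have "\<dots> \<le> (\<integral>z. 2 * b \<partial>P)"
    using loss_diff_bounded[OF assms fstar_F] loss_diff_integrable[OF assms fstar_F]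
    by (intro integral_mono_AE) auto
  finally show ?thesis by (simp add: P.prob_space)
qed

lemma XY_AE: assumes "AE z in P. Q z" "i \<in> {1..N}" shows "AE \<omega> in M. Q (XY i \<omega>)"
  using assms(1) by (intro AE_distrD[OF XY_measurable[OF assms(2)]]) (simp only: ident_distr[OF assms(2)])

lemma deviation_eq: "deviation f \<omega> = excess_risk P loss fstar f -
  (\<Sum>i=1..N. loss_of loss f (XY i \<omega>) - loss_of loss fstar (XY i \<omega>)) / real N"
  by (simp add: deviation_def empirical_risk_def sum_subtractf diff_divide_distrib)

text \<open>This serves the large peeling scales: a level of at least 4 b is exceeded only on a null
  set.\<close>

lemma deviation_bounded: assumes f: "f \<in> F" shows "AE \<omega> in M. \<bar>deviation f \<omega>\<bar> \<le> 4 * b"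
proof -
  have "AE \<omega> in M. \<forall>i\<in>{1..N}. \<bar>loss_of loss f (XY i \<omega>) - loss_of loss fstar (XY i \<omega>)\<bar> \<le> 2 * b"
    by (intro AE_finite_allI finite_atLeastAtMost XY_AE[OF loss_diff_bounded[OF f fstar_F]])
  then show ?thesis
  proof eventually_elim
    case (elim \<omega>)
    have "\<bar>\<Sum>i=1..N. loss_of loss f (XY i \<omega>) - loss_of loss fstar (XY i \<omega>)\<bar> \<le> (\<Sum>i=1..N. 2 * b)"
      using elim by (intro sum_abs[THEN order_trans] sum_mono) auto
    then have "\<bar>(\<Sum>i=1..N. loss_of loss f (XY i \<omega>) - loss_of loss fstar (XY i \<omega>)) / real N\<bar> \<le> 2 * b"
      using N_pos by (simp add: abs_divide field_simps)
    then show ?case using excess_risk_bound[OF f] unfolding deviation_eq by linarith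
  qed
qed

lemma deviation_measurable: assumes "f \<in> F" shows "deviation f \<in> borel_measurable M"
proof -
  have "(\<lambda>\<omega>. loss_of loss g (XY i \<omega>)) \<in> borel_measurable M" if "g \<in> F" "i \<in> {1..N}" for g i
    by (rule measurable_compose[OF XY_measurable loss_measurable]) fact+
  then show ?thesis unfolding deviation_eq[abs_def] using assms fstar_F by auto
qed

lemma excess_risk_tendsto:
  assumes s: "\<And>n. s n \<in> F" and f: "f \<in> F" and lim: "\<And>x. x \<in> space MX \<Longrightarrow> (\<lambda>n. s n x) \<longlonglongrightarrow> f x"
  shows "(\<lambda>n. excess_risk P loss fstar (s n)) \<longlonglongrightarrow> excess_risk P loss fstar f"
    and "z \<in> space P \<Longrightarrow> (\<lambda>n. loss_of loss (s n) z) \<longlonglongrightarrow> loss_of loss f z"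
proof -
  show ptw: "(\<lambda>n. loss_of loss (s n) z) \<longlonglongrightarrow> loss_of loss f z" if z: "z \<in> space P" for z
  proof -
    have "(\<lambda>n. s n (fst z) - f (fst z)) \<longlonglongrightarrow> 0"
      using lim[of "fst z"] z by (auto simp: space_P LIM_zero_iff)
    then have "(\<lambda>n. loss_of loss (s n) z - loss_of loss f z) \<longlonglongrightarrow> 0"
      by (rule Lim_null_comparison[rotated, OF tendsto_rabs_zero]) (use loss_diff_le[OF s f z] in auto)
    then show ?thesis by (simp add: LIM_zero_iff)
  qed
  show "(\<lambda>n. excess_risk P loss fstar (s n)) \<longlonglongrightarrow> excess_risk P loss fstar f"
    unfolding excess_risk_def
  proof (rule integral_dominated_convergence[where w = "\<lambda>_. 2 * b"])
    show "AE z in P. (\<lambda>n. loss_of loss (s n) z - loss_of loss fstar z) \<longlonglongrightarrow> loss_of loss f z - loss_of loss fstar z"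
      using AE_space by eventually_elim (intro tendsto_intros ptw)
  qed (use loss_diff_bounded[OF s fstar_F] loss_measurable_P s f fstar_F in auto)
qed

lemma L2_norm_tendsto:
  assumes s: "\<And>n. s n \<in> F" and f: "f \<in> F" and lim: "\<And>x. x \<in> space MX \<Longrightarrow> (\<lambda>n. s n x) \<longlonglongrightarrow> f x"
  shows "(\<lambda>n. L2_norm \<mu> (s n - fstar)) \<longlonglongrightarrow> L2_norm \<mu> (f - fstar)"
  unfolding L2_norm_def
proof (intro tendsto_intros integral_dominated_convergence[where w = "\<lambda>_. (2 * b)\<^sup>2"])
  show "AE x in \<mu>. (\<lambda>n. ((s n - fstar) x)\<^sup>2) \<longlonglongrightarrow> ((f - fstar) x)\<^sup>2"
    using AE_space by eventually_elim (auto intro!: tendsto_intros lim)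
  show "AE x in \<mu>. norm (((s n - fstar) x)\<^sup>2) \<le> (2 * b)\<^sup>2" for n
    using diff_bounded[OF s[of n] fstar_F] 
  proof eventually_elim
    case (elim x)
    then have "\<bar>s n x - fstar x\<bar>\<^sup>2 \<le> (2 * b)\<^sup>2" by (intro power_mono) auto
    then show ?case by simp
  qed
  have [measurable]: "g \<in> borel_measurable MX" if "g \<in> F" for g by (rule F_measurable[OF that])
  show "(\<lambda>x. ((f - fstar) x)\<^sup>2) \<in> borel_measurable \<mu>" "\<And>n. (\<lambda>x. ((s n - fstar) x)\<^sup>2) \<in> borel_measurable \<mu>"
    using f s fstar_F by auto
qed auto

text \<open>The strict inequality for the \<open>L\<^sub>2\<close> norm makes the constraint stable along sequences that converge
  to a member of the class.\<close>

definition localized :: "real \<Rightarrow> real \<Rightarrow> ('x \<Rightarrow> real) set" where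
  "localized \<rho> \<sigma> = {f \<in> F. nrm (f - fstar) \<le> \<rho> \<and> L2_norm \<mu> (f - fstar) < \<sigma>}"

text \<open>Pointwise measurability provides a countable class for the norm constraint alone. A
  sequence from it that approximates f may violate the L2 constraint at first but satisfies it from
  some index on, and this is enough to pass to the limit.\<close>

lemma countable_reduction:
  assumes "0 < \<rho>"
  obtains D where "countable D" "D \<subseteq> localized \<rho> \<sigma>"
    "\<And>\<omega> c f. \<omega> \<in> space M \<Longrightarrow> \<forall>g\<in>D. \<bar>deviation g \<omega>\<bar> \<le> c \<Longrightarrow> f \<in> localized \<rho> \<sigma> \<Longrightarrow> \<bar>deviation f \<omega>\<bar> \<le> c"
proof -
  obtain D0 where D0: "D0 \<subseteq> {f \<in> F. nrm (f - fstar) \<le> \<rho>}" "countable D0"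
    and seq: "\<And>f. f \<in> F \<Longrightarrow> nrm (f - fstar) \<le> \<rho> \<Longrightarrow> \<exists>s. (\<forall>n::nat. s n \<in> D0) \<and> (\<forall>x\<in>space MX. (\<lambda>n. s n x) \<longlonglongrightarrow> f x)"
    using F_pointwise_measurable[OF assms] unfolding pointwise_measurable_def by blast
  show thesis
  proof (rule that[of "D0 \<inter> localized \<rho> \<sigma>"])
    fix \<omega> c f assume \<omega>: "\<omega> \<in> space M" and le: "\<forall>g\<in>D0 \<inter> localized \<rho> \<sigma>. \<bar>deviation g \<omega>\<bar> \<le> c" and fl: "f \<in> localized \<rho> \<sigma>"
    then have f: "f \<in> F" "nrm (f - fstar) \<le> \<rho>" "L2_norm \<mu> (f - fstar) < \<sigma>" by (auto simp: localized_def)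
    obtain s where s: "\<And>n. s n \<in> D0" "\<And>x. x \<in> space MX \<Longrightarrow> (\<lambda>n. s n x) \<longlonglongrightarrow> f x"
      using seq[OF f(1,2)] by blast
    have sF: "s n \<in> F" "nrm (s n - fstar) \<le> \<rho>" for n using s(1)[of n] D0 by auto
    have "XY i \<omega> \<in> space P" if "i \<in> {1..N}" for i
      using measurable_space[OF XY_measurable[OF that] \<omega>] sets_eq_imp_space_eq[OF sets_P] by simp
    then have "(\<lambda>n. deviation (s n) \<omega>) \<longlonglongrightarrow> deviation f \<omega>"
      unfolding deviation_eq using N_pos
      by (intro tendsto_intros excess_risk_tendsto[OF sF(1) f(1) s(2)]) auto
    then have "(\<lambda>n. \<bar>deviation (s n) \<omega>\<bar>) \<longlonglongrightarrow> \<bar>deviation f \<omega>\<bar>" by (rule tendsto_rabs)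
    moreover have "\<forall>\<^sub>F n in sequentially. \<bar>deviation (s n) \<omega>\<bar> \<le> c"
    proof (rule eventually_mono)
      show "\<forall>\<^sub>F n in sequentially. L2_norm \<mu> (s n - fstar) < \<sigma>"
        by (rule order_tendstoD(2)[OF L2_norm_tendsto[OF sF(1) f(1)] f(3)]) (rule s(2))
      fix n assume "L2_norm \<mu> (s n - fstar) < \<sigma>"
      then show "\<bar>deviation (s n) \<omega>\<bar> \<le> c" using le s(1)[of n] sF[of n] by (auto simp: localized_def)
    qed
    ultimately show "\<bar>deviation f \<omega>\<bar> \<le> c"
      using tendsto_upperbound trivial_limit_sequentially by blast
  qed (use D0 in auto)
qed

end

section \<open>Transfer of the finite-class bound to the sample\<close>

context bounded_lipschitz_erm
begin

lemma distr_sample: "distr M (\<Pi>\<^sub>M i\<in>{1..N}. P) (\<lambda>\<omega>. \<lambda>i\<in>{1..N}. XY i \<omega>) = (\<Pi>\<^sub>M i\<in>{1..N}. P)"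
proof -
  have "distr M (\<Pi>\<^sub>M i\<in>{1..N}. MX \<Otimes>\<^sub>M borel) (\<lambda>\<omega>. \<lambda>i\<in>{1..N}. XY i \<omega>)
      = (\<Pi>\<^sub>M i\<in>{1..N}. distr M (MX \<Otimes>\<^sub>M borel) (XY i))"
    using indep N_pos XY_measurable by (subst indep_vars_iff_distr_eq_PiM'[symmetric]) auto
  also have "\<dots> = (\<Pi>\<^sub>M i\<in>{1..N}. P)"
    by (intro PiM_cong ident_distr refl)
  also have "distr M (\<Pi>\<^sub>M i\<in>{1..N}. MX \<Otimes>\<^sub>M borel) (\<lambda>\<omega>. \<lambda>i\<in>{1..N}. XY i \<omega>)
      = distr M (\<Pi>\<^sub>M i\<in>{1..N}. P) (\<lambda>\<omega>. \<lambda>i\<in>{1..N}. XY i \<omega>)"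
    by (intro distr_cong sets_PiM_cong refl sets_P[symmetric])
  finally show ?thesis .
qed

lemma distr_PiM_fst: "distr (\<Pi>\<^sub>M i\<in>{1..N}. P) (\<Pi>\<^sub>M i\<in>{1..N}. \<mu>) (compose {1..N} fst) = (\<Pi>\<^sub>M i\<in>{1..N}. \<mu>)"
proof -
  have "fst \<in> P \<rightarrow>\<^sub>M \<mu>" using fst_measurable by simp
  then have "distr (\<Pi>\<^sub>M i\<in>{1..N}. P) (\<Pi>\<^sub>M i\<in>{1..N}. \<mu>) (compose {1..N} fst) = (\<Pi>\<^sub>M i\<in>{1..N}. distr P \<mu> fst)"
    by (intro distr_PiM_finite_prob_space' prob_space_P mu.prob_space_axioms) auto
  also have "distr P \<mu> fst = \<mu>" by (rule distr_cong) auto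
  finally show ?thesis .
qed

text \<open>Two versions of f - \<open>fstar\<close> are involved: h is bounded at every point, as
  \<open>finite_class\<close> demands, but need not lie in E; the true difference lies in \<rho> B
  but is bounded only almost surely. Their suprema agree almost everywhere, and the true one is
  compared pointwise with the supremum over the unit ball.\<close>

lemma localized_rademacher_le:
  assumes T: "finite T" "T \<noteq> {}" "T \<subseteq> F" "\<And>f. f \<in> T \<Longrightarrow> nrm (f - fstar) \<le> \<rho>" and \<rho>: "0 < \<rho>"
    and h_meas: "\<And>f. f \<in> T \<Longrightarrow> h f \<in> borel_measurable MX"
    and h_bound: "\<And>f x. f \<in> T \<Longrightarrow> \<bar>h f x\<bar> \<le> m"
    and h_eq: "AE x in \<mu>. \<forall>f\<in>T. h f x = f x - fstar x"
  shows "sign_average {1..N} (\<lambda>\<epsilon>. \<integral>x. Max ((\<lambda>f. \<bar>\<Sum>i\<in>{1..N}. \<epsilon> i * h f (fst (x i))\<bar>) ` T) \<partial>(\<Pi>\<^sub>M i\<in>{1..N}. P))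
    \<le> sqrt N * \<rho> * Rad"
proof -
  let ?I = "{1..N}"
  let ?K = "\<Pi>\<^sub>M i\<in>?I. \<mu>"
  interpret K: prob_space ?K by (rule mu.prob_space_PiM_const)
  \<comment> \<open>Dividing by \<rho> brings f - \<open>fstar\<close> into the unit ball; dividing
    by sqrt N matches the normalization of \<open>Rademacher_complexity\<close>.\<close>
  define k where "k = \<rho> * sqrt N"
  have k: "0 < k" using \<rho> N_pos by (simp add: k_def)
  define H where "H x \<epsilon> = Max ((\<lambda>f. \<bar>\<Sum>i\<in>?I. \<epsilon> i * h f (x i)\<bar>) ` T)" for x :: "nat \<Rightarrow> 'x" and \<epsilon> :: "nat \<Rightarrow> real"
  define G where "G x \<epsilon> = Max ((\<lambda>f. \<bar>\<Sum>i\<in>?I. \<epsilon> i * (f (x i) - fstar (x i))\<bar>) ` T) / k" for x :: "nat \<Rightarrow> 'x" and \<epsilon> :: "nat \<Rightarrow> real"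
  have h_bdd: "bdd_meas \<mu> (h f)" if "f \<in> T" for f
    using h_meas[OF that] h_bound[OF that] by (intro bdd_measI[where B = m]) auto
  have comp: "bdd_meas ?K (\<lambda>x. h f (x i))" if "f \<in> T" "i \<in> ?I" for f i
    by (rule bdd_meas_compose[OF h_bdd[OF that(1)] measurable_component_singleton[OF that(2)]])
  have H: "bdd_meas ?K (\<lambda>x. H x \<epsilon>)" for \<epsilon>
    unfolding H_def by (intro bm_intros T comp)
  have [measurable]: "f \<in> borel_measurable MX" if "f \<in> F" for f by (rule F_measurable[OF that])
  have fcomp: "(\<lambda>x. f (x i)) \<in> borel_measurable ?K" if "f \<in> F" "i \<in> ?I" for f i
    by (rule measurable_compose[OF measurable_component_singleton[OF that(2)]]) (use that in simp)
  have G_meas: "(\<lambda>x. G x \<epsilon>) \<in> borel_measurable ?K" for \<epsilon>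
    unfolding G_def using T fcomp fstar_F
    by (intro borel_measurable_divide borel_measurable_Max borel_measurable_abs borel_measurable_sum
        borel_measurable_times borel_measurable_diff borel_measurable_const) auto
  have "AE x in ?K. \<forall>i\<in>?I. \<forall>f\<in>T. h f (x i) = f (x i) - fstar (x i)"
    by (intro AE_finite_allI finite_atLeastAtMost AE_PiM_component h_eq mu.prob_space_axioms)
  then have GH: "AE x in ?K. G x \<epsilon> = H x \<epsilon> / k" for \<epsilon>
  proof eventually_elim
    case (elim x)
    then have "(\<lambda>f. \<bar>\<Sum>i\<in>?I. \<epsilon> i * h f (x i)\<bar>) ` T = (\<lambda>f. \<bar>\<Sum>i\<in>?I. \<epsilon> i * (f (x i) - fstar (x i))\<bar>) ` T"
      by (intro image_cong refl arg_cong[where f = abs] sum.cong) auto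
    then show ?case by (simp add: G_def H_def)
  qed
  have H_int: "integrable ?K (\<lambda>x. H x \<epsilon> / k)" for \<epsilon>
    by (intro K.bdd_meas_integrable bm_intros H)
  have G_int: "integrable ?K (\<lambda>x. G x \<epsilon>)" for \<epsilon>
    using integrable_cong_AE[OF G_meas borel_measurable_integrable[OF H_int] GH] H_int by simp
  have "(\<integral>x. Max ((\<lambda>f. \<bar>\<Sum>i\<in>?I. \<epsilon> i * h f (fst (x i))\<bar>) ` T) \<partial>(\<Pi>\<^sub>M i\<in>?I. P)) = k * (\<integral>x. G x \<epsilon> \<partial>?K)" for \<epsilon>
  proof -
    have "(\<integral>x. Max ((\<lambda>f. \<bar>\<Sum>i\<in>?I. \<epsilon> i * h f (fst (x i))\<bar>) ` T) \<partial>(\<Pi>\<^sub>M i\<in>?I. P))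
        = (\<integral>x. H (compose ?I fst x) \<epsilon> \<partial>(\<Pi>\<^sub>M i\<in>?I. P))"
    proof -
      have "Max ((\<lambda>f. \<bar>\<Sum>i\<in>?I. \<epsilon> i * h f (fst (x i))\<bar>) ` T) = H (compose ?I fst x) \<epsilon>" for x :: "nat \<Rightarrow> 'x \<times> real"
        unfolding H_def
        by (intro arg_cong[where f = Max] image_cong refl arg_cong[where f = abs] sum.cong) (simp add: compose_def)
      then show ?thesis by simp
    qed
    also have "\<dots> = (\<integral>x. H x \<epsilon> \<partial>distr (\<Pi>\<^sub>M i\<in>?I. P) ?K (compose ?I fst))"
    proof (rule integral_distr[symmetric])
      show "compose ?I fst \<in> (\<Pi>\<^sub>M i\<in>?I. P) \<rightarrow>\<^sub>M ?K"
        unfolding compose_def using fst_measurable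
        by (intro measurable_restrict measurable_compose[OF measurable_component_singleton]) auto
    qed (rule bdd_measD[OF H])
    also have "\<dots> = (\<integral>x. k * (H x \<epsilon> / k) \<partial>?K)"
      unfolding distr_PiM_fst using k by simp
    also have "\<dots> = k * (\<integral>x. G x \<epsilon> \<partial>?K)"
      using integral_cong_AE[OF G_meas borel_measurable_integrable[OF H_int] GH] by simp
    finally show ?thesis .
  qed
  then have "sign_average ?I (\<lambda>\<epsilon>. \<integral>x. Max ((\<lambda>f. \<bar>\<Sum>i\<in>?I. \<epsilon> i * h f (fst (x i))\<bar>) ` T) \<partial>(\<Pi>\<^sub>M i\<in>?I. P))
      = k * sign_average ?I (\<lambda>\<epsilon>. \<integral>x. G x \<epsilon> \<partial>?K)"
    by (simp add: sign_average_cmult)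
  also have "\<dots> \<le> k * Rad"
  proof (rule mult_left_mono)
    let ?\<nu> = "\<Pi>\<^sub>M i\<in>?I. measure_pmf (pmf_of_set {-1, 1 :: real})"
    have Max_nonneg: "0 \<le> Max ((\<lambda>f. \<bar>v f\<bar>) ` T)" for v :: "_ \<Rightarrow> real"
      using T by (auto simp: Max_ge_iff ex_in_conv)
    have "ennreal (sign_average ?I (\<lambda>\<epsilon>. \<integral>x. G x \<epsilon> \<partial>?K)) \<le> (\<integral>\<^sup>+ (x, \<epsilon>). ennreal (G x \<epsilon>) \<partial>(?K \<Otimes>\<^sub>M ?\<nu>))"
    proof (rule sign_average_le_nn_integral)
      have c1: "(\<lambda>z. f (fst z i)) \<in> borel_measurable (?K \<Otimes>\<^sub>M ?\<nu>)" if "f \<in> F" "i \<in> ?I" for f i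
        by (rule measurable_compose[OF measurable_fst fcomp[OF that]])
      have c2: "(\<lambda>z. snd z i) \<in> borel_measurable (?K \<Otimes>\<^sub>M ?\<nu>)" if "i \<in> ?I" for i
        by (rule measurable_compose[OF measurable_snd], rule measurable_compose[OF measurable_component_singleton[OF that]]) simp
      have "(\<lambda>z. G (fst z) (snd z)) \<in> borel_measurable (?K \<Otimes>\<^sub>M ?\<nu>)"
        unfolding G_def using T c1 c2 fstar_F
        by (intro borel_measurable_divide borel_measurable_Max borel_measurable_abs borel_measurable_sum
          borel_measurable_times borel_measurable_diff borel_measurable_const) auto
      then show "(\<lambda>(x, \<epsilon>). G x \<epsilon>) \<in> borel_measurable (?K \<Otimes>\<^sub>M ?\<nu>)" by (simp add: case_prod_unfold)
      show "0 \<le> G x \<epsilon>" for x \<epsilon> unfolding G_def using k Max_nonneg by (intro divide_nonneg_pos) auto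
    qed (rule mu.prob_space_axioms finite_atLeastAtMost G_int)+
    also have "\<dots> \<le> Rademacher_complexity \<mu> N (unit_ball E nrm)"
      unfolding Rademacher_complexity_def
    proof (rule nn_integral_mono, clarify)
      fix x :: "nat \<Rightarrow> 'x" and \<epsilon> :: "nat \<Rightarrow> real"
      have "Max ((\<lambda>f. \<bar>\<Sum>i\<in>?I. \<epsilon> i * (f (x i) - fstar (x i))\<bar>) ` T) \<in> (\<lambda>f. \<bar>\<Sum>i\<in>?I. \<epsilon> i * (f (x i) - fstar (x i))\<bar>) ` T"
        using T by (intro Max_in) auto
      then obtain f where f: "f \<in> T" "G x \<epsilon> = \<bar>\<Sum>i\<in>?I. \<epsilon> i * (f (x i) - fstar (x i))\<bar> / k"
        by (auto simp: G_def)
      define g where "g = (1 / \<rho>) *\<^sub>R (f - fstar)"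
      have fE: "f - fstar \<in> E" using f T diff_E by auto
      have "nrm g = nrm (f - fstar) / \<rho>"
        using norm_E fE \<rho> by (simp add: is_norm_on_def g_def)
      then have g: "g \<in> unit_ball E nrm"
        using T(4)[OF f(1)] \<rho> fE E_subspace by (auto simp: unit_ball_def g_def subspace_scale)
      have "(\<Sum>i\<in>?I. \<epsilon> i * g (x i)) = (\<Sum>i\<in>?I. \<epsilon> i * (f (x i) - fstar (x i))) / \<rho>"
        by (simp add: g_def sum_divide_distrib)
      then have "G x \<epsilon> = \<bar>1 / sqrt (real N) * (\<Sum>i=1..N. \<epsilon> i * g (x i))\<bar>"
        using \<rho> k by (simp add: f(2) k_def abs_divide abs_mult)
      then show "ennreal (G x \<epsilon>) \<le> (SUP f\<in>unit_ball E nrm. ennreal \<bar>1 / sqrt (real N) * (\<Sum>i=1..N. \<epsilon> i * f (x i))\<bar>)"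
        using SUP_upper[OF g, of "\<lambda>f. ennreal \<bar>1 / sqrt (real N) * (\<Sum>i=1..N. \<epsilon> i * f (x i))\<bar>"] by simp
    qed
    finally show "sign_average ?I (\<lambda>\<epsilon>. \<integral>x. G x \<epsilon> \<partial>?K) \<le> Rad"
      using Rad_nonneg by (simp add: Rad_eq)
  qed (use k in simp)
  finally show ?thesis by (simp add: k_def mult_ac)
qed

text \<open>\<open>\<tau>\<close> is 32 times the bound of \<open>localized_rademacher_le\<close>,
  as \<open>sup_process_tail\<close> asks; the level 9/8 \<tau> for sums, divided by N, is 36 Rad
  \<rho> / sqrt N. The oracle is adjoined to T to play the part of t0.\<close>

lemma finite_deviation_tail:
  fixes \<rho> \<sigma> :: real
  assumes T: "finite T" "T \<subseteq> localized \<rho> \<sigma>" and pos: "0 < \<rho>" "0 < \<sigma>" "0 < Rad"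
  defines "\<tau> \<equiv> 32 * (sqrt (real N) * \<rho> * Rad)"
  shows "measure M {\<omega> \<in> space M. \<exists>f\<in>T. 36 * Rad * \<rho> / sqrt N < \<bar>deviation f \<omega>\<bar>}
    \<le> exp (- \<tau>\<^sup>2 / (96 * (real N * \<sigma>\<^sup>2) + 32 * b * \<tau>))"
proof -
  let ?I = "{1..N}"
  define T' where "T' = insert fstar T"
  have T': "finite T'" "T' \<noteq> {}" "T' \<subseteq> F" using T fstar_F by (auto simp: T'_def localized_def)
  have z0: "nrm (fstar - fstar) = 0"
  proof -
    have "fstar - fstar \<in> E" by (rule diff_E[OF fstar_F])
    then show ?thesis using norm_E by (auto simp: is_norm_on_def)
  qed
  have l0: "L2_norm \<mu> (fstar - fstar) = 0" by (simp add: L2_norm_def)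
  have T'loc: "nrm (f - fstar) \<le> \<rho>" "L2_norm \<mu> (f - fstar) \<le> \<sigma>" if "f \<in> T'" for f
    using that T pos z0 l0 by (auto simp: T'_def localized_def)
  define B where "B = {x \<in> space MX. \<exists>f\<in>T'. 2 * b < \<bar>f x - fstar x\<bar>}"
  have [measurable]: "f \<in> borel_measurable MX" if "f \<in> F" for f by (rule F_measurable[OF that])
  have fT'[measurable]: "f \<in> borel_measurable MX" if "f \<in> T'" for f using that T' by auto
  note [measurable] = fstar_F
  have B[measurable]: "B \<in> sets MX"
  proof -
    have "B = (\<Union>f\<in>T'. {x \<in> space MX. 2 * b < \<bar>f x - fstar x\<bar>})" by (auto simp: B_def)
    also have "\<dots> \<in> sets MX" using T'(1) by (intro sets.finite_UN) auto
    finally show ?thesis .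
  qed
  have AE_B: "AE x in \<mu>. x \<notin> B"
  proof -
    have "AE x in \<mu>. \<forall>f\<in>T'. \<bar>f x - fstar x\<bar> \<le> 2 * b"
      using T' diff_bounded[OF _ fstar_F] by (intro AE_finite_allI) auto
    then show ?thesis by eventually_elim (auto simp: B_def)
  qed
  have AE_BP: "AE z in P. fst z \<notin> B" by (rule AE_distrD[OF fst_measurable AE_B])
  \<comment> \<open>The differences are bounded by \<open>2b\<close> only almost surely.  Setting all of them to zero on one common
    null set \<open>B\<close> keeps the contraction property.\<close>
  define h where "h f x = (if x \<in> B then 0 else if x \<in> space MX then f x - fstar x else 0)" for f :: "'x \<Rightarrow> real" and x
  define a where "a f z = h f (fst z)" for f :: "'x \<Rightarrow> real" and z :: "'x \<times> real"
  define l where "l f z = (if fst z \<in> B then 0 else loss_of loss f z - loss_of loss fstar z)" for f and z :: "'x \<times> real"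
  have h_meas: "h f \<in> borel_measurable MX" if "f \<in> T'" for f
    unfolding h_def using that by measurable
  have h_bound: "\<bar>h f x\<bar> \<le> 2 * b" if "f \<in> T'" for f x
    using that b_pos by (auto simp: h_def B_def not_less)
  have l_meas: "l f \<in> borel_measurable P" if "f \<in> T'" for f
  proof -
    have [measurable]: "loss_of loss f \<in> borel_measurable P" "loss_of loss fstar \<in> borel_measurable P" "fst \<in> P \<rightarrow>\<^sub>M MX"
      using loss_measurable_P fstar_F that T' fst_measurable by auto
    show ?thesis unfolding l_def by measurable
  qed
  interpret fc: finite_class P ?I T' a l "2 * b" fstar
  proof unfold_locales
    show "a f \<in> borel_measurable P" if "f \<in> T'" for f
      unfolding a_def by (rule measurable_compose[OF fst_measurable h_meas[OF that]])
    show "\<bar>l f z - l g z\<bar> \<le> \<bar>a f z - a g z\<bar>" if "f \<in> T'" "g \<in> T'" "z \<in> space P" for f g z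
      using loss_diff_le[of f g z] that T' by (auto simp: l_def a_def h_def space_P)
  qed (use T' l_meas h_bound b_pos in \<open>auto simp: T'_def a_def l_def h_def\<close>)
  have var: "(\<integral>z. (a f z)\<^sup>2 \<partial>P) \<le> \<sigma>\<^sup>2" if "f \<in> T'" for f
  proof -
    have "(\<integral>z. (a f z)\<^sup>2 \<partial>P) = (\<integral>x. (h f x)\<^sup>2 \<partial>\<mu>)"
      unfolding a_def using h_meas[OF that] by (subst integral_distr[OF fst_measurable]) auto
    also have "\<dots> = (\<integral>x. ((f - fstar) x)\<^sup>2 \<partial>\<mu>)"
    proof (rule integral_cong_AE)
      show "AE x in \<mu>. (h f x)\<^sup>2 = ((f - fstar) x)\<^sup>2"
        using AE_B AE_space by eventually_elim (auto simp: h_def)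
    qed (use h_meas[OF that] that in auto)
    also have "\<dots> = (L2_norm \<mu> (f - fstar))\<^sup>2" by (simp add: L2_norm_def)
    also have "\<dots> \<le> \<sigma>\<^sup>2" using T'loc(2)[OF that] by (intro power_mono) (auto simp: L2_norm_def)
    finally show ?thesis .
  qed
  have "fc.rademacher \<le> sqrt N * \<rho> * Rad"
    unfolding fc.rademacher_def a_def
  proof (rule localized_rademacher_le[OF T' T'loc(1) pos(1) h_meas h_bound])
    show "AE x in \<mu>. \<forall>f\<in>T'. h f x = f x - fstar x"
      using AE_B AE_space by eventually_elim (auto simp: h_def)
  qed
  then have rad: "32 * fc.rademacher \<le> \<tau>" by (simp add: \<tau>_def)
  have \<tau>: "0 < \<tau>" using pos N_pos by (simp add: \<tau>_def)
  let ?K = "\<Pi>\<^sub>M i\<in>?I. P"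
  let ?S = "{x \<in> space ?K. 9 / 8 * \<tau> \<le> fc.sup_process x}"
  let ?X = "\<lambda>\<omega>. \<lambda>i\<in>?I. XY i \<omega>"
  have X: "?X \<in> M \<rightarrow>\<^sub>M ?K"
    using XY_measurable by (intro measurable_restrict) (simp add: measurable_cong_sets[OF refl sets_P])
  have S: "?S \<in> sets ?K" using bdd_measD[OF fc.sup_process_bdd] by measurable
  have El: "P.expectation (l f) = excess_risk P loss fstar f" if "f \<in> T'" for f
    unfolding excess_risk_def
  proof (rule integral_cong_AE)
    show "AE z in P. l f z = loss_of loss f z - loss_of loss fstar z"
      using AE_BP by eventually_elim (auto simp: l_def)
  qed (use l_meas[OF that] loss_measurable_P fstar_F that T' in auto)
  have "AE \<omega> in M. \<forall>i\<in>?I. fst (XY i \<omega>) \<notin> B"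
    by (intro AE_finite_allI finite_atLeastAtMost XY_AE[OF AE_BP])
  \<comment> \<open>Outside a null event no sample point falls into B, and there l is the true loss
    difference; so the inclusion of events is an almost sure one.\<close>
  then have "AE \<omega> in M. \<omega> \<in> {\<omega> \<in> space M. \<exists>f\<in>T. 36 * Rad * \<rho> / sqrt N < \<bar>deviation f \<omega>\<bar>}
      \<longrightarrow> \<omega> \<in> ?X -` ?S \<inter> space M"
  proof eventually_elim
    case (elim \<omega>)
    show ?case
    proof
      assume "\<omega> \<in> {\<omega> \<in> space M. \<exists>f\<in>T. 36 * Rad * \<rho> / sqrt N < \<bar>deviation f \<omega>\<bar>}"
      then obtain f where \<omega>: "\<omega> \<in> space M" and f: "f \<in> T" "36 * Rad * \<rho> / sqrt N < \<bar>deviation f \<omega>\<bar>" by auto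
      have f': "f \<in> T'" using f by (simp add: T'_def)
      have "fc.emp_process f (?X \<omega>) = (\<Sum>i\<in>?I. loss_of loss f (XY i \<omega>) - loss_of loss fstar (XY i \<omega>) - excess_risk P loss fstar f)"
        unfolding fc.emp_process_def El[OF f'] using elim by (intro sum.cong) (auto simp: l_def)
      also have "\<dots> = - (real N * deviation f \<omega>)"
        unfolding deviation_eq using N_pos by (simp add: sum_subtractf right_diff_distrib diff_divide_distrib)
      finally have "\<bar>fc.emp_process f (?X \<omega>)\<bar> = real N * \<bar>deviation f \<omega>\<bar>" by (simp add: abs_mult)
      moreover have "9 / 8 * \<tau> = real N * (36 * Rad * \<rho> / sqrt N)"
        using N_pos by (simp add: \<tau>_def real_div_sqrt field_simps)
      moreover have "real N * (36 * Rad * \<rho> / sqrt N) \<le> real N * \<bar>deviation f \<omega>\<bar>"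
        using f(2) by (intro mult_left_mono) auto
      moreover have "\<bar>fc.emp_process f (?X \<omega>)\<bar> \<le> fc.sup_process (?X \<omega>)"
        unfolding fc.sup_process_def by (rule fc.ge_Max[OF f'])
      ultimately have "9 / 8 * \<tau> \<le> fc.sup_process (?X \<omega>)" by linarith
      then show "\<omega> \<in> ?X -` ?S \<inter> space M" using \<omega> measurable_space[OF X \<omega>] by simp
    qed
  qed
  then have "measure M {\<omega> \<in> space M. \<exists>f\<in>T. 36 * Rad * \<rho> / sqrt N < \<bar>deviation f \<omega>\<bar>} \<le> measure M (?X -` ?S \<inter> space M)"
    by (rule finite_measure_mono_AE) (rule measurable_sets[OF X S])
  also have "\<dots> = measure ?K ?S"
    using measure_distr[OF X S] unfolding distr_sample by (rule sym)
  also have "\<dots> \<le> exp (- \<tau>\<^sup>2 / (96 * (card ?I * \<sigma>\<^sup>2) + 16 * (2 * b) * \<tau>))"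
    by (rule fc.sup_process_tail[OF var \<tau> rad])
  finally show ?thesis by simp
qed

end

context bounded_lipschitz_erm
begin

text \<open>The finite-class bound does not depend on the size of the class, so it survives the
  increasing union of initial segments of an enumeration. The bad event is defined through the
  countable class, hence measurable, and \<open>countable_reduction\<close> extends the good bound
  to all of \<open>localized\<close>.\<close>

lemma localized_tail:
  fixes \<rho> \<sigma> :: real
  assumes pos: "0 < \<rho>" "0 < \<sigma>" "0 < Rad"
  defines "\<tau> \<equiv> 32 * (sqrt (real N) * \<rho> * Rad)" and "c \<equiv> 36 * Rad * \<rho> / sqrt N"
  obtains Bad where "Bad \<in> sets M"
    "measure M Bad \<le> exp (- \<tau>\<^sup>2 / (96 * (real N * \<sigma>\<^sup>2) + 32 * b * \<tau>))"
    "4 * b \<le> c \<Longrightarrow> measure M Bad = 0"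
    "\<And>\<omega> f. \<omega> \<in> space M - Bad \<Longrightarrow> f \<in> localized \<rho> \<sigma> \<Longrightarrow> \<bar>deviation f \<omega>\<bar> \<le> c"
proof -
  obtain D where D: "countable D" "D \<subseteq> localized \<rho> \<sigma>"
    and red: "\<And>\<omega> c f. \<omega> \<in> space M \<Longrightarrow> \<forall>g\<in>D. \<bar>deviation g \<omega>\<bar> \<le> c \<Longrightarrow> f \<in> localized \<rho> \<sigma> \<Longrightarrow> \<bar>deviation f \<omega>\<bar> \<le> c"
    using countable_reduction[OF pos(1)] by blast
  define bad where "bad S = {\<omega> \<in> space M. \<exists>f\<in>S. c < \<bar>deviation f \<omega>\<bar>}" for S
  have DF: "f \<in> F" if "f \<in> D" for f using D that by (auto simp: localized_def)
  have bad_sets: "bad S \<in> sets M" if "S \<subseteq> D" for S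
  proof -
    have "bad S = (\<Union>f\<in>S. {\<omega> \<in> space M. c < \<bar>deviation f \<omega>\<bar>})" by (auto simp: bad_def)
    also have "\<dots> \<in> sets M"
      using countable_subset[OF that D(1)] deviation_measurable[OF DF] that
      by (intro sets.countable_UN') (auto intro!: borel_measurable_less)
    finally show ?thesis .
  qed
  show thesis
  proof (rule that[of "bad D"])
    show "bad D \<in> sets M" by (rule bad_sets) simp
    show "\<bar>deviation f \<omega>\<bar> \<le> c" if "\<omega> \<in> space M - bad D" "f \<in> localized \<rho> \<sigma>" for \<omega> f
      using that by (intro red[of \<omega> c f]) (auto simp: bad_def not_less)
    show "measure M (bad D) = 0" if "4 * b \<le> c"
    proof -
      have "AE \<omega> in M. \<forall>f\<in>D. \<bar>deviation f \<omega>\<bar> \<le> 4 * b"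
        using D(1) deviation_bounded[OF DF] by (simp add: AE_ball_countable)
      then have "AE \<omega> in M. \<omega> \<notin> bad D"
        by eventually_elim (use \<open>4 * b \<le> c\<close> in \<open>force simp: bad_def\<close>)
      then show ?thesis
        using bad_sets[of D] by (simp add: AE_iff_measurable[OF bad_sets[of D]] prob_eq_0)
    qed
    show "measure M (bad D) \<le> exp (- \<tau>\<^sup>2 / (96 * (real N * \<sigma>\<^sup>2) + 32 * b * \<tau>))"
    proof (cases "D = {}")
      case True
      then show ?thesis by (simp add: bad_def)
    next
      case False
      define d where "d n = from_nat_into D ` {..n}" for n :: nat
      have dD: "d n \<subseteq> D" for n using from_nat_into[OF False] by (auto simp: d_def)
      have un: "(\<Union>n. bad (d n)) = bad D"
        using dD from_nat_into_surj[OF D(1)] by (fastforce simp: bad_def d_def)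
      have "incseq (\<lambda>n. bad (d n))" by (fastforce simp: incseq_def bad_def d_def)
      then have "(\<lambda>n. measure M (bad (d n))) \<longlonglongrightarrow> measure M (\<Union>n. bad (d n))"
        using bad_sets[OF dD] by (intro finite_Lim_measure_incseq) auto
      then show ?thesis unfolding un
      proof (rule LIMSEQ_le_const2, intro exI allI impI)
        fix n :: nat
        show "measure M (bad (d n)) \<le> exp (- \<tau>\<^sup>2 / (96 * (real N * \<sigma>\<^sup>2) + 32 * b * \<tau>))"
          unfolding bad_def \<tau>_def c_def
          using D(2) dD[of n] by (intro finite_deviation_tail pos) (auto simp: d_def)
      qed
    qed
  qed
qed

lemma nrm_scaleR: "f \<in> E \<Longrightarrow> nrm (k *\<^sub>R f) = \<bar>k\<bar> * nrm f"
  and nrm_triangle: "f \<in> E \<Longrightarrow> g \<in> E \<Longrightarrow> nrm (f + g) \<le> nrm f + nrm g"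
  and nrm_nonneg: "f \<in> E \<Longrightarrow> 0 \<le> nrm f"
  using norm_E by (auto simp: is_norm_on_def)

lemma nrm_diff_le: assumes "f \<in> E" "g \<in> E" shows "nrm f - nrm g \<le> nrm (f - g)" "nrm g - nrm f \<le> nrm (f - g)"
proof -
  have fg: "f - g \<in> E" "(-1) *\<^sub>R (f - g) \<in> E" using E_subspace assms by (auto intro: subspace_diff subspace_scale)
  show "nrm f - nrm g \<le> nrm (f - g)" using nrm_triangle[OF assms(2) fg(1)] by simp
  have "f + (-1) *\<^sub>R (f - g) = g" by (simp add: fun_eq_iff)
  then show "nrm g - nrm f \<le> nrm (f - g)"
    using nrm_triangle[OF assms(1) fg(2)] nrm_scaleR[OF fg(1), of "-1"] by simp
qed

lemma L2_norm_scaleR: "L2_norm \<mu> (k *\<^sub>R f) = \<bar>k\<bar> * L2_norm \<mu> f"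
  by (simp add: L2_norm_def power_mult_distrib real_sqrt_mult)

end

section \<open>Sparsity and peeling\<close>

locale sparse_erm = bounded_lipschitz_erm M MX P N XY E nrm F loss fstar b Rad
  for M :: "'w measure" and MX :: "'x measure" and P N XY E nrm F loss fstar b Rad +
  fixes A \<kappa> \<rho>star :: real
  assumes \<kappa>_ge: "1 \<le> \<kappa>" and A_pos: "0 < A" and Rad_pos: "0 < Rad" and \<rho>star_pos: "0 < \<rho>star"
    and bernstein: "\<And>f. f \<in> F \<Longrightarrow> L2_norm (distr P MX fst) (f - fstar) powr (2 * \<kappa>) \<le> A * excess_risk P loss fstar f"
    and sparsity: "ereal (4 / 5 * \<rho>star) \<le> sparsity_parameter (distr P MX fst) E nrm fstar
      (\<lambda>\<rho>. (1920 / 7 * A * Rad * \<rho> / sqrt (real N)) powr (1 / (2 * \<kappa>))) \<rho>star"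
begin

definition rate :: "real \<Rightarrow> real" where
  "rate \<rho> = (1920 / 7 * A * Rad * \<rho> / sqrt (real N)) powr (1 / (2 * \<kappa>))"

definition unit_rate :: real where "unit_rate = Rad / sqrt (real N)"

lemma unit_rate_pos: "0 < unit_rate" using Rad_pos N_pos by (simp add: unit_rate_def)

lemma rate_eq: "rate \<rho> = (1920 / 7 * A * unit_rate * \<rho>) powr (1 / (2 * \<kappa>))"
  by (simp add: rate_def unit_rate_def)

lemma rate_pos: "0 < \<rho> \<Longrightarrow> 0 < rate \<rho>"
  using A_pos unit_rate_pos by (simp add: rate_eq)

lemma rate_powr: "0 < \<rho> \<Longrightarrow> rate \<rho> powr (2 * \<kappa>) = 1920 / 7 * A * unit_rate * \<rho>"
  using \<kappa>_ge A_pos unit_rate_pos by (simp add: rate_eq powr_powr)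

lemma le_rate_iff: assumes "0 \<le> d" "0 < \<rho>" shows "d \<le> rate \<rho> \<longleftrightarrow> d powr (2 * \<kappa>) \<le> 1920 / 7 * A * unit_rate * \<rho>"
proof -
  have "d \<le> rate \<rho> \<longleftrightarrow> d powr (2 * \<kappa>) \<le> rate \<rho> powr (2 * \<kappa>)"
    using powr_less_mono2[of "2 * \<kappa>" "rate \<rho>" d] powr_mono2[of "2 * \<kappa>" d "rate \<rho>"] \<kappa>_ge assms rate_pos[OF assms(2)]
    by (auto simp: not_less[symmetric])
  then show ?thesis by (simp add: rate_powr[OF assms(2)])
qed

text \<open>The exponent 1 / (2 \<kappa>) is at most 1. Consequently, scaling f -
  \<open>fstar\<close> down to norm \<open>\<rho>star\<close> shrinks its L2 norm at least as fast
  as the rate, and the scaled function stays in the L2 ball over which the sparsity parameter is an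
  infimum.\<close>

lemma rate_sublinear: assumes "0 < \<rho>" "\<rho> \<le> \<rho>'" shows "rate \<rho>' \<le> \<rho>' / \<rho> * rate \<rho>"
proof -
  have "1920 / 7 * A * unit_rate * \<rho>' = 1920 / 7 * A * unit_rate * \<rho> * (\<rho>' / \<rho>)"
    using assms by simp
  then have "rate \<rho>' = (1920 / 7 * A * unit_rate * \<rho> * (\<rho>' / \<rho>)) powr (1 / (2 * \<kappa>))"
    by (simp only: rate_eq)
  also have "\<dots> = rate \<rho> * (\<rho>' / \<rho>) powr (1 / (2 * \<kappa>))"
    using assms A_pos unit_rate_pos by (subst powr_mult) (auto simp: rate_eq)
  also have "\<dots> \<le> rate \<rho> * (\<rho>' / \<rho>) powr 1"
    using assms \<kappa>_ge rate_pos[OF assms(1)] by (intro mult_left_mono powr_mono) auto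
  finally show ?thesis using assms by (simp add: mult.commute)
qed

lemma excess_nonneg: "f \<in> F \<Longrightarrow> 0 \<le> excess_risk P loss fstar f"
  using bernstein[of f] A_pos powr_ge_zero[of "L2_norm \<mu> (f - fstar)" "2 * \<kappa>"] by (smt (verit) zero_le_mult_iff)

text \<open>Since \<open>rate (2 * u) powr (2 * \<kappa>)\<close> is linear in \<open>u\<close>, peeling in the norm and in the \<open>L\<^sub>2\<close> norm can be
  done in the single parameter \<open>u = radius f\<close>.\<close>

definition radius :: "('x \<Rightarrow> real) \<Rightarrow> real" where
  "radius f = max (max (nrm (f - fstar)) \<rho>star)
     (L2_norm \<mu> (f - fstar) powr (2 * \<kappa>) / (1920 / 7 * A * unit_rate * 2))"

text \<open>By sparsity, a subgradient of the norm at a point close to \<open>f\<^sup>*\<close> grows along \<open>f - f\<^sup>*\<close> almost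
  as fast as the norm itself.\<close>

lemma norm_growth:
  assumes f: "f \<in> F" and n: "\<rho>star < nrm (f - fstar)" and d: "L2_norm \<mu> (f - fstar) \<le> rate (2 * nrm (f - fstar))"
  shows "7 / 10 * nrm (f - fstar) < nrm f - nrm fstar"
proof -
  define h where "h = f - fstar"
  define n where "n = nrm h"
  have nlt: "\<rho>star < n" using n by (simp add: n_def h_def)
  have n0: "0 < n" using nlt \<rho>star_pos by simp
  have hE: "h \<in> E" using diff_E[OF f] by (simp add: h_def)
  have fE: "f \<in> E" "fstar \<in> E" using f fstar_F F_subset by auto
  define h0 where "h0 = (\<rho>star / n) *\<^sub>R h"
  have "h0 = \<rho>star *\<^sub>R ((1 / n) *\<^sub>R h)" by (simp add: h0_def)
  moreover have "(1 / n) *\<^sub>R h \<in> unit_sphere E nrm"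
    using hE n0 E_subspace by (simp add: unit_sphere_def nrm_scaleR subspace_scale flip: n_def)
  ultimately have h0S: "h0 \<in> (*\<^sub>R) \<rho>star ` unit_sphere E nrm" by blast
  have r0: "0 < rate (2 * \<rho>star)" using \<rho>star_pos by (simp add: rate_pos)
  have "h0 = rate (2 * \<rho>star) *\<^sub>R ((\<rho>star / (n * rate (2 * \<rho>star))) *\<^sub>R h)"
    using r0 by (simp add: h0_def)
  moreover have "(\<rho>star / (n * rate (2 * \<rho>star))) *\<^sub>R h \<in> L2_ball \<mu>"
  proof -
    have "L2_norm \<mu> h \<le> n / \<rho>star * rate (2 * \<rho>star)"
      using d rate_sublinear[of "2 * \<rho>star" "2 * n"] \<rho>star_pos nlt by (simp add: h_def n_def)
    then have "L2_norm \<mu> ((\<rho>star / (n * rate (2 * \<rho>star))) *\<^sub>R h) \<le> 1"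
      using r0 n0 \<rho>star_pos by (simp add: L2_norm_scaleR field_simps)
    moreover have "(\<rho>star / (n * rate (2 * \<rho>star))) *\<^sub>R h \<in> L2_space \<mu>"
      using E_L2 hE E_subspace subspace_scale by blast
    ultimately show ?thesis by (simp add: L2_ball_def)
  qed
  ultimately have h0L: "h0 \<in> (*\<^sub>R) (rate (2 * \<rho>star)) ` L2_ball \<mu>" by blast
  have "ereal (4 / 5 * \<rho>star) \<le> (SUP g \<in> Gamma_set E nrm fstar \<rho>star. ereal (g h0))"
    using sparsity unfolding sparsity_parameter_def
    by (rule order_trans) (rule INF_lower, use h0S h0L in \<open>simp only: rate_def Int_iff\<close>)
  \<comment> \<open>The supremum over subgradients need not be attained. This slack is chosen so
    that, after rescaling by n / \<open>\<rho>star\<close>, the lower bound 4/5 n becomes 7/10 n +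
    \<open>\<rho>star\<close> / 10.\<close>
  define \<delta> where "\<delta> = (n - \<rho>star) * \<rho>star / (10 * n)"
  have "0 < \<delta>" using nlt n0 \<rho>star_pos by (simp add: \<delta>_def)
  then have "ereal (4 / 5 * \<rho>star - \<delta>) < ereal (4 / 5 * \<rho>star)" by simp
  also have "\<dots> \<le> (SUP g \<in> Gamma_set E nrm fstar \<rho>star. ereal (g h0))" by fact
  finally obtain g where g: "g \<in> Gamma_set E nrm fstar \<rho>star" "4 / 5 * \<rho>star - \<delta> < g h0"
    by (auto simp: less_SUP_iff)
  then obtain v where v: "v \<in> E" "nrm v \<le> 1"
    and g': "g \<in> subdifferential E nrm (fstar + (\<rho>star / 20) *\<^sub>R v)"
    by (auto simp: Gamma_set_def unit_ball_def)
  define w where "w = (\<rho>star / 20) *\<^sub>R v"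
  have wE: "w \<in> E" using v E_subspace by (simp add: w_def subspace_scale)
  have w: "nrm w \<le> \<rho>star / 20" using v \<rho>star_pos by (simp add: w_def nrm_scaleR)
  define f1 where "f1 = fstar + w"
  have f1E: "f1 \<in> E" using fE wE E_subspace by (simp add: f1_def subspace_add)
  have lin: "g (p + q) = g p + g q" "g (k *\<^sub>R p) = k * g p" if "p \<in> E" "q \<in> E" for p q k
    using g' that by (auto simp: subdifferential_def linear_functional_on_def)
  have sub: "g q \<le> nrm (f1 + q) - nrm f1" if "q \<in> E" for q
    using g' that by (auto simp: subdifferential_def f1_def w_def)
  \<comment> \<open>The subgradient sits at f1 = \<open>fstar\<close> + w instead of
    \<open>fstar\<close>. Moving between the two points costs nrm w twice, at most
    \<open>\<rho>star\<close> / 10 in all, exactly the surplus that \<delta> keeps.\<close>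
  have "g w \<le> nrm w" using sub[OF wE] nrm_triangle[OF f1E wE] by simp
  moreover have "g h - g w \<le> nrm f - nrm f1"
  proof -
    have mw: "(-1) *\<^sub>R w \<in> E" using wE E_subspace subspace_scale by blast
    have "f1 + (h + (-1) *\<^sub>R w) = f" by (simp add: f1_def h_def fun_eq_iff)
    moreover have "h + (-1) *\<^sub>R w \<in> E" using hE mw E_subspace by (rule_tac subspace_add)
    ultimately show ?thesis
      using sub[of "h + (-1) *\<^sub>R w"] lin(1)[OF hE mw] lin(2)[OF wE wE, of "-1"] by simp
  qed
  moreover have "nrm fstar - nrm f1 \<le> nrm w"
  proof -
    have "f1 - fstar = w" by (simp add: f1_def)
    then show ?thesis using nrm_diff_le(2)[OF f1E fE(2)] by simp
  qed
  moreover have "7 / 10 * n + \<rho>star / 10 < g h"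
  proof -
    have "g h0 = \<rho>star / n * g h" unfolding h0_def by (rule lin(2)[OF hE hE])
    then have "(4 / 5 * \<rho>star - \<delta>) * (n / \<rho>star) < \<rho>star / n * g h * (n / \<rho>star)"
      using g(2) n0 \<rho>star_pos by (intro mult_strict_right_mono) auto
    then have "(4 / 5 * \<rho>star - \<delta>) * n / \<rho>star < g h" using n0 \<rho>star_pos by simp
    moreover have "(4 / 5 * \<rho>star - \<delta>) * n / \<rho>star = 7 / 10 * n + \<rho>star / 10"
      using n0 \<rho>star_pos by (simp add: \<delta>_def field_simps)
    ultimately show ?thesis by simp
  qed
  ultimately show ?thesis using w by (simp add: n_def h_def)
qed

lemma deterministic_bound:
  assumes dev: "\<And>f. f \<in> F \<Longrightarrow> \<bar>deviation f \<omega>\<bar> \<le> 72 * unit_rate * radius f"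
    and opt: "is_arg_min (\<lambda>f. empirical_risk N (\<lambda>i. XY i \<omega>) loss f + 720 / 7 * unit_rate * nrm f) (\<lambda>f. f \<in> F) fh"
  shows "nrm (fh - fstar) \<le> \<rho>star" "L2_norm \<mu> (fh - fstar) \<le> rate (2 * \<rho>star)"
    "excess_risk P loss fstar fh \<le> rate (2 * \<rho>star) powr (2 * \<kappa>) / A"
proof -
  have fh: "fh \<in> F" using opt by (simp add: is_arg_min_def)
  define n where "n = nrm (fh - fstar)"
  define d where "d = L2_norm \<mu> (fh - fstar)"
  define u where "u = radius fh"
  define ex where "ex = excess_risk P loss fstar fh"
  have fE: "fh \<in> E" "fstar \<in> E" using fh fstar_F F_subset by auto
  have n0: "0 \<le> n" unfolding n_def by (intro nrm_nonneg diff_E fh)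
  have d0: "0 \<le> d" by (simp add: d_def L2_norm_def)
  note R = unit_rate_pos
  have K: "0 < 1920 / 7 * A * unit_rate * 2" using A_pos R by simp
  have u_eq: "u = max (max n \<rho>star) (d powr (2 * \<kappa>) / (1920 / 7 * A * unit_rate * 2))"
    by (simp add: u_def radius_def n_def d_def)
  have u_ge: "n \<le> u" "\<rho>star \<le> u" by (auto simp: u_eq)
  have bern: "d powr (2 * \<kappa>) \<le> A * ex" using bernstein[OF fh] by (simp add: d_def ex_def)
  have ex0: "0 \<le> ex" unfolding ex_def by (rule excess_nonneg[OF fh])
  have opt': "empirical_risk N (\<lambda>i. XY i \<omega>) loss fh - empirical_risk N (\<lambda>i. XY i \<omega>) loss fstar
      + 720 / 7 * unit_rate * (nrm fh - nrm fstar) \<le> 0"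
    using opt fstar_F by (auto simp: is_arg_min_def not_less right_diff_distrib)
  \<comment> \<open>Empirical optimality against \<open>fstar\<close>, with the empirical excess
    loss replaced by the true excess risk at the cost of the deviation.\<close>
  have key: "ex + 720 / 7 * unit_rate * (nrm fh - nrm fstar) \<le> 72 * unit_rate * u"
    using opt' dev[OF fh] by (simp add: deviation_def ex_def u_def abs_le_iff)
  have nd: "- n \<le> nrm fh - nrm fstar" using nrm_diff_le(2)[OF fE] by (simp add: n_def)
  have nd': "unit_rate * - n \<le> unit_rate * (nrm fh - nrm fstar)" using nd R by (intro mult_left_mono) auto
  \<comment> \<open>If the L2 part alone determines u, the Bernstein condition gives an excess risk
    of at least 3840/7 in units of \<open>unit_rate * u\<close>, whereas deviation and penalty
    together allow only 72 + 720/7 = 1224/7.\<close>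
  have u_le: "u \<le> max n \<rho>star"
  proof (rule ccontr)
    assume "\<not> u \<le> max n \<rho>star"
    then have u: "u = d powr (2 * \<kappa>) / (1920 / 7 * A * unit_rate * 2)" "n < u" by (auto simp: u_eq)
    have "d powr (2 * \<kappa>) = A * (3840 / 7 * (unit_rate * u))" using A_pos R u(1) by (simp add: field_simps)
    then have "A * (3840 / 7 * (unit_rate * u)) \<le> A * ex" using bern by simp
    then have "3840 / 7 * (unit_rate * u) \<le> ex" using A_pos by simp
    moreover have "unit_rate * n \<le> unit_rate * u" using u(2) R by simp
    moreover have "0 < unit_rate * u" using R n0 u(2) by simp
    ultimately show False using key nd' unfolding mult.assoc by linarith
  qed
  have d_le: "d \<le> rate (2 * max n \<rho>star)"
  proof -
    have "d powr (2 * \<kappa>) / (1920 / 7 * A * unit_rate * 2) \<le> max n \<rho>star" using u_le by (simp add: u_eq)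
    then have "d powr (2 * \<kappa>) \<le> 1920 / 7 * A * unit_rate * (2 * max n \<rho>star)"
      using K by (simp add: field_simps)
    then show ?thesis using le_rate_iff[OF d0, of "2 * max n \<rho>star"] \<rho>star_pos by simp
  qed
  have n_le: "n \<le> \<rho>star"
  proof (rule ccontr)
    assume "\<not> n \<le> \<rho>star"
    then have n: "\<rho>star < n" "max n \<rho>star = n" by auto
    have "7 / 10 * n < nrm fh - nrm fstar"
      using norm_growth[OF fh] n d_le by (simp add: n_def d_def)
    then have "unit_rate * (7 / 10 * n) < unit_rate * (nrm fh - nrm fstar)" using R by simp
    moreover have "unit_rate * u \<le> unit_rate * n" using u_le n R by simp
    ultimately show False using key ex0 unfolding mult.assoc by linarith
  qed
  show "nrm (fh - fstar) \<le> \<rho>star" using n_le by (simp add: n_def)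
  have m: "max n \<rho>star = \<rho>star" using n_le by simp
  show "L2_norm \<mu> (fh - fstar) \<le> rate (2 * \<rho>star)" using d_le by (simp add: m d_def)
  have "unit_rate * u \<le> unit_rate * \<rho>star" using u_le m R by simp
  moreover have "unit_rate * n \<le> unit_rate * \<rho>star" using n_le R by simp
  moreover have "0 \<le> unit_rate * \<rho>star" using R \<rho>star_pos by simp
  ultimately have "ex \<le> 3840 / 7 * (unit_rate * \<rho>star)" using key nd' unfolding mult.assoc by linarith
  then show "excess_risk P loss fstar fh \<le> rate (2 * \<rho>star) powr (2 * \<kappa>) / A"
    using A_pos \<rho>star_pos by (simp add: rate_powr ex_def)
qed


lemma radius_peel:
  assumes "f \<in> F"
  obtains i :: nat where "f \<in> localized (2 ^ i * \<rho>star) (2 * rate (2 * (2 ^ i * \<rho>star)))" "2 ^ i * \<rho>star \<le> 2 * radius f"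
proof -
  define i where "i = (LEAST i. radius f \<le> 2 ^ i * \<rho>star)"
  have "\<exists>i. radius f / \<rho>star < 2 ^ i" by (rule real_arch_pow) simp
  then have ex: "\<exists>i. radius f \<le> 2 ^ i * \<rho>star" using \<rho>star_pos by (auto simp: field_simps intro: less_imp_le)
  have i: "radius f \<le> 2 ^ i * \<rho>star" unfolding i_def by (rule LeastI_ex[OF ex])
  have \<rho>: "0 < 2 ^ i * \<rho>star" using \<rho>star_pos by simp
  have K: "0 < 1920 / 7 * A * unit_rate * 2" using A_pos unit_rate_pos by simp
  have "L2_norm \<mu> (f - fstar) powr (2 * \<kappa>) / (1920 / 7 * A * unit_rate * 2) \<le> 2 ^ i * \<rho>star"
    using i by (simp add: radius_def)
  then have "L2_norm \<mu> (f - fstar) powr (2 * \<kappa>) \<le> 1920 / 7 * A * unit_rate * (2 * (2 ^ i * \<rho>star))"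
    using K by (simp add: field_simps)
  then have "L2_norm \<mu> (f - fstar) \<le> rate (2 * (2 ^ i * \<rho>star))"
    using \<rho> by (subst le_rate_iff) (auto simp: L2_norm_def)
  \<comment> \<open>Positivity makes the bound by twice the rate strict, as \<open>localized\<close>
    demands.\<close>
  moreover have "0 < rate (2 * (2 ^ i * \<rho>star))" using \<rho> by (intro rate_pos) simp
  ultimately have "f \<in> localized (2 ^ i * \<rho>star) (2 * rate (2 * (2 ^ i * \<rho>star)))"
    using i assms by (simp add: localized_def radius_def)
  moreover have "2 ^ i * \<rho>star \<le> 2 * radius f"
  proof (cases i)
    \<comment> \<open>At the lowest scale there is no predecessor to exceed; instead
      \<open>radius\<close> has \<open>\<rho>star\<close> as a floor.\<close>
    case 0
    then show ?thesis using \<rho>star_pos by (simp add: radius_def max_def)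
  next
    case (Suc j)
    then have "\<not> radius f \<le> 2 ^ j * \<rho>star" unfolding i_def by (intro not_less_Least) simp
    then show ?thesis using Suc by simp
  qed
  ultimately show thesis by (rule that)
qed

end

text \<open>Used with \<open>g = \<rho> Rad(B)\<close>, in the notation of \<open>localized_tail\<close>.  The case excluded by \<open>small\<close> is the one
  in which the deviation is almost surely below the level.\<close>

lemma tail_exponent_bound:
  fixes n g b A \<kappa> :: real
  assumes "1 \<le> n" "0 < g" "0 < b" "0 < A" "1 \<le> \<kappa>" and small: "g / sqrt n \<le> b"
  defines "K \<equiv> 3840 / 7 * A" and "\<tau> \<equiv> 32 * (sqrt n * g)"
  defines "\<sigma> \<equiv> 2 * (K * (g / sqrt n)) powr (1 / (2 * \<kappa>))"
  shows "1024 / (384 * K powr (1 / \<kappa>) + 1024 * b powr (2 - 1 / \<kappa>)) *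
      (n powr (1 / (2 * \<kappa>)) * g powr ((2 * \<kappa> - 1) / \<kappa>))
    \<le> \<tau>\<^sup>2 / (96 * (n * \<sigma>\<^sup>2) + 32 * b * \<tau>)"
proof -
  define p where "p = 1 / \<kappa>"
  have p: "0 < p" "p \<le> 1" using \<open>1 \<le> \<kappa>\<close> by (auto simp: p_def)
  define x where "x = g / sqrt n"
  have x: "0 < x" "x \<le> b" using assms by (auto simp: x_def)
  have K: "0 < K" using assms by (simp add: K_def)
  \<comment> \<open>Here 384 = 96 * 4, the 4 coming from the factor 2 in \<sigma>, and 1024 = 32 *
    32 comes from 32 b \<tau>; the numerator 1024 in the claim is the square of the 32 in
    \<tau>.\<close>
  define W where "W = 384 * K powr p + 1024 * b powr (2 - p)"
  have W: "0 < W" using K by (auto simp: W_def intro!: add_pos_nonneg)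
  have "sqrt n * x = g" using \<open>1 \<le> n\<close> by (simp add: x_def)
  moreover have "n * x = sqrt n * (sqrt n * x)" using \<open>1 \<le> n\<close> by (simp add: mult.assoc[symmetric])
  ultimately have \<tau>: "\<tau> = 32 * (n * x)" by (simp add: \<tau>_def)
  have "\<sigma>\<^sup>2 = 4 * (K * x) powr p"
    using \<open>1 \<le> \<kappa>\<close> by (simp add: \<sigma>_def x_def[symmetric] power_mult_distrib power2_eq_square powr_add[symmetric] p_def)
  also have "\<dots> = 4 * (K powr p * x powr p)" using K x by (simp add: powr_mult)
  finally have \<sigma>: "\<sigma>\<^sup>2 = 4 * (K powr p * x powr p)" .
  \<comment> \<open>This is where x \<le> b enters: splitting x into x^p x^(1 - p) bounds the linear
    term by the power x^p of the variance term, with a coefficient depending on b and \<kappa>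
    only.\<close>
  have "b * x = b * (x powr p * x powr (1 - p))" using x by (simp add: powr_add[symmetric])
  also have "\<dots> \<le> b * (x powr p * b powr (1 - p))"
    using x p \<open>0 < b\<close> by (intro mult_left_mono powr_mono2) auto
  also have "\<dots> = b powr (2 - p) * x powr p"
  proof -
    have "b powr (2 - p) = b powr (1 + (1 - p))" by simp
    also have "\<dots> = b * b powr (1 - p)" using \<open>0 < b\<close> by (subst powr_add) simp
    finally show ?thesis by simp
  qed
  finally have bx: "b * x \<le> b powr (2 - p) * x powr p" .
  have "n * (384 * (K powr p * x powr p) + 1024 * (b * x)) \<le> n * (x powr p * W)"
    using bx assms by (intro mult_left_mono) (auto simp: W_def algebra_simps)
  moreover have "96 * (n * \<sigma>\<^sup>2) + 32 * b * \<tau> = n * (384 * (K powr p * x powr p) + 1024 * (b * x))"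
    by (simp add: \<sigma> \<tau> algebra_simps)
  ultimately have le: "96 * (n * \<sigma>\<^sup>2) + 32 * b * \<tau> \<le> n * (x powr p * W)" by simp
  have pos: "0 < 96 * (n * \<sigma>\<^sup>2) + 32 * b * \<tau>"
    using assms by (auto simp: \<tau>_def intro!: add_nonneg_pos)
  \<comment> \<open>With p = 1 / \<kappa>, the powers of n and g combine into n x^(2 - p), which up
    to constants is \<tau>^2 divided by n x^p.\<close>
  have "n powr (1 / (2 * \<kappa>)) * g powr ((2 * \<kappa> - 1) / \<kappa>) = n * x powr (2 - p)"
  proof -
    have "x powr (2 - p) = g powr (2 - p) / (n powr (1 / 2)) powr (2 - p)"
      using assms by (simp add: x_def powr_divide powr_half_sqrt)
    also have "(n powr (1 / 2)) powr (2 - p) = n powr (1 - p / 2)" by (simp add: powr_powr diff_divide_distrib)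
    also have "g powr (2 - p) / n powr (1 - p / 2) = g powr (2 - p) * n powr (p / 2 - 1)"
      using powr_minus_divide[of n "1 - p / 2"] by simp
    finally have "n * x powr (2 - p) = g powr (2 - p) * (n powr 1 * n powr (p / 2 - 1))" using assms by simp
    also have "n powr 1 * n powr (p / 2 - 1) = n powr (p / 2)" by (subst powr_add[symmetric]) simp
    also have "p / 2 = 1 / (2 * \<kappa>)" by (simp add: p_def)
    finally have "n * x powr (2 - p) = g powr (2 - p) * n powr (1 / (2 * \<kappa>))" .
    moreover have "(2 * \<kappa> - 1) / \<kappa> = 2 - p" using assms by (simp add: p_def field_simps)
    ultimately show ?thesis by simp
  qed
  moreover have "1024 / W * (n * x powr (2 - p)) = \<tau>\<^sup>2 / (n * (x powr p * W))"
  proof -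
    have "x powr (2 - p) = x\<^sup>2 / x powr p" using x by (simp add: powr_diff powr_numeral)
    moreover have "1024 / W * (n * (x\<^sup>2 / y)) = (32 * (n * x))\<^sup>2 / (n * (y * W))" if "0 < y" for y
      using that \<open>1 \<le> n\<close> W by (simp add: field_simps power2_eq_square)
    ultimately show ?thesis using x by (simp add: \<tau>)
  qed
  moreover have "\<tau>\<^sup>2 / (n * (x powr p * W)) \<le> \<tau>\<^sup>2 / (96 * (n * \<sigma>\<^sup>2) + 32 * b * \<tau>)"
    using le pos W x \<open>1 \<le> n\<close> by (intro divide_left_mono mult_pos_pos) auto
  ultimately show ?thesis by (simp add: W_def p_def)
qed

section \<open>Union bound over the peeling scales\<close>

context sparse_erm
begin

definition tail_constant :: real where
  "tail_constant = 1024 / (384 * (3840 / 7 * A) powr (1 / \<kappa>) + 1024 * b powr (2 - 1 / \<kappa>))"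

text \<open>The bad event at scale i has probability at most q^(i + 1): the exponent grows by the
  factor 2^(i e) with e = (2 \<kappa> - 1) / \<kappa> \<ge> 1, and 2^i \<ge> i + 1. The geometric
  series sums to q / (1 - q), at most 2 q when q \<le> 1/2.\<close>

lemma uniform_deviation:
  defines "Q \<equiv> real N powr (1 / (2 * \<kappa>)) * (\<rho>star * Rad) powr ((2 * \<kappa> - 1) / \<kappa>)"
  assumes half: "exp (- (tail_constant * Q)) \<le> 1 / 2"
  obtains Good where "Good \<in> sets M" "1 - 2 * exp (- (tail_constant * Q)) \<le> measure M Good"
    "\<And>\<omega> f. \<omega> \<in> Good \<Longrightarrow> f \<in> F \<Longrightarrow> \<bar>deviation f \<omega>\<bar> \<le> 72 * unit_rate * radius f"
proof -
  define q where "q = exp (- (tail_constant * Q))"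
  have q: "0 < q" "q \<le> 1 / 2" using half by (auto simp: q_def)
  have c0: "0 < tail_constant"
    using A_pos by (auto simp: tail_constant_def intro!: divide_pos_pos add_pos_nonneg)
  have Q0: "0 \<le> Q" by (simp add: Q_def)
  define \<rho> where "\<rho> i = 2 ^ i * \<rho>star" for i :: nat
  have \<rho>: "0 < \<rho> i" for i using \<rho>star_pos by (simp add: \<rho>_def)
  have "\<exists>Bad. Bad \<in> sets M \<and> measure M Bad \<le> q ^ Suc i \<and>
    (\<forall>\<omega>\<in>space M - Bad. \<forall>f\<in>localized (\<rho> i) (2 * rate (2 * \<rho> i)). \<bar>deviation f \<omega>\<bar> \<le> 36 * unit_rate * \<rho> i)" for i
  proof -
    let ?\<tau> = "32 * (sqrt (real N) * \<rho> i * Rad)" and ?\<sigma> = "2 * rate (2 * \<rho> i)"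
    have \<sigma>: "0 < ?\<sigma>" using rate_pos[of "2 * \<rho> i"] \<rho>[of i] by simp
    obtain Bad where Bad: "Bad \<in> sets M"
      "measure M Bad \<le> exp (- ?\<tau>\<^sup>2 / (96 * (real N * ?\<sigma>\<^sup>2) + 32 * b * ?\<tau>))"
      "4 * b \<le> 36 * Rad * \<rho> i / sqrt (real N) \<Longrightarrow> measure M Bad = 0"
      "\<And>\<omega> f. \<omega> \<in> space M - Bad \<Longrightarrow> f \<in> localized (\<rho> i) ?\<sigma> \<Longrightarrow> \<bar>deviation f \<omega>\<bar> \<le> 36 * Rad * \<rho> i / sqrt (real N)"
      by (rule localized_tail[OF \<rho>[of i] \<sigma> Rad_pos]) blast
    have "measure M Bad \<le> q ^ Suc i"
    proof (cases "4 * b \<le> 36 * Rad * \<rho> i / sqrt (real N)")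
      case True
      then show ?thesis using Bad(3) q by simp
    next
      case False
      define Qi where "Qi = real N powr (1 / (2 * \<kappa>)) * (\<rho> i * Rad) powr ((2 * \<kappa> - 1) / \<kappa>)"
      have "36 * (\<rho> i * Rad / sqrt (real N)) \<le> 36 * b"
        using False b_pos by (simp add: mult_ac)
      then have small: "\<rho> i * Rad / sqrt (real N) \<le> b" by simp
      have rate_i: "rate (2 * \<rho> i) = (3840 / 7 * A * (\<rho> i * Rad / sqrt (real N))) powr (1 / (2 * \<kappa>))"
        by (simp add: rate_def mult_ac)
      have \<tau>_i: "?\<tau> = 32 * (sqrt (real N) * (\<rho> i * Rad))" by simp
      have "tail_constant * Qi \<le> ?\<tau>\<^sup>2 / (96 * (real N * ?\<sigma>\<^sup>2) + 32 * b * ?\<tau>)"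
        unfolding rate_i \<tau>_i Qi_def tail_constant_def
        using small N_pos Rad_pos \<rho>[of i] b_pos A_pos \<kappa>_ge by (intro tail_exponent_bound) auto
      moreover have "real (Suc i) * Q \<le> Qi"
      proof -
        let ?e = "(2 * \<kappa> - 1) / \<kappa>"
        have e: "1 \<le> ?e" using \<kappa>_ge by (simp add: field_simps)
        have "real (Suc i) \<le> 2 ^ i" by (induction i) auto
        also have "(2::real) ^ i = (2 ^ i) powr 1" by simp
        also have "\<dots> \<le> (2 ^ i) powr ?e" using e by (intro powr_mono) auto
        finally have "real (Suc i) * Q \<le> (2 ^ i) powr ?e * Q" using Q0 by (intro mult_right_mono)
        also have "\<dots> = Qi"
          using \<rho>star_pos Rad_pos by (simp add: Q_def Qi_def \<rho>_def powr_mult mult_ac)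
        finally show ?thesis .
      qed
      then have "tail_constant * (real (Suc i) * Q) \<le> tail_constant * Qi" using c0 by simp
      ultimately have "- ?\<tau>\<^sup>2 / (96 * (real N * ?\<sigma>\<^sup>2) + 32 * b * ?\<tau>) \<le> real (Suc i) * - (tail_constant * Q)"
        by (simp add: mult_ac)
      then have "exp (- ?\<tau>\<^sup>2 / (96 * (real N * ?\<sigma>\<^sup>2) + 32 * b * ?\<tau>)) \<le> q ^ Suc i"
        unfolding q_def exp_of_nat_mult[symmetric] by simp
      then show ?thesis using Bad(2) by simp
    qed
    then show ?thesis using Bad(1,4) by (intro exI[of _ Bad]) (auto simp: unit_rate_def mult_ac)
  qed
  then obtain Bad where Bad: "\<And>i. Bad i \<in> sets M" "\<And>i. measure M (Bad i) \<le> q ^ Suc i"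
    "\<And>i \<omega> f. \<omega> \<in> space M - Bad i \<Longrightarrow> f \<in> localized (\<rho> i) (2 * rate (2 * \<rho> i)) \<Longrightarrow> \<bar>deviation f \<omega>\<bar> \<le> 36 * unit_rate * \<rho> i"
    by metis
  have geo: "(\<lambda>i. q ^ Suc i) sums (q * (1 / (1 - q)))"
    using q sums_mult[OF geometric_sums[of q], of q] by simp
  have sum: "summable (\<lambda>i. measure M (Bad i))"
    by (rule summable_comparison_test'[OF sums_summable[OF geo], of 0]) (use Bad(2) in simp)
  have "measure M (\<Union>i. Bad i) \<le> (\<Sum>i. measure M (Bad i))"
    using Bad(1) sum by (intro finite_measure_subadditive_countably) auto
  also have "\<dots> \<le> (\<Sum>i. q ^ Suc i)" by (intro suminf_le Bad(2) sum sums_summable[OF geo])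
  also have "\<dots> = q / (1 - q)" using sums_unique[OF geo] by simp
  also have "\<dots> \<le> 2 * q" using q by (simp add: field_simps)
  finally have "measure M (\<Union>i. Bad i) \<le> 2 * q" .
  moreover have BadU: "(\<Union>i. Bad i) \<in> sets M" using Bad(1) by auto
  ultimately have "1 - 2 * q \<le> measure M (space M - (\<Union>i. Bad i))"
    by (simp add: prob_compl)
  moreover have "\<bar>deviation f \<omega>\<bar> \<le> 72 * unit_rate * radius f"
    if \<omega>: "\<omega> \<in> space M - (\<Union>i. Bad i)" and f: "f \<in> F" for \<omega> f
  proof -
    obtain i where i: "f \<in> localized (\<rho> i) (2 * rate (2 * \<rho> i))" "\<rho> i \<le> 2 * radius f"
      using radius_peel[OF f] by (auto simp: \<rho>_def)
    have "\<bar>deviation f \<omega>\<bar> \<le> 36 * unit_rate * \<rho> i" using \<omega> by (intro Bad(3)[OF _ i(1)]) auto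
    also have "\<dots> \<le> 36 * unit_rate * (2 * radius f)" using i(2) unit_rate_pos by (intro mult_left_mono) auto
    finally show ?thesis by simp
  qed
  ultimately show thesis using BadU by (intro that[of "space M - (\<Union>i. Bad i)"]) (auto simp: q_def)
qed

end

theorem theorem2p2:
  fixes A b \<kappa> :: real
  assumes "\<kappa> \<ge> 1" and "A > 0" and "b > 0"
  shows "\<exists>C1 C2. C1 > 0 \<and> C2 > 0 \<and>
    (\<forall>(M :: 'w measure) (MX :: 'x measure) P N XY E nrm F loss fstar C Rad r \<rho>star lam fhat.
       regularized_erm M MX P N XY E nrm F loss fstar \<longrightarrow>
       (\<forall>f1\<in>F. \<forall>f2\<in>F. \<forall>x\<in>space MX. \<forall>y.
          \<bar>loss (f1 x) y - loss (f2 x) y\<bar> \<le> \<bar>f1 x - f2 x\<bar>) \<longrightarrow>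
       (\<forall>f\<in>F. L2_norm (distr P MX fst) (f - fstar) powr (2 * \<kappa>)
          \<le> A * excess_risk P loss fstar f) \<longrightarrow>
       (\<forall>f\<in>F. Linf_norm (distr P MX fst) f \<le> ereal b) \<longrightarrow>
       C = 1920 / 7 \<longrightarrow>
       0 \<le> Rad \<longrightarrow>
       Rademacher_complexity (distr P MX fst) N (unit_ball E nrm) = ennreal Rad \<longrightarrow>
       r = (\<lambda>\<rho>. (C * A * Rad * \<rho> / sqrt (real N)) powr (1 / (2 * \<kappa>))) \<longrightarrow>
       0 < \<rho>star \<longrightarrow>
       sparsity_parameter (distr P MX fst) E nrm fstar r \<rho>star \<ge> ereal (4 / 5 * \<rho>star) \<longrightarrow>
       lam = 720 * Rad / (7 * sqrt (real N)) \<longrightarrow>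
       (\<forall>\<omega>\<in>space M. is_arg_min (\<lambda>f. empirical_risk N (\<lambda>i. XY i \<omega>) loss f + lam * nrm f)
          (\<lambda>f. f \<in> F) (fhat \<omega>)) \<longrightarrow>
       (\<exists>G\<in>sets M.
          measure M G > 1 - C1 * exp (- C2 * real N powr (1 / (2 * \<kappa>))
                                 * (\<rho>star * Rad) powr ((2 * \<kappa> - 1) / \<kappa>)) \<and>
          (\<forall>\<omega>\<in>G.
             nrm (fhat \<omega> - fstar) \<le> \<rho>star \<and>
             L2_norm (distr P MX fst) (fhat \<omega> - fstar) \<le> r (2 * \<rho>star) \<and>
             excess_risk P loss fstar (fhat \<omega>) \<le> r (2 * \<rho>star) powr (2 * \<kappa>) / A)) \<and>
       r (2 * \<rho>star) = (C * A * Rad * (2 * \<rho>star) / sqrt (real N)) powr (1 / (2 * \<kappa>)) \<and>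
       r (2 * \<rho>star) powr (2 * \<kappa>) / A = C * Rad * (2 * \<rho>star) / sqrt (real N))"
proof -
  define C2 where "C2 = 1024 / (384 * (3840 / 7 * A) powr (1 / \<kappa>) + 1024 * b powr (2 - 1 / \<kappa>))"
  have C2: "0 < C2"
    using assms by (auto simp: C2_def intro!: divide_pos_pos add_pos_nonneg)
  show ?thesis
  \<comment> \<open>The union bound loses 2 q with q = exp (- C2 Q). The choice C1 = 4 makes the
    inequality strict and, when q > 1/2, the claimed lower bound negative, so that the empty event
    serves.\<close>
  proof (rule exI[of _ 4], rule exI[of _ C2], intro conjI allI impI)
    show "(4 :: real) > 0" by simp
    show "C2 > 0" by (rule C2)
    fix M :: "'w measure" and MX :: "'x measure" and P N XY E nrm F loss fstar
    fix C Rad :: real and r :: "real \<Rightarrow> real" and \<rho>star lam :: real and fhat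
    assume erm: "regularized_erm M MX P N XY E nrm F loss fstar"
      and lip: "\<forall>f1\<in>F. \<forall>f2\<in>F. \<forall>x\<in>space MX. \<forall>y. \<bar>loss (f1 x) y - loss (f2 x) y\<bar> \<le> \<bar>f1 x - f2 x\<bar>"
      and bern: "\<forall>f\<in>F. L2_norm (distr P MX fst) (f - fstar) powr (2 * \<kappa>) \<le> A * excess_risk P loss fstar f"
      and bdd: "\<forall>f\<in>F. Linf_norm (distr P MX fst) f \<le> ereal b"
      and C: "C = 1920 / 7" and Rad: "0 \<le> Rad"
      and Rad_eq: "Rademacher_complexity (distr P MX fst) N (unit_ball E nrm) = ennreal Rad"
      and r: "r = (\<lambda>\<rho>. (C * A * Rad * \<rho> / sqrt (real N)) powr (1 / (2 * \<kappa>)))"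
      and \<rho>: "0 < \<rho>star"
      and sp: "sparsity_parameter (distr P MX fst) E nrm fstar r \<rho>star \<ge> ereal (4 / 5 * \<rho>star)"
      and lam: "lam = 720 * Rad / (7 * sqrt (real N))"
      and opt: "\<forall>\<omega>\<in>space M. is_arg_min (\<lambda>f. empirical_risk N (\<lambda>i. XY i \<omega>) loss f + lam * nrm f)
          (\<lambda>f. f \<in> F) (fhat \<omega>)"
    interpret regularized_erm M MX P N XY E nrm F loss fstar by (rule erm)
    define Q where "Q = real N powr (1 / (2 * \<kappa>)) * (\<rho>star * Rad) powr ((2 * \<kappa> - 1) / \<kappa>)"
    have expo: "- C2 * real N powr (1 / (2 * \<kappa>)) * (\<rho>star * Rad) powr ((2 * \<kappa> - 1) / \<kappa>) = - (C2 * Q)"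
      by (simp add: Q_def)
    show "r (2 * \<rho>star) = (C * A * Rad * (2 * \<rho>star) / sqrt (real N)) powr (1 / (2 * \<kappa>))"
      by (simp only: r)
    show "r (2 * \<rho>star) powr (2 * \<kappa>) / A = C * Rad * (2 * \<rho>star) / sqrt (real N)"
      using assms C Rad \<rho> by (simp add: r powr_powr)
    show "\<exists>G\<in>sets M.
        measure M G > 1 - 4 * exp (- C2 * real N powr (1 / (2 * \<kappa>)) * (\<rho>star * Rad) powr ((2 * \<kappa> - 1) / \<kappa>)) \<and>
        (\<forall>\<omega>\<in>G. nrm (fhat \<omega> - fstar) \<le> \<rho>star \<and>
           L2_norm (distr P MX fst) (fhat \<omega> - fstar) \<le> r (2 * \<rho>star) \<and>
           excess_risk P loss fstar (fhat \<omega>) \<le> r (2 * \<rho>star) powr (2 * \<kappa>) / A)"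
    proof (cases "exp (- (C2 * Q)) \<le> 1 / 2")
      case False
      then show ?thesis unfolding expo by (intro bexI[of _ "{}"]) auto
    next
      case True
      \<comment> \<open>A vanishing complexity gives Q = 0 and q = 1, which belongs to the other
        case; so the positivity assumed in \<open>sparse_erm\<close> is available here.\<close>
      have "Rad \<noteq> 0"
      proof
        assume "Rad = 0"
        with True show False by (simp add: Q_def)
      qed
      with Rad have Rad_pos: "0 < Rad" by simp
      have r_eq: "r = (\<lambda>\<rho>. (1920 / 7 * A * Rad * \<rho> / sqrt (real N)) powr (1 / (2 * \<kappa>)))"
        by (simp only: r C)
      interpret S: sparse_erm M MX P N XY E nrm F loss fstar b Rad A \<kappa> \<rho>star
        using assms lip bern bdd Rad Rad_pos Rad_eq \<rho> sp unfolding r_eq by unfold_locales auto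
      have rate: "r = S.rate" unfolding r_eq S.rate_def[abs_def] by simp
      have lam': "lam = 720 / 7 * S.unit_rate" by (simp add: lam S.unit_rate_def)
      have C2_eq: "C2 = S.tail_constant" by (simp add: C2_def S.tail_constant_def)
      obtain G where G: "G \<in> sets M" "1 - 2 * exp (- (C2 * Q)) \<le> measure M G"
        "\<And>\<omega> f. \<omega> \<in> G \<Longrightarrow> f \<in> F \<Longrightarrow> \<bar>S.deviation f \<omega>\<bar> \<le> 72 * S.unit_rate * S.radius f"
        using S.uniform_deviation True unfolding C2_eq Q_def by blast
      show ?thesis unfolding expo
      proof (intro bexI[OF _ G(1)] conjI ballI)
        show "measure M G > 1 - 4 * exp (- (C2 * Q))"
          using G(2) exp_gt_zero[of "- (C2 * Q)"] by linarith
        fix \<omega> assume \<omega>: "\<omega> \<in> G"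
        then have "\<omega> \<in> space M" using sets.sets_into_space[OF G(1)] by auto
        with opt have "is_arg_min (\<lambda>f. empirical_risk N (\<lambda>i. XY i \<omega>) loss f + 720 / 7 * S.unit_rate * nrm f)
          (\<lambda>f. f \<in> F) (fhat \<omega>)" unfolding lam' by blast
        note det = S.deterministic_bound[OF G(3)[OF \<omega>] this]
        show "nrm (fhat \<omega> - fstar) \<le> \<rho>star" by (rule det(1))
        show "L2_norm (distr P MX fst) (fhat \<omega> - fstar) \<le> r (2 * \<rho>star)" unfolding rate by (rule det(2))
        show "excess_risk P loss fstar (fhat \<omega>) \<le> r (2 * \<rho>star) powr (2 * \<kappa>) / A"
          unfolding rate by (rule det(3))
      qed
    qed
  qed
qed

end
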